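(* Let $p\in(0,1)$ and let $(X_n)_{n\in\mathbb{Z}}$ be a stationary, strongly mixing sequence of real-valued random variables with distribution function $F$ and strong mixing coefficients $\alpha(n)$. Let $t_p=F^{-1}(p)$. Assume that for some $M\neq 0$ $$F(t_p+h)-F(t_p)=Mh+o(h)\quad\text{as }h\to 0,$$ that $\sum_{n=1}^\infty\alpha(n)<\infty$, and that $\lim_{n\to\infty}\operatorname{Var}[\sqrt n F_n(t_p)]>0$. Consider the circular block bootstrap with block length $l=l_n$ chosen such that $\frac1l+\frac ln\to 0$ as $n\to\infty$. Then $$\sup_{t\in\mathbb{R}}\left|P^\star\bigl(F_n^{\star-1}(p)-F_n^{-1}(p)\le t\bigr)-P\bigl(F_n^{-1}(p)-t_p\le t\bigr)\right|\longrightarrow 0$$ in probability as $n\to\infty$.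
   Context: For a distribution function $G$ and $p\in(0,1)$, the $p$-quantile is $G^{-1}(p):=\inf\{t\in\mathbb{R}: G(t)\ge p\}$. The empirical distribution function is $F_n(t):=\frac1n\sum_{i=1}^n \mathbf{1}_{\{X_i\le t\}}$, and $F_n^{-1}(p)$ is its $p$-quantile. The strong mixing coefficients are $$\alpha(k):=\sup\{|P(A\cap B)-P(A)P(B)|: A\in\mathcal{F}_1^n,\ B\in\mathcal{F}_{n+k}^\infty,\ n\in\mathbb{Z}\},$$ where $\mathcal{F}_a^l$ is the $\sigma$-field generated by $X_a,\ldots,X_l$ (trivial if $l<a$); the sequence is strongly mixing if $\alpha(k)\to 0$ as $k\to\infty$. Circular block bootstrap: for each $n$, let $l=l_n\in\{1,\ldots,n\}$ be the block length and $b=\lfloor n/l\rfloor$. Extend the sample $X_1,\ldots,X_n$ periodically, i.e. in the resampling an index $i+n$ is read as $i$ ($X_{i+n}:=X_i$). The bootstrap sample $X_1^\star,\ldots,X_{bl}^\star$ consists of $b$ blocks of length $l$ which, conditionally on $(X_n)_{n\in\mathbb{N}}$, are independent, each one chosen uniformly: the starting index $j$ is uniform on $\{1,\ldots,n\}$, so that for $k=0,\ldots,b-1$ and $j=1,\ldots,n$ $$P^\star\bigl(X^\star_{kl+1}=X_j,\ldots,X^\star_{(k+1)l}=X_{j+l-1}\bigr)=\tfrac1n,$$ where $P^\star$ is the conditional probability given $(X_n)_{n\in\mathbb{N}}$. Set $F_n^\star(t):=\frac{1}{bl}\sum_{i=1}^{bl}\mathbf{1}_{\{X_i^\star\le t\}}$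 and let $F_n^{\star-1}(p)$ be its $p$-quantile. *)

theory Defs
  imports "HOL-Probability.Probability" "HOL-Library.Landau_Symbols"
begin

definition quantile :: "(real \<Rightarrow> real) \<Rightarrow> real \<Rightarrow> real" where
  "quantile G p = Inf {t. G t \<ge> p}"

definition ecdf :: "nat \<Rightarrow> (nat \<Rightarrow> real) \<Rightarrow> real \<Rightarrow> real" where
  "ecdf n x t = (1 / real n) * (\<Sum>i=1..n. indicat_real {..t} (x i))"

text \<open>Strict stationarity: the law of the whole two-sided sequence is shift invariant.\<close>

definition stationary :: "'a measure \<Rightarrow> (int \<Rightarrow> 'a \<Rightarrow> real) \<Rightarrow> bool" where
  "stationary M X \<longleftrightarrow>
     (\<forall>k. distr M (Pi\<^sub>M UNIV (\<lambda>_. borel)) (\<lambda>\<omega> i. X (i + k) \<omega>) =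
          distr M (Pi\<^sub>M UNIV (\<lambda>_. borel)) (\<lambda>\<omega> i. X i \<omega>))"

text \<open>For \<open>I = {}\<close> this is the trivial \<open>\<sigma>\<close>-field.\<close>

definition sigma_gen_by :: "'a measure \<Rightarrow> (int \<Rightarrow> 'a \<Rightarrow> real) \<Rightarrow> int set \<Rightarrow> 'a set set" where
  "sigma_gen_by M X I =
     sigma_sets (space M) {X i -` B \<inter> space M | i B. i \<in> I \<and> B \<in> sets borel}"

definition mixing_coeff :: "'a measure \<Rightarrow> (int \<Rightarrow> 'a \<Rightarrow> real) \<Rightarrow> nat \<Rightarrow> real" where
  "mixing_coeff M X k =
     Sup {\<bar>measure M (A \<inter> B) - measure M A * measure M B\<bar> | A B n.
            A \<in> sigma_gen_by M X {1..n} \<and> B \<in> sigma_gen_by M X {n + int k..}}"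

definition strongly_mixing :: "'a measure \<Rightarrow> (int \<Rightarrow> 'a \<Rightarrow> real) \<Rightarrow> bool" where
  "strongly_mixing M X \<longleftrightarrow> mixing_coeff M X \<longlonglongrightarrow> 0"

definition tendsto_in_prob ::
  "'a measure \<Rightarrow> (nat \<Rightarrow> 'a \<Rightarrow> real) \<Rightarrow> ('a \<Rightarrow> real) \<Rightarrow> bool" where
  "tendsto_in_prob M Y Z \<longleftrightarrow>
     (\<forall>n. Y n \<in> borel_measurable M) \<and> Z \<in> borel_measurable M \<and>
     (\<forall>\<epsilon>>0. (\<lambda>n. measure M {\<omega> \<in> space M. \<bar>Y n \<omega> - Z \<omega>\<bar> > \<epsilon>}) \<longlonglongrightarrow> 0)"

text \<open>
  Observations carry the indices \<open>1, \<dots>, n\<close>; \<open>periodic_ext n x\<close> extends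
  \<open>x 1, \<dots>, x n\<close> with period \<open>n\<close> to all indices \<open>m \<ge> 1\<close>.
\<close>

definition periodic_ext :: "nat \<Rightarrow> (nat \<Rightarrow> real) \<Rightarrow> nat \<Rightarrow> real" where
  "periodic_ext n x m = x ((m - 1) mod n + 1)"

text \<open>
  \<open>J k\<close> is the starting index of the \<open>k\<close>-th block (\<open>k = 0, 1, \<dots>\<close>). An index \<open>i \<ge> 1\<close>
  is written as \<open>i = k * l + r + 1\<close> with \<open>r < l\<close>.
\<close>

definition cbb_sample :: "nat \<Rightarrow> nat \<Rightarrow> (nat \<Rightarrow> real) \<Rightarrow> (nat \<Rightarrow> nat) \<Rightarrow> nat \<Rightarrow> real" where
  "cbb_sample n l x J i = periodic_ext n x (J ((i - 1) div l) + (i - 1) mod l)"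

text \<open>
  The conditional law of the bootstrap sample given that the observations are
  \<open>x 1, \<dots>, x n\<close>: the starting indices of the \<open>n div l\<close> blocks are independent and
  uniform on \<open>{1..n}\<close>. Only the first \<open>(n div l) * l\<close> coordinates are meaningful; the value
  \<open>1\<close> given to \<open>Pi_pmf\<close> is the unused default outside the index set.
\<close>

definition cbb_pmf :: "nat \<Rightarrow> nat \<Rightarrow> (nat \<Rightarrow> real) \<Rightarrow> (nat \<Rightarrow> real) pmf" where
  "cbb_pmf n l x =
     map_pmf (cbb_sample n l x) (Pi_pmf {..<n div l} 1 (\<lambda>_. pmf_of_set {1..n}))"

end

theory Submission
  imports Defs
begin

text \<open>
  The events \<open>F\<^sub>n\<^sup>-\<^sup>1(p) \<le> t\<close> and \<open>p \<le> F\<^sub>n(t)\<close> agree, so both distribution functions can be read off from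
  empirical distribution functions at points \<open>tp + y / sqrt n\<close>. There \<open>sqrt n (F\<^sub>n - p)\<close> is
  \<open>W\<^sub>n + D y + o(1)\<close> in probability with \<open>W\<^sub>n = sqrt n (F\<^sub>n(tp) - p)\<close>, which is asymptotically normal.
  Conditionally on the data, the bootstrap empirical distribution function is a mean of i.i.d. block
  means, and a Lindeberg argument gives \<open>P\<^sup>*(p \<le> F\<^sub>n\<^sup>*(tp + y / sqrt n)) = \<Phi>((W\<^sub>n + D y) / \<sigma>) + o(1)\<close>. Evaluating
  this at the random point \<open>F\<^sub>n\<^sup>-\<^sup>1(p) + t / sqrt n\<close>, where \<open>y \<approx> t - W\<^sub>n / D\<close>, cancels \<open>W\<^sub>n\<close>, so both
  distribution functions converge to \<open>\<Phi>(D t / \<sigma>)\<close>; monotonicity makes the convergence uniform.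

  The central limit theorem for \<open>W\<^sub>n\<close> needs only summable mixing coefficients: the characteristic
  function of the partial sums satisfies \<open>A\<^sub>k = A\<^sub>k\<^sub>-\<^sub>1 (1 - v\<^sup>2 \<sigma>\<^sup>2 / 2) + o(1/n)\<close> with \<open>v = u / sqrt n\<close>, because
  \<open>E[exp(i v S\<^sub>k\<^sub>-\<^sub>1) Y\<^sub>k]\<close> telescopes into lagged covariances. Uniform integrability of the squared
  block sums, which replaces moment bounds in the Lindeberg condition, follows from the central limit
  theorem together with the convergence of variances.
\<close>

subsection \<open>Quantiles and the normal distribution function\<close>

text \<open>Two obstacles shape the proof. The levels at which distribution functions are evaluated
  move with \<open>n\<close> and, for the bootstrap, are random. No functional limit theorem is
  invoked for this: the lag-\<open>k\<close> covariance of the indicators of an event of probability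
  \<open>x\<close> is at most \<open>min (\<alpha> k) x\<close>, so the normalised variance of an
  increment is at most a multiple of \<open>\<kappa> x\<close>, the sum of these minima, which
  vanishes with \<open>x\<close> by dominated convergence. Hence, for fixed \<open>y\<close>,
  fluctuations at \<open>tp + y / sqrt n\<close> may be replaced by those at \<open>tp\<close>, and
  finitely many \<open>y\<close> suffice because distribution functions are monotone. Second, the
  conditional variance is an average of squared block sums, and a direct weak law for these would
  call for fourth moments. The squares are truncated at a level \<open>m\<close>, fixed before
  \<open>n\<close> grows: the weak law then concerns bounded functions, and the limits are integrals
  against the normal law. Since the supremum runs over all \<open>t\<close>, rescaling
  \<open>t\<close> by \<open>sqrt n\<close> does not change it, so no normalisation appears in the
  theorem.\<close>

abbreviation Phi :: "real \<Rightarrow> real" where "Phi \<equiv> cdf std_normal_distribution"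

text \<open>Right continuity puts the infimum into the level set, and monotonicity makes that set
  upward closed. The two existence hypotheses keep it nonempty and bounded below, as
  \<open>Inf\<close> on the reals requires.\<close>

lemma quantile_le_iff:
  assumes "mono G" and "\<And>t. continuous (at_right t) G" and "\<exists>t. p \<le> G t" and "\<exists>t. G t < p"
  shows "quantile G p \<le> t \<longleftrightarrow> p \<le> G t"
proof -
  let ?A = "{t. p \<le> G t}"
  obtain a where a: "G a < p" using assms(4) by auto
  have bdd: "bdd_below ?A"
    by (rule bdd_belowI[of _ a]) (use a assms(1) in \<open>auto simp: mono_def dest: order.strict_trans2 intro!: leI\<close>, meson le_cases less_le_not_le order_trans)
  have ne: "?A \<noteq> {}" using assms(3) by auto
  have "p \<le> G (Inf ?A)"
  proof (rule tendsto_lowerbound)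
    show "(G \<longlongrightarrow> G (Inf ?A)) (at_right (Inf ?A))"
      using assms(2) by (simp add: continuous_within)
    show "\<forall>\<^sub>F x in at_right (Inf ?A). p \<le> G x"
      unfolding eventually_at_right_field
    proof (intro exI[of _ "Inf ?A + 1"] conjI allI impI)
      fix y assume "Inf ?A < y"
      then obtain z where "z \<in> ?A" "z < y" using cInf_lessD[OF ne] by auto
      then show "p \<le> G y" using assms(1) by (auto simp: mono_def intro: order_trans[OF _ monoD[OF assms(1)]])
    qed simp
  qed simp
  moreover have "Inf ?A \<le> t" if "p \<le> G t" using that bdd by (auto intro: cInf_lower)
  ultimately show ?thesis unfolding quantile_def
    using monoD[OF assms(1), of "Inf ?A" t] by auto
qed

lemma mono_ecdf: "mono (ecdf n x)"
  unfolding mono_def ecdf_def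
  by (intro allI impI mult_left_mono sum_mono) (auto simp: indicator_def)

lemma ecdf_right_continuous: "continuous (at_right t) (ecdf n x)"
proof -
  have "continuous (at_right t) (\<lambda>t. indicat_real {..t} c)" for c :: real
  proof (cases "c \<le> t")
    case True
    have "\<forall>\<^sub>F u in at_right t. indicat_real {..u} c = indicat_real {..t} c"
      using True by (auto simp: eventually_at_right_field indicator_def intro!: exI[of _ "t+1"])
    then show ?thesis by (auto simp: continuous_within intro: tendsto_eventually)
  next
    case False
    have "\<forall>\<^sub>F u in at_right t. indicat_real {..u} c = indicat_real {..t} c"
      using False by (auto simp: eventually_at_right_field indicator_def intro!: exI[of _ c])
    then show ?thesis by (auto simp: continuous_within intro: tendsto_eventually)
  qed
  then show ?thesis unfolding ecdf_def by (intro continuous_intros)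
qed

lemma quantile_ecdf_le_iff:
  assumes "1 \<le> n" "0 < p" "p < 1"
  shows "quantile (ecdf n x) p \<le> t \<longleftrightarrow> p \<le> ecdf n x t"
proof (rule quantile_le_iff[OF mono_ecdf ecdf_right_continuous])
  have "ecdf n x (Max (x ` {1..n})) = 1"
    using assms(1) by (auto simp: ecdf_def indicator_def intro!: Max_ge)
  then show "\<exists>t. p \<le> ecdf n x t" using assms(3) by (metis less_imp_le)
  have "ecdf n x (Min (x ` {1..n}) - 1) = 0"
  proof -
    have "Min (x ` {1..n}) - 1 < x i" if "i \<in> {1..n}" for i
      proof -
      have "Min (x ` {1..n}) \<le> x i" using that by (intro Min_le) auto
      then show ?thesis by linarith
    qed
    then show ?thesis by (force simp: ecdf_def indicator_def intro!: sum.neutral)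
  qed
  then show "\<exists>t. ecdf n x t < p" using assms(2) by metis
qed

section \<open>Uniform approximation of distribution functions from a finite grid\<close>

text \<open>Outside the interval from \<open>a\<close> to \<open>b\<close> the function
  \<open>H\<close> is within \<epsilon> of 0 or 1; inside, neighbouring grid points change
  \<open>H\<close> by less than \<epsilon>, so monotonicity squeezes \<open>G\<close> between its
  grid values. \<open>T\<close> is found before \<open>G\<close>, so one finite set serves all
  random distribution functions.\<close>

lemma polya_grid:
  fixes H :: "real \<Rightarrow> real"
  assumes cont: "\<And>x. isCont H x" and mono: "mono H" and bot: "(H \<longlongrightarrow> 0) at_bot" and top: "(H \<longlongrightarrow> 1) at_top"
    and eps: "\<epsilon> > 0"
  shows "\<exists>T. finite T \<and> (\<forall>G. mono G \<and> (\<forall>t. 0 \<le> G t \<and> G t \<le> 1) \<and> (\<forall>t\<in>T. \<bar>G t - H t\<bar> \<le> \<epsilon>) \<longrightarrow>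
           (\<forall>t. \<bar>G t - H t\<bar> \<le> 2 * \<epsilon>))"
proof -
  obtain a where a: "H a < \<epsilon>" using order_tendstoD(2)[OF bot eps] by (auto simp: eventually_at_bot_linorder)
  obtain b0 where b0: "\<And>x. x \<ge> b0 \<Longrightarrow> H x > 1 - \<epsilon>"
    using order_tendstoD(1)[OF top, of "1 - \<epsilon>"] eps by (auto simp: eventually_at_top_linorder)
  define b where "b = max a b0"
  have ab: "a \<le> b" and b: "H b > 1 - \<epsilon>" using b0 by (auto simp: b_def)
  have H0: "0 \<le> H x" for x
    by (rule tendsto_upperbound[OF bot]) (auto simp: eventually_at_bot_linorder intro!: exI[of _ x] monoD[OF mono])
  have H1: "H x \<le> 1" for x
    by (rule tendsto_lowerbound[OF top]) (auto simp: eventually_at_top_linorder intro!: exI[of _ x] monoD[OF mono])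
  have "uniformly_continuous_on {a..b+1} H"
    by (rule compact_uniformly_continuous) (auto intro: continuous_at_imp_continuous_on cont)
  then obtain d where d: "d > 0" "\<And>x y. x \<in> {a..b+1} \<Longrightarrow> y \<in> {a..b+1} \<Longrightarrow> \<bar>x - y\<bar> < d \<Longrightarrow> \<bar>H x - H y\<bar> < \<epsilon>"
    using eps unfolding uniformly_continuous_on_def dist_real_def by metis
  \<comment> \<open>Below \<open>d\<close> for uniform continuity, and at most 1 so that the grid
    point to the right of any \<open>t < b\<close> stays in \<open>{a..b+1}\<close>.\<close>
  define e where "e = min (d/2) 1"
  have e: "e > 0" "e < d" "e \<le> 1" using d by (auto simp: e_def)
  define T where "T = (\<lambda>i::int. a + of_int i * e) ` {0..\<lceil>(b - a)/e\<rceil>} \<union> {b}"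
  show ?thesis
  proof (intro exI[of _ T] conjI allI impI)
    show "finite T" by (simp add: T_def)
    fix G t assume G: "mono G \<and> (\<forall>t. 0 \<le> G t \<and> G t \<le> 1) \<and> (\<forall>t\<in>T. \<bar>G t - H t\<bar> \<le> \<epsilon>)"
    then have mG: "x \<le> y \<Longrightarrow> G x \<le> G y" and G0: "0 \<le> G x" and G1: "G x \<le> 1"
      and GT: "x \<in> T \<Longrightarrow> \<bar>G x - H x\<bar> \<le> \<epsilon>" for x y by (auto simp: mono_def)
    have "0 \<le> (b - a) / e" using ab e by simp
    then have "0 \<le> \<lceil>(b - a) / e\<rceil>" by linarith
    then have "a \<in> T" by (auto simp: T_def intro!: image_eqI[where x=0])
    have "b \<in> T" by (simp add: T_def)
    have mH: "x \<le> y \<Longrightarrow> H x \<le> H y" for x y using mono by (auto simp: mono_def)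
    consider "t < a" | "t \<ge> b" | "a \<le> t" "t < b" by linarith
    then show "\<bar>G t - H t\<bar> \<le> 2 * \<epsilon>"
    proof cases
      case 1
      then show ?thesis using mG[of t a] mH[of t a] GT[OF \<open>a \<in> T\<close>] a H0[of t] G0[of t] by linarith
    next
      case 2
      then show ?thesis using mG[of b t] mH[of b t] GT[OF \<open>b \<in> T\<close>] b H1[of t] G1[of t] by linarith
    next
      case 3
      define i where "i = \<lfloor>(t - a)/e\<rfloor>"
      have i0: "0 \<le> i" using 3 e by (simp add: i_def)
      have "of_int i \<le> (t-a)/e" "(t-a)/e < of_int i + 1" by (auto simp: i_def)
      then have i: "a + of_int i * e \<le> t" "t < a + of_int (i+1) * e"
        using e by (simp_all add: field_simps)
      have "(t - a)/e < (b - a)/e" using 3 e by (simp add: divide_strict_right_mono)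
      then have "i < \<lceil>(b-a)/e\<rceil>" unfolding i_def by linarith
      then have T1: "a + of_int i * e \<in> T" "a + of_int (i+1) * e \<in> T"
        using i0 unfolding T_def by (simp_all only: Un_iff) (auto simp del: of_int_add)
      have step: "a + of_int (i+1) * e = a + of_int i * e + e" by (simp add: algebra_simps)
      have ge: "0 \<le> of_int i * e" using i0 e by simp
      have "\<bar>H (a + of_int i * e) - H t\<bar> < \<epsilon>"
        by (rule d(2)) (use i step e 3 ge in auto)
      moreover have "\<bar>H (a + of_int (i+1) * e) - H t\<bar> < \<epsilon>"
        by (rule d(2)) (use i step e 3 ge in auto)
      ultimately show ?thesis
        using GT[OF T1(1)] GT[OF T1(2)] mG[OF i(1)] mG[OF less_imp_le[OF i(2)]] by linarith
    qed
  qed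
qed

text \<open>The normal density is bounded by \<open>1 / sqrt (2 * pi)\<close>, hence by 1. The crude
  constant suffices to move errors in the argument outside \<open>Phi\<close>.\<close>

lemma Phi_lipschitz: "\<bar>Phi x - Phi y\<bar> \<le> \<bar>x - y\<bar>"
proof -
  interpret N: real_distribution std_normal_distribution by (rule real_dist_normal_dist)
  have *: "Phi b - Phi a \<le> b - a" if "a < b" for a b
  proof -
    have "ennreal (Phi b - Phi a) = emeasure std_normal_distribution {a<..b}"
      using that by (simp add: N.cdf_diff_eq N.emeasure_eq_measure)
    also have "\<dots> = (\<integral>\<^sup>+x. ennreal (std_normal_density x) * indicator {a<..b} x \<partial>lborel)"
      by (subst emeasure_density) auto
    also have "\<dots> \<le> (\<integral>\<^sup>+x. indicator {a<..b} x \<partial>lborel)"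
    proof (rule nn_integral_mono)
      fix x :: real
      have "1 \<le> sqrt (2 * pi)" using pi_ge_two by simp
      then have "std_normal_density x \<le> 1 * 1" unfolding std_normal_density_def
        by (intro mult_mono) auto
      then show "ennreal (std_normal_density x) * indicator {a<..b} x \<le> indicator {a<..b} x"
        by (auto simp: indicator_def)
    qed
    also have "\<dots> = ennreal (b - a)" using that by simp
    finally show ?thesis using that by (simp add: ennreal_le_iff)
  qed
  have "Phi x \<le> Phi y \<longleftrightarrow> Phi x \<le> Phi y" "x \<le> y \<Longrightarrow> Phi x \<le> Phi y" "y \<le> x \<Longrightarrow> Phi y \<le> Phi x"
    by (auto intro: N.cdf_nondecreasing)
  then show ?thesis using *[of x y] *[of y x] by (cases x y rule: linorder_cases) auto
qed

lemma isCont_Phi: "isCont Phi x"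
  unfolding isCont_def tendsto_iff dist_real_def eventually_at
  by (metis Phi_lipschitz le_less_trans)

lemma polya_grid_Phi:
  assumes "c > 0" "\<epsilon> > 0"
  shows "\<exists>T. finite T \<and> (\<forall>G. mono G \<and> (\<forall>t. 0 \<le> G t \<and> G t \<le> 1) \<and> (\<forall>t\<in>T. \<bar>G t - Phi (c * t)\<bar> \<le> \<epsilon>) \<longrightarrow>
           (\<forall>t. \<bar>G t - Phi (c * t)\<bar> \<le> 2 * \<epsilon>))"
proof (rule polya_grid)
  interpret N: real_distribution std_normal_distribution by (rule real_dist_normal_dist)
  show "isCont (\<lambda>t. Phi (c * t)) x" for x
    by (rule isCont_o2[OF _ isCont_Phi]) auto
  show "mono (\<lambda>t. Phi (c * t))" using assms by (auto simp: mono_def intro!: N.cdf_nondecreasing)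
  show "((\<lambda>t. Phi (c * t)) \<longlongrightarrow> 0) at_bot"
    by (rule filterlim_compose[OF N.cdf_lim_at_bot]) 
       (rule filterlim_tendsto_pos_mult_at_bot[OF tendsto_const \<open>c>0\<close> filterlim_ident])
  show "((\<lambda>t. Phi (c * t)) \<longlongrightarrow> 1) at_top"
    by (rule filterlim_compose[OF N.cdf_lim_at_top_prob])
       (rule filterlim_tendsto_pos_mult_at_top[OF tendsto_const \<open>c>0\<close> filterlim_ident])
qed fact

section \<open>The central limit theorem for i.i.d. arrays\<close>

text \<open>The truncation error \<open>U\<close> takes the place of the Lindeberg sum.\<close>

lemma iid_char_estimate:
  fixes q :: "'b pmf" and \<xi> :: "'b \<Rightarrow> real"
  assumes fin: "finite (set_pmf q)" and mean: "measure_pmf.expectation q \<xi> = 0"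
    and \<sigma>: "\<sigma> > 0" and b: "b \<ge> 1" "t\<^sup>2 / 4 \<le> real b" and K: "K \<ge> 0"
  defines "V \<equiv> measure_pmf.expectation q (\<lambda>x. (\<xi> x)\<^sup>2)"
    and "U \<equiv> measure_pmf.expectation q (\<lambda>x. (\<xi> x)\<^sup>2 - min ((\<xi> x)\<^sup>2) K)"
  shows "cmod (char (distr (Pi_pmf {..<b} d (\<lambda>_. q)) borel (\<lambda>J. (\<Sum>k<b. \<xi> (J k)) / sqrt b / \<sigma>)) t
            - of_real (1 + (- (t\<^sup>2) / 2) / b) ^ b)
     \<le> t\<^sup>2 / 2 * \<bar>V / \<sigma>\<^sup>2 - 1\<bar> + t\<^sup>2 / \<sigma>\<^sup>2 * (2 * U + \<bar>t\<bar> / \<sigma> * sqrt (2 * K / b) * V)"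
proof -
  let ?P = "Pi_pmf {..<b} d (\<lambda>_. q)"
  define s where "s = t / (sqrt b * \<sigma>)"
  define \<nu> where "\<nu> = distr q borel \<xi>"
  have int[simp]: "integrable (measure_pmf q) f" for f :: "'b \<Rightarrow> real" by (rule integrable_measure_pmf_finite[OF fin])
  interpret \<nu>: real_distribution \<nu> unfolding \<nu>_def by (rule prob_space.real_distribution_distr[OF measure_pmf.prob_space_axioms]) simp
  have ind: "prob_space.indep_vars ?P (\<lambda>_. borel) (\<lambda>k J. \<xi> (J k) / sqrt b / \<sigma>) {..<b}"
  proof -
    have "prob_space.indep_vars ?P (\<lambda>_. count_space UNIV) (\<lambda>k J. J k) {..<b}"
      by (rule indep_vars_Pi_pmf) simp
    then show ?thesis
      by (rule prob_space.indep_vars_compose2[OF measure_pmf.prob_space_axioms, where Y="\<lambda>_ x. \<xi> x / sqrt b / \<sigma>"]) simp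
  qed
  have comp: "char (distr ?P borel (\<lambda>J. \<xi> (J k) / sqrt b / \<sigma>)) t = char \<nu> s" if "k < b" for k
  proof -
    have "map_pmf (\<lambda>J. J k) ?P = q" using that by (simp add: Pi_pmf_component)
    then have "char \<nu> s = char (distr (map_pmf (\<lambda>J. J k) ?P) borel \<xi>) s" by (simp add: \<nu>_def)
    also have "\<dots> = (CLINT J|?P. iexp (s * \<xi> (J k)))"
      by (simp add: char_def integral_distr)
    also have "\<dots> = char (distr ?P borel (\<lambda>J. \<xi> (J k) / sqrt b / \<sigma>)) t"
      by (simp add: char_def integral_distr s_def field_simps)
    finally show ?thesis ..
  qed
  have "char (distr ?P borel (\<lambda>J. (\<Sum>k<b. \<xi> (J k)) / sqrt b / \<sigma>)) t
      = char (distr ?P borel (\<lambda>J. \<Sum>k<b. \<xi> (J k) / sqrt b / \<sigma>)) t"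
    by (simp add: sum_divide_distrib)
  also have "\<dots> = (\<Prod>k<b. char (distr ?P borel (\<lambda>J. \<xi> (J k) / sqrt b / \<sigma>)) t)"
    by (rule prob_space.char_distr_sum[OF measure_pmf.prob_space_axioms ind])
  also have "\<dots> = char \<nu> s ^ b" using comp by simp
  finally have \<phi>: "char (distr ?P borel (\<lambda>J. (\<Sum>k<b. \<xi> (J k)) / sqrt b / \<sigma>)) t = char \<nu> s ^ b" .
  have Vs: "measure_pmf.variance q \<xi> = V" by (simp add: V_def mean)
  have V0: "0 \<le> V" unfolding V_def by (rule Bochner_Integration.integral_nonneg) simp
  have s2: "s\<^sup>2 = t\<^sup>2 / (b * \<sigma>\<^sup>2)" using b by (simp add: s_def power_divide power_mult_distrib)
  \<comment> \<open>The cut is at \<open>2 * K\<close>, not \<open>K\<close>: above it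
    \<open>x\<^sup>2 - K\<close> is at least half of \<open>x\<^sup>2\<close>, so the truncation
    error controls the whole square; below it one factor \<bar>x\<bar> is at most
    \<open>sqrt (2 * K)\<close>.\<close>
  have pt: "min (6 * x\<^sup>2) (\<bar>s\<bar> * \<bar>x\<bar>^3) \<le> 12 * (x\<^sup>2 - min (x\<^sup>2) K) + \<bar>s\<bar> * sqrt (2*K) * x\<^sup>2" for x
  proof (cases "x\<^sup>2 \<le> 2 * K")
    case True
    then have "\<bar>x\<bar> \<le> sqrt (2 * K)" by (metis real_sqrt_abs real_sqrt_le_iff)
    then have "\<bar>s\<bar> * (\<bar>x\<bar> * x\<^sup>2) \<le> \<bar>s\<bar> * (sqrt (2*K) * x\<^sup>2)" by (intro mult_left_mono mult_right_mono) auto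
    moreover have "\<bar>x\<bar>^3 = \<bar>x\<bar> * x\<^sup>2" by (simp add: power3_eq_cube power2_eq_square)
    moreover have "0 \<le> 12 * (x\<^sup>2 - min (x\<^sup>2) K)" by simp
    ultimately show ?thesis by (simp only: mult.assoc) (meson add_increasing min.coboundedI2)
  next
    case False
    then have "6 * x\<^sup>2 \<le> 12 * (x\<^sup>2 - min (x\<^sup>2) K)" using K by (simp add: min_def)
    moreover have "0 \<le> \<bar>s\<bar> * sqrt (2*K) * x\<^sup>2" using K by simp
    ultimately show ?thesis by linarith
  qed
  have "cmod (char \<nu> s - (1 - s\<^sup>2 * V / 2)) \<le> (s\<^sup>2 / 6) * measure_pmf.expectation q (\<lambda>x. min (6 * (\<xi> x)\<^sup>2) (\<bar>s\<bar> * \<bar>\<xi> x\<bar>^3))"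
    by (rule prob_space.char_approx3'[OF measure_pmf.prob_space_axioms _ _ _ mean Vs \<nu>_def]) auto
  also have "\<dots> \<le> (s\<^sup>2 / 6) * measure_pmf.expectation q (\<lambda>x. 12 * ((\<xi> x)\<^sup>2 - min ((\<xi> x)\<^sup>2) K) + \<bar>s\<bar> * sqrt (2*K) * (\<xi> x)\<^sup>2)"
    by (intro mult_left_mono integral_mono pt) auto
  also have "\<dots> = (s\<^sup>2 / 6) * (12 * U + \<bar>s\<bar> * sqrt (2*K) * V)"
    unfolding U_def V_def by (subst Bochner_Integration.integral_add) (simp_all only: int integral_mult_right_zero)
  also have "\<dots> \<le> s\<^sup>2 * (2 * U + \<bar>s\<bar> * sqrt (2*K) * V)"
    using V0 K by (simp add: algebra_simps)
  finally have 1: "cmod (char \<nu> s - (1 - s\<^sup>2 * V / 2)) \<le> s\<^sup>2 * (2 * U + \<bar>s\<bar> * sqrt (2*K) * V)" .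
  let ?w = "1 + (- (t\<^sup>2) / 2) / real b"
  have 2: "cmod ((1 - s\<^sup>2 * V / 2) - of_real ?w) \<le> t\<^sup>2 / (2 * b) * \<bar>V / \<sigma>\<^sup>2 - 1\<bar>"
  proof -
    have "(1 - s\<^sup>2 * V / 2) - ?w = - (t\<^sup>2 / (2 * b) * (V / \<sigma>\<^sup>2 - 1))"
      using b \<sigma> by (simp add: s2 field_simps)
    then have "\<bar>(1 - s\<^sup>2 * V / 2) - ?w\<bar> = t\<^sup>2 / (2 * b) * \<bar>V / \<sigma>\<^sup>2 - 1\<bar>"
      by (simp add: abs_mult)
    moreover have "(1 - s\<^sup>2 * V / 2) - of_real ?w = complex_of_real ((1 - s\<^sup>2 * V / 2) - ?w)" by simp
    ultimately show ?thesis by (simp only: norm_of_real)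
  qed
  \<comment> \<open>Comparing \<open>b\<close>-th powers costs only a factor \<open>b\<close>
    because both bases have modulus at most 1; for the real base this is
    \<open>t\<^sup>2 / 4 \<le> real b\<close>.\<close>
  have "cmod (char \<nu> s ^ b - of_real ?w ^ b) \<le> b * cmod (char \<nu> s - of_real ?w)"
    by (rule norm_power_diff[OF \<nu>.cmod_char_le_1])
       (use b in \<open>simp only: norm_of_real abs_le_iff, simp add: divide_le_eq\<close>)
  also have "\<dots> \<le> b * (s\<^sup>2 * (2 * U + \<bar>s\<bar> * sqrt (2*K) * V) + t\<^sup>2 / (2 * b) * \<bar>V / \<sigma>\<^sup>2 - 1\<bar>)"
    using norm_triangle_le[OF add_mono[OF 1 2]] by (intro mult_left_mono) (auto simp: algebra_simps)
  also have "\<dots> = t\<^sup>2 / 2 * \<bar>V / \<sigma>\<^sup>2 - 1\<bar> + t\<^sup>2 / \<sigma>\<^sup>2 * (2 * U + \<bar>s\<bar> * sqrt (2*K) * V)"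
    using b \<sigma> by (simp add: s2 distrib_left)
  also have "\<bar>s\<bar> * sqrt (2*K) = \<bar>t\<bar> / \<sigma> * sqrt (2 * K / b)"
    using b \<sigma> by (simp add: s_def abs_mult real_sqrt_divide)
  finally show ?thesis unfolding \<phi> .
qed

text \<open>The threshold for \<open>b\<close> may depend on the truncation level \<open>K\<close>, but the tolerance \<open>\<delta>\<close> may
  not: in the application \<open>K\<close> is chosen after \<open>\<delta>\<close> by uniform integrability.\<close>

theorem iid_clt_uniform:
  fixes \<sigma> \<epsilon> :: real
  assumes \<sigma>: "\<sigma> > 0" and \<epsilon>: "\<epsilon> > 0"
  shows "\<exists>\<delta>>0. \<forall>K\<ge>0. \<exists>N::nat. \<forall>b\<ge>N. \<forall>(q :: 'b pmf) \<xi>. finite (set_pmf q) \<longrightarrow>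
     measure_pmf.expectation q \<xi> = 0 \<longrightarrow>
     \<bar>measure_pmf.expectation q (\<lambda>x. (\<xi> x)\<^sup>2) - \<sigma>\<^sup>2\<bar> < \<delta> \<longrightarrow>
     measure_pmf.expectation q (\<lambda>x. (\<xi> x)\<^sup>2 - min ((\<xi> x)\<^sup>2) K) < \<delta> \<longrightarrow>
     (\<forall>x. \<bar>measure_pmf.prob (Pi_pmf {..<b} d (\<lambda>_. q)) {J. (\<Sum>k<b. \<xi> (J k)) / sqrt (real b) \<le> x} - Phi (x / \<sigma>)\<bar> \<le> \<epsilon>)"
proof (rule ccontr)
  define ok where "ok \<delta> K b q \<xi> \<longleftrightarrow> (finite (set_pmf q) \<longrightarrow>
     measure_pmf.expectation q \<xi> = 0 \<longrightarrow>
     \<bar>measure_pmf.expectation q (\<lambda>x. (\<xi> x)\<^sup>2) - \<sigma>\<^sup>2\<bar> < \<delta> \<longrightarrow>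
     measure_pmf.expectation q (\<lambda>x. (\<xi> x)\<^sup>2 - min ((\<xi> x)\<^sup>2) K) < \<delta> \<longrightarrow>
     (\<forall>x. \<bar>measure_pmf.prob (Pi_pmf {..<b} d (\<lambda>_. q)) {J. (\<Sum>k<b. \<xi> (J k)) / sqrt (real b) \<le> x} - Phi (x / \<sigma>)\<bar> \<le> \<epsilon>))"
    for \<delta> K :: real and b :: nat and q :: "'b pmf" and \<xi>
  assume "\<not> ?thesis"
  then have neg: "\<not> (\<exists>\<delta>>0. \<forall>K\<ge>0. \<exists>N. \<forall>b\<ge>N. \<forall>q \<xi>. ok \<delta> K b q \<xi>)"
    unfolding ok_def .
  \<comment> \<open>Failure of uniformity yields one offending triple per tolerance. Asking for
    \<open>b\<close> at least \<open>Suc m * (nat \<lceil>K\<rceil> + 1)\<close> forces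
    \<open>K / b\<close> to 0, which removes the last error term of
    \<open>iid_char_estimate\<close>; the resulting array obeys the central limit theorem, a
    contradiction.\<close>
  have "\<exists>K b q \<xi>. K \<ge> 0 \<and> b \<ge> Suc m * (nat \<lceil>K\<rceil> + 1) \<and> \<not> ok (inverse (real (Suc m))) K b q \<xi>" for m
  proof (rule ccontr)
    assume "\<not> ?thesis"
    then have "\<forall>K\<ge>0. \<exists>N. \<forall>b\<ge>N. \<forall>q \<xi>. ok (inverse (real (Suc m))) K b q \<xi>" by blast
    moreover have "inverse (real (Suc m)) > 0" by simp
    ultimately show False using neg by blast
  qed
  then obtain K b q \<xi> where K0: "\<And>m. K m \<ge> 0" and bK: "\<And>m. b m \<ge> Suc m * (nat \<lceil>K m\<rceil> + 1)"
    and nok: "\<And>m. \<not> ok (inverse (real (Suc m))) (K m) (b m) (q m) (\<xi> m)"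
    by metis
  have fin: "finite (set_pmf (q m))" and mean: "measure_pmf.expectation (q m) (\<xi> m) = 0"
    and V: "\<bar>measure_pmf.expectation (q m) (\<lambda>x. (\<xi> m x)\<^sup>2) - \<sigma>\<^sup>2\<bar> < inverse (real (Suc m))"
    and U: "measure_pmf.expectation (q m) (\<lambda>x. (\<xi> m x)\<^sup>2 - min ((\<xi> m x)\<^sup>2) (K m)) < inverse (real (Suc m))"
    and bad: "\<not> (\<forall>x. \<bar>measure_pmf.prob (Pi_pmf {..<b m} d (\<lambda>_. q m)) {J. (\<Sum>k<b m. \<xi> m (J k)) / sqrt (b m) \<le> x} - Phi (x / \<sigma>)\<bar> \<le> \<epsilon>)" for m
    using nok[of m] unfolding ok_def by blast+
  let ?P = "\<lambda>m. Pi_pmf {..<b m} d (\<lambda>_. q m)"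
  define Z where "Z m J = (\<Sum>k<b m. \<xi> m (J k)) / sqrt (b m) / \<sigma>" for m J
  have b: "b m \<ge> Suc m" for m 
  proof -
    have "Suc m = Suc m * 1" by (rule mult_1_right[symmetric])
    also have "Suc m * 1 \<le> Suc m * (nat \<lceil>K m\<rceil> + 1)" by (rule mult_le_mono2) simp
    also note bK[of m]
    finally show ?thesis .
  qed
  have blim: "filterlim b at_top sequentially"
    by (rule filterlim_at_top_mono[OF filterlim_Suc]) (intro always_eventually allI b)
  have inv0: "(\<lambda>m. inverse (real (Suc m))) \<longlonglongrightarrow> 0" by (rule LIMSEQ_inverse_real_of_nat)
  define v where "v m = measure_pmf.expectation (q m) (\<lambda>x. (\<xi> m x)\<^sup>2)" for m
  define w where "w m = measure_pmf.expectation (q m) (\<lambda>x. (\<xi> m x)\<^sup>2 - min ((\<xi> m x)\<^sup>2) (K m))" for m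
  have vlim: "v \<longlonglongrightarrow> \<sigma>\<^sup>2"
    by (rule LIM_zero_cancel, rule Lim_null_comparison[OF always_eventually inv0])
       (simp only: v_def real_norm_def less_imp_le[OF V] simp_thms)
  have w0: "0 \<le> w m" for m unfolding w_def by (rule Bochner_Integration.integral_nonneg) simp
  have wlim: "w \<longlonglongrightarrow> 0"
    by (rule Lim_null_comparison[OF always_eventually inv0])
       (simp only: real_norm_def abs_of_nonneg[OF w0] less_imp_le[OF U[folded w_def]] simp_thms)
  have Kb: "(\<lambda>m. K m / b m) \<longlonglongrightarrow> 0"
  proof (rule Lim_null_comparison[OF _ inv0], rule always_eventually, rule allI)
    fix m
    have "K m \<le> real (nat \<lceil>K m\<rceil> + 1)" using K0[of m] by linarith
    then have "real (Suc m) * K m \<le> real (Suc m) * real (nat \<lceil>K m\<rceil> + 1)" by (intro mult_left_mono) auto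
    also have "\<dots> \<le> b m" using bK[of m] by (metis of_nat_le_iff of_nat_mult)
    finally have "K m \<le> real (b m) * inverse (Suc m)" by (simp add: field_simps)
    then show "norm (K m / b m) \<le> inverse (Suc m)" using K0[of m] b[of m] by (simp add: divide_le_eq mult.commute)
  qed
  have "weak_conv_m (\<lambda>m. distr (?P m) borel (Z m)) std_normal_distribution"
  proof (rule levy_continuity)
    fix t
    have "(\<lambda>m. complex_of_real (1 + (- (t\<^sup>2) / 2) / b m) ^ b m) \<longlonglongrightarrow> complex_of_real (exp (- (t\<^sup>2) / 2))"
    proof -
      have "(\<lambda>m. (1 + (- (t\<^sup>2) / 2) / b m) ^ b m) \<longlonglongrightarrow> exp (- (t\<^sup>2) / 2)"
        by (rule filterlim_compose[OF tendsto_exp_limit_sequentially blim])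
      then show ?thesis by (subst of_real_power[symmetric]) (rule tendsto_of_real)
    qed
    moreover have "(\<lambda>m. char (distr (?P m) borel (Z m)) t - complex_of_real (1 + (- (t\<^sup>2) / 2) / b m) ^ b m) \<longlonglongrightarrow> 0"
    proof (rule Lim_null_comparison)
      show "\<forall>\<^sub>F m in sequentially. norm (char (distr (?P m) borel (Z m)) t - complex_of_real (1 + (- (t\<^sup>2) / 2) / b m) ^ b m)
         \<le> t\<^sup>2 / 2 * \<bar>v m / \<sigma>\<^sup>2 - 1\<bar> + t\<^sup>2 / \<sigma>\<^sup>2 * (2 * w m + \<bar>t\<bar> / \<sigma> * sqrt (2 * (K m / b m)) * v m)"
        using eventually_ge_at_top[of "nat \<lceil>t\<^sup>2 / 4\<rceil>"]
      proof eventually_elim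
        case (elim m)
        then have "t\<^sup>2 / 4 \<le> b m" using b[of m] by linarith
        then show ?case
          using iid_char_estimate[OF fin[of m] mean[of m] \<sigma> _ _ K0[of m], where b="b m" and t=t and d=d] b[of m] unfolding Z_def v_def w_def by simp
      qed
      have "(\<lambda>m. t\<^sup>2 / 2 * \<bar>v m / \<sigma>\<^sup>2 - 1\<bar> + t\<^sup>2 / \<sigma>\<^sup>2 * (2 * w m + \<bar>t\<bar> / \<sigma> * sqrt (2 * (K m / b m)) * v m))
        \<longlonglongrightarrow> t\<^sup>2 / 2 * \<bar>\<sigma>\<^sup>2 / \<sigma>\<^sup>2 - 1\<bar> + t\<^sup>2 / \<sigma>\<^sup>2 * (2 * 0 + \<bar>t\<bar> / \<sigma> * sqrt (2 * 0) * \<sigma>\<^sup>2)"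
        using \<sigma> by (intro tendsto_intros vlim wlim Kb) auto
      then show "(\<lambda>m. t\<^sup>2 / 2 * \<bar>v m / \<sigma>\<^sup>2 - 1\<bar> + t\<^sup>2 / \<sigma>\<^sup>2 * (2 * w m + \<bar>t\<bar> / \<sigma> * sqrt (2 * (K m / b m)) * v m)) \<longlonglongrightarrow> 0"
        using \<sigma> by simp
    qed
    ultimately show "(\<lambda>m. char (distr (?P m) borel (Z m)) t) \<longlonglongrightarrow> char std_normal_distribution t"
      by (subst char_std_normal_distribution) (rule Lim_transform)
  qed (auto intro!: real_dist_normal_dist prob_space.real_distribution_distr[OF measure_pmf.prob_space_axioms])
  then have conv: "(\<lambda>m. cdf (distr (?P m) borel (Z m)) x) \<longlonglongrightarrow> Phi x" for x
    unfolding weak_conv_m_def weak_conv_def using isCont_Phi by blast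
  have cdf_eq: "cdf (distr (?P m) borel (Z m)) x = measure_pmf.prob (?P m) {J. (\<Sum>k<b m. \<xi> m (J k)) / sqrt (b m) \<le> \<sigma> * x}" for m x
  proof -
    have "y / \<sigma> \<le> x \<longleftrightarrow> y \<le> \<sigma> * x" for y
      using \<sigma> by (simp add: divide_le_eq mult.commute)
    then show ?thesis by (simp add: cdf_def measure_distr Z_def vimage_def del: divide_divide_eq_left)
  qed
  \<comment> \<open>\<open>polya_grid_Phi\<close> doubles the error seen on the grid, hence
    \<epsilon>/2.\<close>
  obtain T where T: "finite T" "\<And>G. mono G \<Longrightarrow> (\<And>t. 0 \<le> G t \<and> G t \<le> 1) \<Longrightarrow> (\<And>t. t\<in>T \<Longrightarrow> \<bar>G t - Phi (1 * t)\<bar> \<le> \<epsilon>/2) \<Longrightarrow>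
           (\<forall>t. \<bar>G t - Phi (1 * t)\<bar> \<le> 2 * (\<epsilon>/2))"
    using polya_grid_Phi[of 1 "\<epsilon>/2"] \<epsilon> by auto
  have "\<forall>\<^sub>F m in sequentially. \<forall>t\<in>T. \<bar>cdf (distr (?P m) borel (Z m)) t - Phi t\<bar> < \<epsilon>/2"
  proof (rule eventually_ball_finite[OF T(1)], rule ballI)
    fix t
    have "0 < \<epsilon>/2" using \<epsilon> by simp
    from tendstoD[OF conv[of t] this]
    show "\<forall>\<^sub>F m in sequentially. \<bar>cdf (distr (?P m) borel (Z m)) t - Phi t\<bar> < \<epsilon>/2"
      by (simp only: dist_real_def)
  qed
  then obtain m where m: "\<forall>t\<in>T. \<bar>cdf (distr (?P m) borel (Z m)) t - Phi t\<bar> < \<epsilon>/2"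
    using eventually_happens'[OF sequentially_bot] by blast
  interpret R: real_distribution "distr (?P m) borel (Z m)"
    by (rule prob_space.real_distribution_distr[OF measure_pmf.prob_space_axioms]) simp
  have all: "\<forall>x. \<bar>cdf (distr (?P m) borel (Z m)) x - Phi (1 * x)\<bar> \<le> 2 * (\<epsilon>/2)"
  proof (rule T(2))
    show "mono (cdf (distr (?P m) borel (Z m)))" by (rule monoI) (rule R.cdf_nondecreasing)
    show "0 \<le> cdf (distr (?P m) borel (Z m)) t \<and> cdf (distr (?P m) borel (Z m)) t \<le> 1" for t
      using R.cdf_nonneg R.cdf_bounded_prob by blast
    show "\<bar>cdf (distr (?P m) borel (Z m)) t - Phi (1 * t)\<bar> \<le> \<epsilon>/2" if "t \<in> T" for t
      using m that by (simp only: mult_1_left less_imp_le)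
  qed
  have "\<bar>measure_pmf.prob (?P m) {J. (\<Sum>k<b m. \<xi> m (J k)) / sqrt (real (b m)) \<le> x} - Phi (x / \<sigma>)\<bar> \<le> \<epsilon>" for x
  proof -
    have "\<sigma> * (x / \<sigma>) = x" using \<sigma> by simp
    then show ?thesis using spec[OF all, of "x / \<sigma>"] unfolding cdf_eq by simp
  qed
  then show False using bad[of m] by blast
qed

subsection \<open>Mixing and covariances\<close>

context prob_space begin

lemma integrable_bounded:
  fixes f :: "'a \<Rightarrow> 'b::{banach, second_countable_topology}"
  assumes "f \<in> borel_measurable M" "\<And>x. x \<in> space M \<Longrightarrow> norm (f x) \<le> B"
  shows "integrable M f"
  by (rule integrable_const_bound[of _ B]) (use assms in auto)

lemma abs_expectation_le:
  fixes f :: "'a \<Rightarrow> 'b::{banach, second_countable_topology}"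
  assumes "f \<in> borel_measurable M" "\<And>x. x \<in> space M \<Longrightarrow> norm (f x) \<le> B"
  shows "norm (integral\<^sup>L M f) \<le> B"
proof -
  have "norm (integral\<^sup>L M f) \<le> expectation (\<lambda>x. norm (f x))" by (rule integral_norm_bound)
  also have "\<dots> \<le> expectation (\<lambda>x. B)"
    by (rule integral_mono) (use assms in \<open>auto intro!: integrable_bounded[of _ B]\<close>)
  finally show ?thesis by (simp add: prob_space)
qed

text \<open>The optimal sign pattern is that of the conditional expectation of \<open>h\<close> given \<open>F\<close>.\<close>

lemma expectation_mult_le_sign:
  fixes f h :: "'a \<Rightarrow> real"
  assumes F: "subalgebra M F" and f[measurable]: "f \<in> borel_measurable F" and fa: "\<And>x. x \<in> space M \<Longrightarrow> \<bar>f x\<bar> \<le> a"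
    and h[measurable]: "integrable M h"
  shows "\<exists>P\<in>sets F. \<bar>expectation (\<lambda>x. f x * h x)\<bar> \<le>
     a * (expectation (\<lambda>x. indicator P x * h x) - expectation (\<lambda>x. indicator (space M - P) x * h x))"
proof -
  interpret finite_measure_subalgebra M F by unfold_locales (rule F)
  have spF: "space F = space M" using F by (simp add: subalgebra_def)
  have hm[measurable]: "h \<in> borel_measurable M" using h by auto
  have a0: "0 \<le> a" using fa not_empty by (metis abs_ge_zero ex_in_conv order_trans)
  let ?k = "real_cond_exp M F h"
  have kF[measurable]: "?k \<in> borel_measurable F" by simp
  have ki: "integrable M ?k" using h by auto
  define P where "P = {x \<in> space F. ?k x \<ge> 0}"
  have PF[measurable]: "P \<in> sets F" unfolding P_def by measurable
  have [measurable]: "P \<in> sets M" using PF F by (auto simp: subalgebra_def)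
  have bi: "integrable M (\<lambda>x. g x * h x)" if "g \<in> borel_measurable F" "\<And>x. x \<in> space M \<Longrightarrow> \<bar>g x\<bar> \<le> c" for g c
  proof (rule Bochner_Integration.integrable_bound)
    show "integrable M (\<lambda>x. c * h x)" using h by simp
    show "(\<lambda>x. g x * h x) \<in> borel_measurable M" using measurable_from_subalg[OF F that(1)] by measurable
    have "\<bar>g x * h x\<bar> \<le> \<bar>c * h x\<bar>" if x: "x \<in> space M" for x
      using \<open>\<And>x. x \<in> space M \<Longrightarrow> \<bar>g x\<bar> \<le> c\<close>[OF x] unfolding abs_mult by (intro mult_right_mono) auto
    then show "AE x in M. norm (g x * h x) \<le> norm (c * h x)" by (intro AE_I2) simp
  qed
  have iP: "integrable M (\<lambda>x. indicat_real Q x * h x)" if "Q \<in> sets F" for Q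
  proof (rule bi)
    show "indicat_real Q \<in> borel_measurable F" using that by simp
    show "\<bar>indicat_real Q x\<bar> \<le> 1" for x by (simp add: indicator_def)
  qed
  have Pc: "space M - P \<in> sets F" using sets.compl_sets[OF PF] by (simp add: spF)
  have "\<bar>expectation (\<lambda>x. f x * h x)\<bar> = \<bar>expectation (\<lambda>x. f x * ?k x)\<bar>"
    by (subst real_cond_exp_intg(2)) (use bi[OF f fa] in auto)
  also have "\<dots> \<le> expectation (\<lambda>x. \<bar>f x * ?k x\<bar>)" by (rule integral_abs_bound)
  also have "\<dots> \<le> expectation (\<lambda>x. a * (indicator P x * ?k x - indicator (space M - P) x * ?k x))"
  proof (rule integral_mono)
    show "integrable M (\<lambda>x. \<bar>f x * ?k x\<bar>)"
      using real_cond_exp_intg(1)[OF bi[OF f fa]] by auto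
    show "integrable M (\<lambda>x. a * (indicator P x * ?k x - indicator (space M - P) x * ?k x))"
      using real_cond_exp_intg(1)[OF iP[OF PF]] real_cond_exp_intg(1)[OF iP[OF Pc]] PF Pc
      by (auto)
    fix x assume x: "x \<in> space M"
    have "\<bar>f x * ?k x\<bar> \<le> a * \<bar>?k x\<bar>" using fa[OF x] by (simp add: abs_mult mult_right_mono)
    also have "\<bar>?k x\<bar> = indicator P x * ?k x - indicator (space M - P) x * ?k x"
      using x by (auto simp: P_def indicator_def spF)
    finally show "\<bar>f x * ?k x\<bar> \<le> a * (indicator P x * ?k x - indicator (space M - P) x * ?k x)" .
  qed
  also have "\<dots> = a * (expectation (\<lambda>x. indicator P x * ?k x) - expectation (\<lambda>x. indicator (space M - P) x * ?k x))"
    using real_cond_exp_intg(1)[OF iP[OF PF]] real_cond_exp_intg(1)[OF iP[OF Pc]] PF Pc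
    by (simp add: Bochner_Integration.integral_diff)
  also have "expectation (\<lambda>x. indicator P x * ?k x) = expectation (\<lambda>x. indicator P x * h x)"
    by (rule real_cond_exp_intg(2)) (use iP PF in auto)
  also have "expectation (\<lambda>x. indicator (space M - P) x * ?k x) = expectation (\<lambda>x. indicator (space M - P) x * h x)"
    by (rule real_cond_exp_intg(2)) (use iP Pc in auto)
  finally show ?thesis using PF by blast
qed

text \<open>The sign lemma is applied twice: first \<open>f\<close> is replaced by a difference of
  two indicators, then, for each of them, \<open>g\<close>. Only pairs of events remain, and each
  application contributes a factor 2, whence the 4.\<close>

lemma covariance_inequality:
  fixes f g :: "'a \<Rightarrow> real"
  assumes F: "subalgebra M F" and G: "subalgebra M G"
    and \<alpha>: "\<And>A B. A \<in> sets F \<Longrightarrow> B \<in> sets G \<Longrightarrow> \<bar>prob (A \<inter> B) - prob A * prob B\<bar> \<le> \<alpha>"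
    and f: "f \<in> borel_measurable F" and fa: "\<And>x. x \<in> space M \<Longrightarrow> \<bar>f x\<bar> \<le> a"
    and g: "g \<in> borel_measurable G" and gc: "\<And>x. x \<in> space M \<Longrightarrow> \<bar>g x\<bar> \<le> c"
  shows "\<bar>expectation (\<lambda>x. f x * g x) - expectation f * expectation g\<bar> \<le> 4 * a * c * \<alpha>"
proof -
  have a0: "0 \<le> a" using fa not_empty by (metis abs_ge_zero ex_in_conv order_trans)
  have c0: "0 \<le> c" using gc not_empty by (metis abs_ge_zero ex_in_conv order_trans)
  have [measurable]: "f \<in> borel_measurable M" "g \<in> borel_measurable M"
    using measurable_from_subalg[OF F f] measurable_from_subalg[OF G g] by auto
  have [simp]: "integrable M f" "integrable M g"
    using integrable_bounded[of f a] integrable_bounded[of g c] fa gc by auto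
  have [simp]: "integrable M (\<lambda>x. f x * g x)"
    by (rule integrable_bounded[of _ "a * c"]) (use fa gc a0 in \<open>auto simp: abs_mult intro!: mult_mono\<close>)
  have *: "\<bar>expectation (\<lambda>x. indicator P x * (g x - expectation g))\<bar> \<le> 2 * c * \<alpha>" if P: "P \<in> sets F" for P
  proof -
    have [measurable]: "P \<in> sets M" using P F by (auto simp: subalgebra_def)
    have [simp]: "integrable M (\<lambda>x. indicator P x * g x)" "integrable M (\<lambda>x. g x * indicator P x)"
      by (rule integrable_bounded[of _ "c"], use gc c0 in \<open>auto simp: indicator_def\<close>)+
    have eq: "expectation (\<lambda>x. indicator P x * (g x - expectation g)) = expectation (\<lambda>x. g x * (indicator P x - prob P))"
      by (simp add: right_diff_distrib mult.commute[of _ "expectation g"] mult.commute[of _ "g _"] emeasure_eq_measure)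
    obtain Q where Q: "Q \<in> sets G" and le: "\<bar>expectation (\<lambda>x. g x * (indicat_real P x - prob P))\<bar> \<le>
       c * (expectation (\<lambda>x. indicator Q x * (indicat_real P x - prob P)) - expectation (\<lambda>x. indicator (space M - Q) x * (indicat_real P x - prob P)))"
      using expectation_mult_le_sign[OF G g gc, of "\<lambda>x. indicat_real P x - prob P"] by (auto simp: emeasure_eq_measure)
    have [measurable]: "Q \<in> sets M" using Q G by (auto simp: subalgebra_def)
    have Qc: "space M - Q \<in> sets G" using sets.compl_sets[OF Q] G by (simp add: subalgebra_def)
    have ind: "expectation (\<lambda>x. indicator R x * (indicat_real P x - prob P)) = prob (P \<inter> R) - prob P * prob R" if "R \<in> sets M" for R
    proof -
      have "expectation (\<lambda>x. indicator R x * (indicat_real P x - prob P)) = expectation (\<lambda>x. indicat_real (P \<inter> R) x - prob P * indicator R x)"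
        by (rule Bochner_Integration.integral_cong) (auto simp: indicator_def)
      also have "\<dots> = prob (P \<inter> R) - prob P * prob R"
        using that by (subst Bochner_Integration.integral_diff) (auto simp: emeasure_eq_measure)
      finally show ?thesis .
    qed
    have "expectation (\<lambda>x. indicator Q x * (indicat_real P x - prob P)) - expectation (\<lambda>x. indicator (space M - Q) x * (indicat_real P x - prob P)) \<le> 2 * \<alpha>"
      using \<alpha>[OF P Q] \<alpha>[OF P Qc] by (simp add: ind)
    from order_trans[OF le mult_left_mono[OF this c0]] show ?thesis unfolding eq by simp
  qed
  have "\<bar>expectation (\<lambda>x. f x * (g x - expectation g))\<bar> \<le> a * (4 * c * \<alpha>)"
  proof -
    obtain P where P: "P \<in> sets F" and le: "\<bar>expectation (\<lambda>x. f x * (g x - expectation g))\<bar> \<le>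
       a * (expectation (\<lambda>x. indicator P x * (g x - expectation g)) - expectation (\<lambda>x. indicator (space M - P) x * (g x - expectation g)))"
      using expectation_mult_le_sign[OF F f fa, of "\<lambda>x. g x - expectation g"] by auto
    have Pc: "space M - P \<in> sets F" using sets.compl_sets[OF P] F by (simp add: subalgebra_def)
    have "expectation (\<lambda>x. indicator P x * (g x - expectation g)) - expectation (\<lambda>x. indicator (space M - P) x * (g x - expectation g)) \<le> 4 * c * \<alpha>"
      using *[OF P] *[OF Pc] by linarith
    from order_trans[OF le mult_left_mono[OF this a0]] show ?thesis .
  qed
  moreover have "expectation (\<lambda>x. f x * (g x - expectation g)) = expectation (\<lambda>x. f x * g x) - expectation f * expectation g"
    by (simp add: right_diff_distrib)
  ultimately show ?thesis by (simp add: ac_simps)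
qed

end

text \<open>From a fixed index each lag is met at most once on either side, so every row is at most
  twice the sum of \<open>c\<close>. The bound ignores the position \<open>a\<close>, as blocks with
  arbitrary starting point require.\<close>

lemma sum_abs_diff_le:
  fixes c :: "nat \<Rightarrow> real" and r :: "nat \<Rightarrow> nat \<Rightarrow> real"
  assumes c: "\<And>k. 0 \<le> c k" and r: "\<And>i k. i \<in> {a..<a+m} \<Longrightarrow> i + k \<in> {a..<a+m} \<Longrightarrow> r i (i+k) \<le> c k \<and> r (i+k) i \<le> c k"
  shows "(\<Sum>i\<in>{a..<a+m}. \<Sum>j\<in>{a..<a+m}. r i j) \<le> 2 * real m * (\<Sum>k<m. c k)"
proof -
  have "(\<Sum>j\<in>{a..<a+m}. r i j) \<le> 2 * (\<Sum>k<m. c k)" if i: "i \<in> {a..<a+m}" for i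
  proof -
    have "(\<Sum>j\<in>{a..<a+m}. r i j) = (\<Sum>j\<in>{i..<a+m}. r i j) + (\<Sum>j\<in>{a..<i}. r i j)"
      using i by (subst sum.union_disjoint[symmetric]) (auto intro: sum.cong)
    also have "(\<Sum>j\<in>{i..<a+m}. r i j) \<le> (\<Sum>k<m. c k)"
    proof -
      have "(\<Sum>j\<in>{i..<a+m}. r i j) \<le> (\<Sum>j\<in>{i..<a+m}. c (j - i))"
      proof (rule sum_mono)
        fix j assume "j \<in> {i..<a+m}"
        then show "r i j \<le> c (j - i)" using r[of i "j - i"] i by auto
      qed
      also have "\<dots> = (\<Sum>k\<in>(\<lambda>j. j - i) ` {i..<a+m}. c k)"
        by (rule sum.reindex_cong[symmetric, of "\<lambda>j. j - i"]) (auto simp: inj_on_def)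
      also have "\<dots> \<le> (\<Sum>k<m. c k)" by (rule sum_mono2) (use i c in auto)
      finally show ?thesis .
    qed
    also have "(\<Sum>j\<in>{a..<i}. r i j) \<le> (\<Sum>k<m. c k)"
    proof -
      have "(\<Sum>j\<in>{a..<i}. r i j) \<le> (\<Sum>j\<in>{a..<i}. c (i - j))"
      proof (rule sum_mono)
        fix j assume "j \<in> {a..<i}"
        then show "r i j \<le> c (i - j)" using r[of j "i - j"] i by auto
      qed
      also have "\<dots> = (\<Sum>k\<in>(\<lambda>j. i - j) ` {a..<i}. c k)"
        by (rule sum.reindex_cong[symmetric, of "\<lambda>j. i - j"]) (auto simp: inj_on_def)
      also have "\<dots> \<le> (\<Sum>k<m. c k)" by (rule sum_mono2) (use i c in auto)
      finally show ?thesis .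
    qed
    finally show ?thesis by simp
  qed
  then have "(\<Sum>i\<in>{a..<a+m}. \<Sum>j\<in>{a..<a+m}. r i j) \<le> (\<Sum>i\<in>{a..<a+m}. 2 * (\<Sum>k<m. c k))"
    by (rule sum_mono)
  then show ?thesis by simp
qed

section \<open>Stationary mixing sequences and their centred indicators\<close>

locale mixing_process = prob_space M for M :: "'a measure" +
  fixes X :: "int \<Rightarrow> 'a \<Rightarrow> real"
  assumes X_measurable[measurable]: "\<And>i. X i \<in> borel_measurable M"
    and stat: "stationary M X"
    and summable_mixing: "summable (\<lambda>n. mixing_coeff M X (n + 1))"
begin

abbreviation \<alpha> :: "nat \<Rightarrow> real" where "\<alpha> \<equiv> mixing_coeff M X"

text \<open>Encoded as a \<open>measure\<close> so that \<open>subalgebra\<close> and conditional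
  expectations apply; \<open>sets_sub\<close> ties it to the field in the mixing
  coefficients.\<close>

definition sub :: "int set \<Rightarrow> 'a measure" where
  "sub I = sigma (space M) {X i -` B \<inter> space M | i B. i \<in> I \<and> B \<in> sets borel}"

lemma sets_sub: "sets (sub I) = sigma_gen_by M X I"
  unfolding sub_def sigma_gen_by_def by (rule sets_measure_of) auto

lemma space_sub[simp]: "space (sub I) = space M"
  unfolding sub_def by (rule space_measure_of) auto

lemma subalgebra_sub: "subalgebra M (sub I)"
  unfolding subalgebra_def sets_sub sigma_gen_by_def
  by (intro conjI sets.sigma_sets_subset) auto

lemma measurable_sub: "i \<in> I \<Longrightarrow> X i \<in> borel_measurable (sub I)"
  unfolding measurable_def space_sub sets_sub sigma_gen_by_def by (auto intro!: sigma_sets.Basic)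

lemma summable_\<alpha>: "summable \<alpha>"
  using summable_mixing summable_Suc_iff[of \<alpha>] by simp

lemma \<alpha>_tendsto: "\<alpha> \<longlonglongrightarrow> 0"
  using summable_LIMSEQ_zero[OF summable_\<alpha>] .

lemma mixing_le:
  assumes "A \<in> sets (sub {1..n})" "B \<in> sets (sub {n + int k..})"
  shows "\<bar>prob (A \<inter> B) - prob A * prob B\<bar> \<le> \<alpha> k"
  unfolding mixing_coeff_def
proof (rule cSup_upper)
  show "\<bar>prob (A \<inter> B) - prob A * prob B\<bar> \<in> {\<bar>prob (A \<inter> B) - prob A * prob B\<bar> |A B n. A \<in> sigma_gen_by M X {1..n} \<and> B \<in> sigma_gen_by M X {n + int k..}}"
    using assms by (auto simp: sets_sub)
  \<comment> \<open>A real \<open>Sup\<close> dominates its elements only if the set is bounded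
    above.\<close>
  have "\<bar>prob C - prob A * prob B\<bar> \<le> 1" for A B C
  proof -
    have "0 \<le> prob A * prob B" "prob A * prob B \<le> 1" by (auto intro!: mult_le_one)
    then show ?thesis using prob_le_1[of C] measure_nonneg[of M C] by linarith
  qed
  then show "bdd_above {\<bar>prob (A \<inter> B) - prob A * prob B\<bar> |A B n. A \<in> sigma_gen_by M X {1..n} \<and> B \<in> sigma_gen_by M X {n + int k..}}"
    by (intro bdd_aboveI[of _ 1]) auto
qed

lemma \<alpha>_nonneg: "0 \<le> \<alpha> k"
  using mixing_le[of "{}" 0 "{}" k] by simp

lemma cov_le:
  fixes f g :: "'a \<Rightarrow> real"
  assumes "f \<in> borel_measurable (sub {1..n})" "\<And>x. x \<in> space M \<Longrightarrow> \<bar>f x\<bar> \<le> a"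
    "g \<in> borel_measurable (sub {n + int k..})" "\<And>x. x \<in> space M \<Longrightarrow> \<bar>g x\<bar> \<le> c"
  shows "\<bar>expectation (\<lambda>x. f x * g x) - expectation f * expectation g\<bar> \<le> 4 * a * c * \<alpha> k"
  by (rule covariance_inequality[OF subalgebra_sub subalgebra_sub mixing_le]) (use assms in auto)

text \<open>Real and imaginary part are bounded separately, which doubles the constant 4.\<close>

lemma cov_le_complex:
  fixes f :: "'a \<Rightarrow> complex" and g :: "'a \<Rightarrow> real"
  assumes f[measurable]: "f \<in> borel_measurable (sub {1..n})" and fa: "\<And>x. x \<in> space M \<Longrightarrow> cmod (f x) \<le> a"
    and g[measurable]: "g \<in> borel_measurable (sub {n + int k..})" and gc: "\<And>x. x \<in> space M \<Longrightarrow> \<bar>g x\<bar> \<le> c"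
  shows "cmod (integral\<^sup>L M (\<lambda>x. f x * g x) - integral\<^sup>L M f * expectation g) \<le> 8 * a * c * \<alpha> k"
proof -
  have m[measurable]: "f \<in> borel_measurable M" "g \<in> borel_measurable M"
    using measurable_from_subalg[OF subalgebra_sub f] measurable_from_subalg[OF subalgebra_sub g] .
  have a0: "0 \<le> a" using fa not_empty by (metis norm_ge_zero ex_in_conv order_trans)
  have fi: "integrable M f" by (rule integrable_bounded[OF m(1) fa])
  have fgi: "integrable M (\<lambda>x. f x * g x)"
    by (rule integrable_bounded[of _ "a * c"]) (use fa gc a0 in \<open>auto simp: norm_mult intro!: mult_mono\<close>)
  let ?z = "integral\<^sup>L M (\<lambda>x. f x * g x) - integral\<^sup>L M f * expectation g"
  have "Re ?z = expectation (\<lambda>x. Re (f x) * g x) - expectation (\<lambda>x. Re (f x)) * expectation g"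
    using integral_Re[OF fgi] integral_Re[OF fi] by simp
  moreover have "\<bar>expectation (\<lambda>x. Re (f x) * g x) - expectation (\<lambda>x. Re (f x)) * expectation g\<bar> \<le> 4 * a * c * \<alpha> k"
    by (rule cov_le[where n=n]) (use gc order_trans[OF abs_Re_le_cmod fa] in auto)
  moreover have "Im ?z = expectation (\<lambda>x. Im (f x) * g x) - expectation (\<lambda>x. Im (f x)) * expectation g"
    using integral_Im[OF fgi] integral_Im[OF fi] by simp
  moreover have "\<bar>expectation (\<lambda>x. Im (f x) * g x) - expectation (\<lambda>x. Im (f x)) * expectation g\<bar> \<le> 4 * a * c * \<alpha> k"
    by (rule cov_le[where n=n]) (use gc order_trans[OF abs_Im_le_cmod fa] in auto)
  ultimately show ?thesis using cmod_le[of ?z] by linarith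
qed

lemma stationary_expectation:
  fixes \<phi> :: "(int \<Rightarrow> real) \<Rightarrow> real"
  assumes [measurable]: "\<phi> \<in> borel_measurable (Pi\<^sub>M UNIV (\<lambda>_. borel))"
  shows "expectation (\<lambda>\<omega>. \<phi> (\<lambda>i. X (i + k) \<omega>)) = expectation (\<lambda>\<omega>. \<phi> (\<lambda>i. X i \<omega>))"
proof -
  have [measurable]: "(\<lambda>\<omega> i. X (i + k) \<omega>) \<in> M \<rightarrow>\<^sub>M Pi\<^sub>M UNIV (\<lambda>_. borel)" for k
    by (rule measurable_PiM_single') auto
  from this[of 0] have [measurable]: "(\<lambda>\<omega> i. X i \<omega>) \<in> M \<rightarrow>\<^sub>M Pi\<^sub>M UNIV (\<lambda>_. borel)" by simp
  have "integral\<^sup>L (distr M (Pi\<^sub>M UNIV (\<lambda>_. borel)) (\<lambda>\<omega> i. X (i + k) \<omega>)) \<phi> =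
        integral\<^sup>L (distr M (Pi\<^sub>M UNIV (\<lambda>_. borel)) (\<lambda>\<omega> i. X i \<omega>)) \<phi>"
    using stat by (simp add: stationary_def)
  then show ?thesis by (simp add: integral_distr)
qed

definition \<pi> :: "real set \<Rightarrow> real" where "\<pi> B = prob {\<omega>\<in>space M. X 1 \<omega> \<in> B}"

text \<open>\<open>B\<close> stays arbitrary because two kinds of sets occur: half-lines, for the
  distribution functions themselves, and short intervals between two levels, where smallness of
  \<open>\<pi> B\<close> is exploited.\<close>

definition Y :: "real set \<Rightarrow> nat \<Rightarrow> 'a \<Rightarrow> real" where
  "Y B i \<omega> = indicat_real B (X (int i) \<omega>) - \<pi> B"

lemma \<pi>_bounds: "0 \<le> \<pi> B" "\<pi> B \<le> 1" by (auto simp: \<pi>_def)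

lemma Y_bound: "\<bar>Y B i \<omega>\<bar> \<le> 1"
  using \<pi>_bounds[of B] by (auto simp: Y_def indicator_def)

context
  fixes B :: "real set"
  assumes B[measurable]: "B \<in> sets borel"
begin

lemma Y_measurable[measurable]: "Y B i \<in> borel_measurable M"
  unfolding Y_def by measurable

lemma Y_measurable_sub: "int i \<in> I \<Longrightarrow> Y B i \<in> borel_measurable (sub I)"
  using measurable_sub[of "int i" I] unfolding Y_def by measurable

lemma expectation_indicator_X: "expectation (\<lambda>\<omega>. indicat_real B (X i \<omega>)) = \<pi> B"
proof -
  have "expectation (\<lambda>\<omega>. indicat_real B (X i \<omega>)) = expectation (\<lambda>\<omega>. indicat_real B (X (1 + (i - 1)) \<omega>))" by simp
  also have "\<dots> = expectation (\<lambda>\<omega>. indicat_real B (X 1 \<omega>))"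
    by (rule stationary_expectation[of "\<lambda>x. indicat_real B (x 1)"]) measurable
  also have "\<dots> = expectation (indicat_real {\<omega>\<in>space M. X 1 \<omega> \<in> B})"
    by (rule Bochner_Integration.integral_cong) (auto simp: indicator_def)
  also have "\<dots> = \<pi> B" by (simp add: \<pi>_def emeasure_eq_measure)
  finally show ?thesis .
qed

lemma integrable_indicator_X[simp]: "integrable M (\<lambda>\<omega>. indicat_real B (X i \<omega>))"
  by (rule integrable_bounded[of _ 1]) auto

lemma integrable_Y_mult[simp]: "integrable M (\<lambda>\<omega>. Y B i \<omega> * Y B j \<omega>)"
  by (rule integrable_bounded[of _ 1]) (auto simp: abs_mult intro!: mult_le_one Y_bound)

lemma integrable_Y[simp]: "integrable M (Y B i)"
  by (rule integrable_bounded[of _ 1]) (auto simp: Y_bound)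

lemma expectation_Y: "expectation (Y B i) = 0"
  unfolding Y_def[abs_def] by (simp add: expectation_indicator_X prob_space)

lemma expectation_Y_Y:
  "expectation (\<lambda>\<omega>. Y B i \<omega> * Y B j \<omega>) = prob {\<omega>\<in>space M. X (int i) \<omega> \<in> B \<and> X (int j) \<omega> \<in> B} - \<pi> B * \<pi> B"
proof -
  have i: "integrable M (\<lambda>\<omega>. indicat_real B (X (int i) \<omega>) * indicat_real B (X (int j) \<omega>))"
    by (rule integrable_bounded[of _ 1]) (auto simp: indicator_def)
  have "expectation (\<lambda>\<omega>. Y B i \<omega> * Y B j \<omega>) = expectation (\<lambda>\<omega>. indicat_real B (X (int i) \<omega>) * indicat_real B (X (int j) \<omega>)
     - \<pi> B * indicat_real B (X (int i) \<omega>) - \<pi> B * indicat_real B (X (int j) \<omega>) + \<pi> B * \<pi> B)"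
    unfolding Y_def by (rule Bochner_Integration.integral_cong) (auto simp: algebra_simps)
  also have "\<dots> = expectation (\<lambda>\<omega>. indicat_real B (X (int i) \<omega>) * indicat_real B (X (int j) \<omega>)) - \<pi> B * \<pi> B"
    using i by (simp add: expectation_indicator_X prob_space)
  also have "expectation (\<lambda>\<omega>. indicat_real B (X (int i) \<omega>) * indicat_real B (X (int j) \<omega>)) =
      expectation (indicat_real {\<omega>\<in>space M. X (int i) \<omega> \<in> B \<and> X (int j) \<omega> \<in> B})"
    by (rule Bochner_Integration.integral_cong) (auto simp: indicator_def)
  finally show ?thesis by (simp add: emeasure_eq_measure)
qed

lemma prob_X_B: "prob {\<omega>\<in>space M. X i \<omega> \<in> B} = \<pi> B"
proof -
  have "prob {\<omega>\<in>space M. X i \<omega> \<in> B} = expectation (indicat_real {\<omega>\<in>space M. X i \<omega> \<in> B})"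
    by (simp add: emeasure_eq_measure)
  also have "\<dots> = expectation (\<lambda>\<omega>. indicat_real B (X i \<omega>))"
    by (rule Bochner_Integration.integral_cong) (auto simp: indicator_def)
  finally show ?thesis by (simp add: expectation_indicator_X)
qed

text \<open>Mixing gives decay in the lag; the bound by \<open>\<pi> B\<close> holds because the
  joint probability and the product both lie between 0 and \<open>\<pi> B\<close>. Taking the
  minimum makes the summed covariances small for rare events without losing summability.\<close>

lemma cov_Y_le:
  assumes "1 \<le> i"
  shows "\<bar>expectation (\<lambda>\<omega>. Y B i \<omega> * Y B (i + k) \<omega>)\<bar> \<le> min (\<alpha> k) (\<pi> B)"
proof -
  let ?A = "\<lambda>i. {\<omega>\<in>space M. X (int i) \<omega> \<in> B}"
  have AS: "?A j \<in> sets (sub I)" if "int j \<in> I" for j I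
  proof -
    have "X (int j) -` B \<inter> space (sub I) \<in> sets (sub I)" by (rule measurable_sets[OF measurable_sub[OF that]]) simp
    then show ?thesis by (simp add: vimage_def Int_def conj_commute)
  qed
  have e: "expectation (\<lambda>\<omega>. Y B i \<omega> * Y B (i + k) \<omega>) = prob (?A i \<inter> ?A (i+k)) - prob (?A i) * prob (?A (i+k))"
  proof -
    have "?A i \<inter> ?A (i+k) = {\<omega>\<in>space M. X (int i) \<omega> \<in> B \<and> X (int (i + k)) \<omega> \<in> B}" by auto
    then show ?thesis unfolding expectation_Y_Y prob_X_B by simp
  qed
  have 1: "\<bar>prob (?A i \<inter> ?A (i+k)) - prob (?A i) * prob (?A (i+k))\<bar> \<le> \<alpha> k"
    by (rule mixing_le[where n="int i"]; rule AS) (use assms in auto)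
  have "prob (?A i \<inter> ?A (i+k)) \<le> prob (?A i)" by (rule finite_measure_mono) auto
  moreover have "\<pi> B * \<pi> B \<le> \<pi> B" using \<pi>_bounds[of B] by (simp add: mult_left_le)
  ultimately have "\<bar>prob (?A i \<inter> ?A (i+k)) - prob (?A i) * prob (?A (i+k))\<bar> \<le> \<pi> B"
    using measure_nonneg[of M "?A i \<inter> ?A (i+k)"] mult_nonneg_nonneg[OF \<pi>_bounds(1)[of B] \<pi>_bounds(1)[of B]]
    unfolding prob_X_B by linarith
  with 1 show ?thesis unfolding e by simp
qed

lemma second_moment_sum_le:
  assumes "1 \<le> a"
  shows "expectation (\<lambda>\<omega>. (\<Sum>i\<in>{a..<a+m}. Y B i \<omega>)\<^sup>2) \<le> 2 * real m * (\<Sum>k. min (\<alpha> k) (\<pi> B))"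
proof -
  have "expectation (\<lambda>\<omega>. (\<Sum>i\<in>{a..<a+m}. Y B i \<omega>)\<^sup>2) = (\<Sum>i\<in>{a..<a+m}. \<Sum>j\<in>{a..<a+m}. expectation (\<lambda>\<omega>. Y B i \<omega> * Y B j \<omega>))"
    by (simp add: power2_eq_square sum_product Bochner_Integration.integral_sum)
  also have "\<dots> \<le> 2 * real m * (\<Sum>k<m. min (\<alpha> k) (\<pi> B))"
  proof (rule sum_abs_diff_le)
    show "0 \<le> min (\<alpha> k) (\<pi> B)" for k using \<alpha>_nonneg \<pi>_bounds by simp
    fix i k assume "i \<in> {a..<a+m}"
    then have "1 \<le> i" using assms by auto
    from cov_Y_le[OF this, of k] show "expectation (\<lambda>\<omega>. Y B i \<omega> * Y B (i + k) \<omega>) \<le> min (\<alpha> k) (\<pi> B) \<and>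
        expectation (\<lambda>\<omega>. Y B (i + k) \<omega> * Y B i \<omega>) \<le> min (\<alpha> k) (\<pi> B)"
      by (simp add: mult.commute abs_le_iff)
  qed
  also have "\<dots> \<le> 2 * real m * (\<Sum>k. min (\<alpha> k) (\<pi> B))"
  proof (intro mult_left_mono sum_le_suminf)
    show "summable (\<lambda>k. min (\<alpha> k) (\<pi> B))"
      by (rule summable_comparison_test[OF _ summable_\<alpha>]) (use \<alpha>_nonneg \<pi>_bounds in auto)
  qed (use \<alpha>_nonneg \<pi>_bounds in auto)
  finally show ?thesis .
qed

end

text \<open>A modulus of continuity in the level: by \<open>second_moment_sum_le\<close> a sum of
  \<open>m\<close> centred indicators of \<open>B\<close> has second moment at most
  \<open>2 * m * \<kappa> (\<pi> B)\<close>.\<close>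

definition \<kappa> :: "real \<Rightarrow> real" where "\<kappa> x = (\<Sum>k. min (\<alpha> k) x)"

lemma \<kappa>_nonneg: "0 \<le> x \<Longrightarrow> 0 \<le> \<kappa> x"
  unfolding \<kappa>_def by (rule suminf_nonneg) (use \<alpha>_nonneg in \<open>auto intro!: summable_comparison_test[OF _ summable_\<alpha>]\<close>)

text \<open>Dominated convergence for series, with \<alpha> as summable majorant.\<close>

lemma \<kappa>_tendsto:
  assumes "(x \<longlongrightarrow> 0) (sequentially)" "\<And>n. 0 \<le> x n"
  shows "(\<lambda>n. \<kappa> (x n)) \<longlonglongrightarrow> 0"
proof -
  have "(\<lambda>n. \<Sum>k. min (\<alpha> k) (x n)) \<longlonglongrightarrow> (\<Sum>k. 0)"
  proof (rule tannerys_theorem[THEN conjunct2, THEN conjunct2, OF _ always_eventually summable_\<alpha>])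
    fix k show "(\<lambda>n. min (\<alpha> k) (x n)) \<longlonglongrightarrow> 0"
      using tendsto_min[OF tendsto_const assms(1), of "\<alpha> k"] by (simp only: min_absorb2[OF \<alpha>_nonneg])
  qed (use assms(2) \<alpha>_nonneg in auto)
  then show ?thesis by (simp add: \<kappa>_def)
qed

end

subsection \<open>The central limit theorem under mixing\<close>

lemma cesaro_mean:
  fixes f :: "nat \<Rightarrow> real"
  assumes "f \<longlonglongrightarrow> c"
  shows "(\<lambda>n. (\<Sum>k=1..n. f k) / real n) \<longlonglongrightarrow> c"
proof (rule LIMSEQ_I)
  fix \<epsilon> :: real assume \<epsilon>: "0 < \<epsilon>"
  obtain N where N: "\<And>k. k \<ge> N \<Longrightarrow> \<bar>f k - c\<bar> < \<epsilon>/2"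
    using LIMSEQ_D[OF assms, of "\<epsilon>/2"] \<epsilon> by auto
  define C where "C = (\<Sum>k=1..N. \<bar>f k - c\<bar>)"
  have C0: "0 \<le> C" unfolding C_def by (rule sum_nonneg) simp
  show "\<exists>no. \<forall>n\<ge>no. norm ((\<Sum>k=1..n. f k) / real n - c) < \<epsilon>"
  proof (intro exI allI impI)
    fix n assume n: "n \<ge> nat \<lceil>2 * C / \<epsilon>\<rceil> + 1"
    then have n0: "n > 0" by simp
    have "2 * C / \<epsilon> < real n" using n by linarith
    then have Cn: "C < \<epsilon> / 2 * real n" using \<epsilon> by (simp add: field_simps)
    have "(\<Sum>k=1..n. f k) / real n - c = (\<Sum>k=1..n. f k - c) / real n"
      using n0 by (simp add: sum_subtractf field_simps)
    also have "\<bar>\<dots>\<bar> \<le> (\<Sum>k=1..n. \<bar>f k - c\<bar>) / real n"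
      by (simp add: divide_right_mono)
    also have "(\<Sum>k=1..n. \<bar>f k - c\<bar>) \<le> (\<Sum>k=1..n. (if k \<le> N then \<bar>f k - c\<bar> else 0) + \<epsilon>/2)"
      using N \<epsilon> by (intro sum_mono) (auto simp: not_le less_imp_le)
    also have "\<dots> = (\<Sum>k=1..n. (if k \<le> N then \<bar>f k - c\<bar> else 0)) + \<epsilon>/2 * real n"
      by (simp add: sum.distrib)
    also have "(\<Sum>k=1..n. (if k \<le> N then \<bar>f k - c\<bar> else 0)) = (\<Sum>k\<in>{1..n} \<inter> {..N}. \<bar>f k - c\<bar>)"
      by (subst sum.inter_restrict) (auto intro: sum.cong)
    also have "\<dots> \<le> C" unfolding C_def by (rule sum_mono2) auto
    also have "C + \<epsilon>/2 * real n < \<epsilon> * real n" using Cn by (simp add: field_simps)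
    finally show "norm ((\<Sum>k=1..n. f k) / real n - c) < \<epsilon>" using n0 by (simp add: divide_right_mono divide_strict_right_mono)
  qed
qed

text \<open>As \<rho> has modulus at most 1, an error made at one step is never amplified later;
  errors only add up.\<close>

lemma linear_recursion_bound:
  fixes a :: "nat \<Rightarrow> complex"
  assumes "cmod \<rho> \<le> 1" "\<And>k. 1 \<le> k \<Longrightarrow> cmod (a k - a (k - 1) * \<rho>) \<le> d k"
  shows "cmod (a n - a 0 * \<rho> ^ n) \<le> (\<Sum>k=1..n. d k)"
proof (induction n)
  case (Suc n)
  have "a (Suc n) - a 0 * \<rho> ^ Suc n = (a (Suc n) - a n * \<rho>) + (a n - a 0 * \<rho> ^ n) * \<rho>"
    by (simp add: algebra_simps)
  also have "cmod \<dots> \<le> d (Suc n) + (\<Sum>k=1..n. d k) * 1"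
  proof (rule norm_triangle_mono)
    show "cmod (a (Suc n) - a n * \<rho>) \<le> d (Suc n)" using assms(2)[of "Suc n"] by simp
    show "cmod ((a n - a 0 * \<rho> ^ n) * \<rho>) \<le> (\<Sum>k=1..n. d k) * 1"
      unfolding norm_mult
      by (rule mult_mono[OF Suc.IH assms(1) order_trans[OF norm_ge_zero Suc.IH] norm_ge_zero])
  qed
  finally show ?case by simp
qed simp

context mixing_process
begin

definition S :: "real set \<Rightarrow> nat \<Rightarrow> 'a \<Rightarrow> real" where
  "S B k \<omega> = (\<Sum>i=1..k. Y B i \<omega>)"

definition \<gamma> :: "real set \<Rightarrow> nat \<Rightarrow> real" where
  "\<gamma> B k = expectation (\<lambda>\<omega>. Y B 1 \<omega> * Y B (1 + k) \<omega>)"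

text \<open>The increment of the variance: the second moment of \<open>S B n\<close> is the sum of
  \<open>g B k\<close> over \<open>k\<close> up to \<open>n\<close>
  (\<open>second_moment_S\<close>). Its limit \<open>\<sigma>2 B\<close> is the long-run
  variance.\<close>

definition g :: "real set \<Rightarrow> nat \<Rightarrow> real" where
  "g B k = \<gamma> B 0 + 2 * (\<Sum>i\<in>{1..<k}. \<gamma> B i)"

definition \<sigma>2 :: "real set \<Rightarrow> real" where
  "\<sigma>2 B = \<gamma> B 0 + 2 * (\<Sum>i. \<gamma> B (Suc i))"

definition e :: "real set \<Rightarrow> real \<Rightarrow> nat \<Rightarrow> 'a \<Rightarrow> complex" where
  "e B v k \<omega> = iexp (v * S B k \<omega>)"

text \<open>The characteristic function of the partial sum at frequency \<open>v\<close>; the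
  recursion runs over \<open>k\<close> with \<open>v\<close> held fixed.\<close>

definition A :: "real set \<Rightarrow> real \<Rightarrow> nat \<Rightarrow> complex" where
  "A B v k = integral\<^sup>L M (e B v k)"

lemma S_Suc: "1 \<le> k \<Longrightarrow> S B k \<omega> = S B (k - 1) \<omega> + Y B k \<omega>"
  by (cases k) (auto simp: S_def)

lemma S_diff: "b \<le> a \<Longrightarrow> S B a \<omega> - S B b \<omega> = (\<Sum>i\<in>{b+1..a}. Y B i \<omega>)"
proof -
  assume "b \<le> a"
  then have "{1..a} = {1..b} \<union> {b+1..a}" by auto
  then show ?thesis unfolding S_def by (simp add: sum.union_disjoint)
qed

lemma S_diff_bound: "b \<le> a \<Longrightarrow> \<bar>S B a \<omega> - S B b \<omega>\<bar> \<le> real (a - b)"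
proof -
  assume "b \<le> a"
  have "\<bar>\<Sum>i\<in>{b+1..a}. Y B i \<omega>\<bar> \<le> (\<Sum>i\<in>{b+1..a}. 1)"
    by (rule order_trans[OF sum_abs sum_mono]) (rule Y_bound)
  then show ?thesis using \<open>b \<le> a\<close> by (simp add: S_diff)
qed

lemma norm_e[simp]: "cmod (e B v k \<omega>) = 1"
  unfolding e_def by simp

lemma e_0[simp]: "e B v 0 \<omega> = 1"
  by (simp add: e_def S_def)

lemma e_diff_bound:
  assumes "b \<le> a"
  shows "cmod (e B v a \<omega> - e B v b \<omega>) \<le> \<bar>v\<bar> * real (a - b)"
proof -
  let ?x = "v * (S B a \<omega> - S B b \<omega>)"
  have "e B v a \<omega> - e B v b \<omega> = e B v b \<omega> * (iexp ?x - 1)"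
    by (simp add: e_def algebra_simps exp_diff)
  then have "cmod (e B v a \<omega> - e B v b \<omega>) = cmod (iexp ?x - 1)" by (simp add: norm_mult)
  also have "\<dots> \<le> \<bar>?x\<bar>" using iexp_approx1[of ?x 0] by simp
  also have "\<dots> \<le> \<bar>v\<bar> * real (a - b)" unfolding abs_mult
    by (intro mult_left_mono S_diff_bound assms) auto
  finally show ?thesis .
qed

text \<open>First order is enough for the lagged increments, since \<open>one_step_bound\<close>
  multiplies them by a further \<open>v\<close>; the newest factor needs
  \<open>e_step2\<close>.\<close>

lemma e_step1:
  assumes "1 \<le> k"
  shows "cmod (e B v k \<omega> - e B v (k-1) \<omega> * (1 + \<i> * v * Y B k \<omega>)) \<le> v\<^sup>2 / 2"
proof -
  let ?x = "v * Y B k \<omega>"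
  have "e B v k \<omega> - e B v (k-1) \<omega> * (1 + \<i> * v * Y B k \<omega>) = e B v (k-1) \<omega> * (iexp ?x - (1 + \<i> * ?x))"
    by (simp add: e_def S_Suc[OF assms] distrib_left exp_add algebra_simps)
  then have "cmod (e B v k \<omega> - e B v (k-1) \<omega> * (1 + \<i> * v * Y B k \<omega>)) = cmod (iexp ?x - (1 + \<i> * ?x))"
    by (simp add: norm_mult)
  also have "\<dots> \<le> \<bar>?x\<bar>\<^sup>2 / 2" using iexp_approx1[of ?x 1] by (simp add: numeral_2_eq_2)
  also have "\<bar>?x\<bar>\<^sup>2 \<le> (\<bar>v\<bar> * 1)\<^sup>2" unfolding abs_mult
    by (intro power_mono mult_left_mono Y_bound) auto
  finally show ?thesis by simp
qed

lemma e_step2: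
  assumes "1 \<le> k"
  shows "cmod (e B v k \<omega> - e B v (k-1) \<omega> * (1 + \<i> * v * Y B k \<omega> - v\<^sup>2 / 2 * (Y B k \<omega> * Y B k \<omega>))) \<le> \<bar>v\<bar>^3 / 6"
proof -
  let ?x = "v * Y B k \<omega>"
  have "e B v k \<omega> - e B v (k-1) \<omega> * (1 + \<i> * v * Y B k \<omega> - v\<^sup>2 / 2 * (Y B k \<omega> * Y B k \<omega>))
      = e B v (k-1) \<omega> * (iexp ?x - (1 + \<i> * ?x + (\<i> * ?x)\<^sup>2 / 2))"
    by (simp add: e_def S_Suc[OF assms] distrib_left exp_add algebra_simps power2_eq_square)
  then have "cmod (e B v k \<omega> - e B v (k-1) \<omega> * (1 + \<i> * v * Y B k \<omega> - v\<^sup>2 / 2 * (Y B k \<omega> * Y B k \<omega>)))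
      = cmod (iexp ?x - (1 + \<i> * ?x + (\<i> * ?x)\<^sup>2 / 2))"
    by (simp add: norm_mult)
  also have "\<dots> \<le> \<bar>?x\<bar>^3 / 6" using iexp_approx1[of ?x 2] by (simp add: numeral_2_eq_2 numeral_3_eq_3 fact_numeral)
  also have "\<bar>?x\<bar>^3 \<le> (\<bar>v\<bar> * 1)^3" unfolding abs_mult
    by (intro power_mono mult_left_mono Y_bound) auto
  finally show ?thesis by simp
qed

context
  fixes B :: "real set"
  assumes B[measurable]: "B \<in> sets borel"
begin

lemma S_measurable[measurable]: "S B k \<in> borel_measurable M"
  unfolding S_def using Y_measurable[OF B] by measurable

lemma e_measurable[measurable]: "e B v k \<in> borel_measurable M"
  unfolding e_def by measurable

lemma S_measurable_sub: "S B k \<in> borel_measurable (sub {1..int k})"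
  unfolding S_def[abs_def] by (intro borel_measurable_sum Y_measurable_sub[OF B]) auto

lemma e_measurable_sub: "e B v k \<in> borel_measurable (sub {1..int k})"
  using S_measurable_sub unfolding e_def[abs_def] by measurable

lemma expectation_Y_Y_gamma:
  assumes "1 \<le> i"
  shows "expectation (\<lambda>\<omega>. Y B i \<omega> * Y B (i + k) \<omega>) = \<gamma> B k"
proof -
  have "expectation (\<lambda>\<omega>. Y B i \<omega> * Y B (i + k) \<omega>) =
     expectation (\<lambda>\<omega>. (indicat_real B (X (1 + (int i - 1)) \<omega>) - \<pi> B) * (indicat_real B (X ((1 + int k) + (int i - 1)) \<omega>) - \<pi> B))"
    by (simp add: Y_def add.commute)
  also have "\<dots> = expectation (\<lambda>\<omega>. (indicat_real B (X 1 \<omega>) - \<pi> B) * (indicat_real B (X (1 + int k) \<omega>) - \<pi> B))"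
    by (rule stationary_expectation[of "\<lambda>x. (indicat_real B (x 1) - \<pi> B) * (indicat_real B (x (1 + int k)) - \<pi> B)"]) measurable
  finally show ?thesis by (simp add: \<gamma>_def Y_def)
qed

lemma gamma_le: "\<bar>\<gamma> B k\<bar> \<le> \<alpha> k"
  using cov_Y_le[OF B, of 1 k] by (simp add: \<gamma>_def)

lemma summable_gamma: "summable (\<gamma> B)"
  by (rule summable_comparison_test[OF _ summable_\<alpha>]) (use gamma_le in auto)

lemma g_tendsto: "g B \<longlonglongrightarrow> \<sigma>2 B"
proof -
  have "summable (\<lambda>i. \<gamma> B (Suc i))" using summable_gamma summable_Suc_iff by blast
  then have "(\<lambda>n. \<Sum>i<n. \<gamma> B (Suc i)) \<longlonglongrightarrow> (\<Sum>i. \<gamma> B (Suc i))" by (rule summable_LIMSEQ)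
  then have "(\<lambda>n. \<gamma> B 0 + 2 * (\<Sum>i<n. \<gamma> B (Suc i))) \<longlonglongrightarrow> \<sigma>2 B" unfolding \<sigma>2_def by (intro tendsto_intros)
  moreover have "(\<Sum>i<n. \<gamma> B (Suc i)) = (\<Sum>i\<in>{1..<Suc n}. \<gamma> B i)" for n
    by (rule sum.reindex_bij_witness[of _ "\<lambda>i. i - 1" Suc]) auto
  ultimately have "(\<lambda>n. g B (Suc n)) \<longlonglongrightarrow> \<sigma>2 B" by (simp add: g_def)
  then show ?thesis by (rule LIMSEQ_imp_Suc)
qed

lemma second_moment_S: "expectation (\<lambda>\<omega>. (S B n \<omega>)\<^sup>2) = (\<Sum>k=1..n. g B k)"
proof (induction n)
  case (Suc n)
  let ?k = "Suc n"
  have i1: "integrable M (\<lambda>\<omega>. (S B n \<omega>)\<^sup>2)"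
    by (rule integrable_bounded[of _ "(real n)\<^sup>2"])
       (use S_diff_bound[of 0 n B] in \<open>auto simp: S_def abs_le_square_iff[symmetric]\<close>)
  have "(S B ?k \<omega>)\<^sup>2 = (S B n \<omega>)\<^sup>2 + 2 * (\<Sum>j=1..n. Y B j \<omega> * Y B ?k \<omega>) + Y B ?k \<omega> * Y B (?k + 0) \<omega>" for \<omega>
  proof -
    have "S B ?k \<omega> = S B n \<omega> + Y B ?k \<omega>" using S_Suc[of ?k B \<omega>] by simp
    moreover have "(\<Sum>j=1..n. Y B j \<omega> * Y B ?k \<omega>) = S B n \<omega> * Y B ?k \<omega>" by (simp add: S_def sum_distrib_right)
    ultimately show ?thesis by (simp add: power2_eq_square algebra_simps)
  qed
  then have "expectation (\<lambda>\<omega>. (S B ?k \<omega>)\<^sup>2) = expectation (\<lambda>\<omega>. (S B n \<omega>)\<^sup>2) + 2 * (\<Sum>j=1..n. expectation (\<lambda>\<omega>. Y B j \<omega> * Y B ?k \<omega>)) + \<gamma> B 0"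
    using i1 integrable_Y_mult[OF B] expectation_Y_Y_gamma[of ?k 0]
    by (simp add: Bochner_Integration.integral_sum)
  also have "(\<Sum>j=1..n. expectation (\<lambda>\<omega>. Y B j \<omega> * Y B ?k \<omega>)) = (\<Sum>j=1..n. \<gamma> B (?k - j))"
  proof (rule sum.cong[OF refl])
    fix j assume "j \<in> {1..n}"
    then show "expectation (\<lambda>\<omega>. Y B j \<omega> * Y B ?k \<omega>) = \<gamma> B (?k - j)"
      using expectation_Y_Y_gamma[of j "?k - j"] by simp
  qed
  also have "\<dots> = (\<Sum>i\<in>{1..<?k}. \<gamma> B i)"
    by (rule sum.reindex_bij_witness[of _ "\<lambda>i. ?k - i" "\<lambda>i. ?k - i"]) auto
  finally show ?case using Suc.IH by (simp add: g_def)
qed (simp add: S_def)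

lemma second_moment_S_tendsto: "(\<lambda>n. expectation (\<lambda>\<omega>. (S B n \<omega>)\<^sup>2) / n) \<longlonglongrightarrow> \<sigma>2 B"
  unfolding second_moment_S by (rule cesaro_mean[OF g_tendsto])

lemma integrable_e[simp]: "integrable M (e B v k)"
  by (rule integrable_bounded[of _ 1]) auto

lemma integrable_e_Y[simp]: "integrable M (\<lambda>\<omega>. e B v k \<omega> * Y B i \<omega>)"
  using Y_measurable[OF B] by (intro integrable_bounded[of _ 1]) (auto simp: norm_mult Y_bound)

lemma integrable_e_Y_Y[simp]: "integrable M (\<lambda>\<omega>. e B v k \<omega> * of_real (Y B i \<omega> * Y B j \<omega>))"
  using Y_measurable[OF B] by (intro integrable_bounded[of _ 1]) (auto simp: norm_mult intro!: mult_le_one Y_bound)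

lemma A_bound: "cmod (A B v k) \<le> 1"
  unfolding A_def by (rule abs_expectation_le) auto

lemma A_diff_bound:
  assumes "b \<le> a" shows "cmod (A B v a - A B v b) \<le> \<bar>v\<bar> * real (a - b)"
proof -
  have "A B v a - A B v b = integral\<^sup>L M (\<lambda>\<omega>. e B v a \<omega> - e B v b \<omega>)" unfolding A_def by simp
  then show ?thesis using abs_expectation_le[of "\<lambda>\<omega>. e B v a \<omega> - e B v b \<omega>"] e_diff_bound[OF assms] by simp
qed

text \<open>Moving the exponential \<open>L\<close> steps into the past costs \<open>\<bar>v\<bar> L\<close> and buys the mixing rate \<open>\<alpha> (L + 1)\<close>.\<close>

lemma three_fold_decoupling:
  assumes "1 \<le> j" "j \<le> k"
  shows "cmod (integral\<^sup>L M (\<lambda>\<omega>. e B v (j-1) \<omega> * of_real (Y B j \<omega> * Y B k \<omega>)) - A B v (k-1) * \<gamma> B (k-j))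
     \<le> \<bar>v\<bar> * (2 * real L + real (k - j)) + 8 * \<alpha> (L+1)"
proof -
  \<comment> \<open>Truncated subtraction: if fewer than \<open>L\<close> past steps exist,
    \<open>q\<close> is 0, the exponential is 1 and there is nothing to decouple.\<close>
  define q where "q = j - 1 - L"
  have YY: "\<bar>Y B j \<omega> * Y B k \<omega>\<bar> \<le> 1" for \<omega> by (auto simp: abs_mult intro!: mult_le_one Y_bound)
  have G: "expectation (\<lambda>\<omega>. Y B j \<omega> * Y B k \<omega>) = \<gamma> B (k-j)"
    using expectation_Y_Y_gamma[OF assms(1), of "k - j"] assms by simp
  have G1: "\<bar>\<gamma> B (k-j)\<bar> \<le> 1"
    unfolding G[symmetric] using abs_expectation_le[of "\<lambda>\<omega>. Y B j \<omega> * Y B k \<omega>" 1] YY Y_measurable[OF B] by simp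
  have 1: "cmod (integral\<^sup>L M (\<lambda>\<omega>. e B v (j-1) \<omega> * of_real (Y B j \<omega> * Y B k \<omega>)) - integral\<^sup>L M (\<lambda>\<omega>. e B v q \<omega> * of_real (Y B j \<omega> * Y B k \<omega>))) \<le> \<bar>v\<bar> * real L"
  proof -
    have "integral\<^sup>L M (\<lambda>\<omega>. e B v (j-1) \<omega> * of_real (Y B j \<omega> * Y B k \<omega>)) - integral\<^sup>L M (\<lambda>\<omega>. e B v q \<omega> * of_real (Y B j \<omega> * Y B k \<omega>))
       = integral\<^sup>L M (\<lambda>\<omega>. (e B v (j-1) \<omega> - e B v q \<omega>) * of_real (Y B j \<omega> * Y B k \<omega>))"
      by (subst Bochner_Integration.integral_diff[symmetric]) (simp_all only: integrable_e_Y_Y left_diff_distrib)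
    also have "cmod \<dots> \<le> \<bar>v\<bar> * real L"
    proof (rule abs_expectation_le)
      show "(\<lambda>\<omega>. (e B v (j-1) \<omega> - e B v q \<omega>) * of_real (Y B j \<omega> * Y B k \<omega>)) \<in> borel_measurable M"
        using Y_measurable[OF B] by measurable
      fix \<omega>
      have "cmod (e B v (j-1) \<omega> - e B v q \<omega>) \<le> \<bar>v\<bar> * real (j - 1 - q)"
        by (rule e_diff_bound) (simp add: q_def)
      also have "\<dots> \<le> \<bar>v\<bar> * real L" by (intro mult_left_mono) (auto simp: q_def)
      finally have "cmod (e B v (j-1) \<omega> - e B v q \<omega>) \<le> \<bar>v\<bar> * real L" .
      from mult_mono[OF this YY[of \<omega>]] show "cmod ((e B v (j-1) \<omega> - e B v q \<omega>) * of_real (Y B j \<omega> * Y B k \<omega>)) \<le> \<bar>v\<bar> * real L"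
        unfolding norm_mult norm_of_real by simp
    qed
    finally show ?thesis .
  qed
  have 2: "cmod (integral\<^sup>L M (\<lambda>\<omega>. e B v q \<omega> * of_real (Y B j \<omega> * Y B k \<omega>)) - A B v q * \<gamma> B (k-j)) \<le> 8 * \<alpha> (L+1)"
  proof (cases "q = 0")
    case True
    have "integral\<^sup>L M (\<lambda>\<omega>. e B v q \<omega> * of_real (Y B j \<omega> * Y B k \<omega>)) = of_real (\<gamma> B (k-j))"
      unfolding True G[symmetric] by (subst integral_complex_of_real[symmetric]) simp
    moreover have "e B v 0 = (\<lambda>_. 1)" by (rule ext) simp
    then have "A B v q = 1" unfolding True A_def by (simp add: prob_space)
    ultimately show ?thesis using \<alpha>_nonneg by simp
  next
    case False
    \<comment> \<open>For nonzero \<open>q\<close> one has \<open>q + (L + 1) = j\<close>, so the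
      gap before the earlier of the two factors is exactly \<open>L + 1\<close>.\<close>
    have "cmod (integral\<^sup>L M (\<lambda>\<omega>. e B v q \<omega> * of_real (Y B j \<omega> * Y B k \<omega>)) - integral\<^sup>L M (e B v q) * expectation (\<lambda>\<omega>. Y B j \<omega> * Y B k \<omega>)) \<le> 8 * 1 * 1 * \<alpha> (L+1)"
    proof (rule cov_le_complex[OF e_measurable_sub])
      show "(\<lambda>\<omega>. Y B j \<omega> * Y B k \<omega>) \<in> borel_measurable (sub {int q + int (L + 1)..})"
        by (intro borel_measurable_times Y_measurable_sub[OF B]) (use False assms in \<open>auto simp: q_def\<close>)
    qed (use YY in auto)
    then show ?thesis unfolding G A_def by simp
  qed
  \<comment> \<open>All lags must share the same factor \<open>A B v (k-1)\<close>, so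
    \<open>A\<close> is moved forward again from \<open>q\<close>, by at most
    \<open>L + (k - j)\<close> steps. With the \<open>L\<close> steps back this gives
    \<open>2 * L + (k - j)\<close>.\<close>
  have 3: "cmod (A B v q * \<gamma> B (k-j) - A B v (k-1) * \<gamma> B (k-j)) \<le> \<bar>v\<bar> * (real L + real (k - j))"
  proof -
    have "A B v q * \<gamma> B (k-j) - A B v (k-1) * \<gamma> B (k-j) = (A B v q - A B v (k-1)) * \<gamma> B (k-j)" by (simp add: left_diff_distrib)
    also have "cmod \<dots> \<le> (\<bar>v\<bar> * real (k - 1 - q)) * 1"
      unfolding norm_mult norm_of_real using G1
      by (intro mult_mono) (use A_diff_bound[of q "k-1" v] assms in \<open>auto simp: norm_minus_commute q_def\<close>)
    also have "\<dots> \<le> \<bar>v\<bar> * (real L + real (k - j))"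
      using assms by (simp only: mult_1_right, intro mult_left_mono) (auto simp: q_def)
    finally show ?thesis .
  qed
  show ?thesis using norm_triangle_le[OF add_mono[OF norm_triangle_le[OF add_mono[OF 1 2]] 3]]
    by (auto simp: algebra_simps)
qed

text \<open>Lags up to \<open>m\<close> are expanded to second order, larger ones only contribute the tail of \<open>\<alpha>\<close>.
  With \<open>n v\<^sup>2\<close> bounded, summing over \<open>k \<le> n\<close> and letting first \<open>n\<close>, then \<open>L\<close>, then \<open>m\<close> tend to
  infinity makes the error vanish.\<close>

lemma one_step_bound:
  fixes v :: real and m L :: nat
  assumes k: "1 \<le> k"
  defines "\<theta> \<equiv> \<bar>v\<bar> * (2 * real L + real m) + 8 * \<alpha> (L+1)"
  shows "cmod (A B v k - A B v (k-1) * of_real (1 - v\<^sup>2 / 2 * g B k)) \<le>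
    \<bar>v\<bar>^3 / 6 + (real m * (\<bar>v\<bar>^3 / 2 + v\<^sup>2 * \<theta>) + 9 * v\<^sup>2 * (\<Sum>i. \<alpha> (i + m))) + v\<^sup>2 / 2 * \<theta>"
proof -
  let ?I = "\<lambda>f. integral\<^sup>L M f :: complex"
  define R where "R = ?I (\<lambda>\<omega>. e B v (k-1) \<omega> * of_real (Y B k \<omega> * Y B k \<omega>))"
  define Q where "Q = ?I (\<lambda>\<omega>. e B v (k-1) \<omega> * Y B k \<omega>)"
  define D where "D j = ?I (\<lambda>\<omega>. (e B v j \<omega> - e B v (j-1) \<omega>) * Y B k \<omega>)" for j
  have Ym[measurable]: "Y B i \<in> borel_measurable M" for i by (rule Y_measurable[OF B])
  have \<theta>0: "0 \<le> \<theta>" unfolding \<theta>_def using \<alpha>_nonneg by simp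
  have Deq: "D j = ?I (\<lambda>\<omega>. e B v j \<omega> * Y B k \<omega>) - ?I (\<lambda>\<omega>. e B v (j-1) \<omega> * Y B k \<omega>)" for j
    unfolding D_def left_diff_distrib by (rule Bochner_Integration.integral_diff) auto
  \<comment> \<open>\<open>Q\<close> is telescoped back to \<open>e B v 0\<close>, which is 1, where
    it vanishes because \<open>Y\<close> is centred. The increment at \<open>j\<close> is close to
    \<open>\<i> * v * A B v (k-1) * \<gamma> B (k-j)\<close>, and the outer factor
    \<open>\<i> * v\<close> produces the negative lag terms of
    \<open>- v\<^sup>2 / 2 * g B k\<close>.\<close>
  have "(\<Sum>j\<in>{1..<k}. D j) = (\<Sum>j<k-1. ?I (\<lambda>\<omega>. e B v (Suc j) \<omega> * Y B k \<omega>) - ?I (\<lambda>\<omega>. e B v j \<omega> * Y B k \<omega>))"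
    unfolding Deq by (rule sum.reindex_bij_witness[of _ Suc "\<lambda>j. j - 1"]) auto
  also have "\<dots> = Q - ?I (\<lambda>\<omega>. e B v 0 \<omega> * Y B k \<omega>)"
    by (subst sum_lessThan_telescope) (simp add: Q_def)
  also have "?I (\<lambda>\<omega>. e B v 0 \<omega> * Y B k \<omega>) = 0"
    using expectation_Y[OF B, of k] by simp
  finally have Qsum: "Q = (\<Sum>j\<in>{1..<k}. D j)" by simp
  have err: "cmod (A B v k - (A B v (k-1) + \<i> * v * Q - v\<^sup>2 / 2 * R)) \<le> \<bar>v\<bar>^3 / 6"
  proof -
    have "A B v k - (A B v (k-1) + \<i> * v * Q - v\<^sup>2 / 2 * R) =
      ?I (\<lambda>\<omega>. e B v k \<omega> - (e B v (k-1) \<omega> + \<i> * v * (e B v (k-1) \<omega> * Y B k \<omega>) - v\<^sup>2 / 2 * (e B v (k-1) \<omega> * of_real (Y B k \<omega> * Y B k \<omega>))))"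
      unfolding A_def Q_def R_def
      by (simp only: Bochner_Integration.integral_diff Bochner_Integration.integral_add integral_mult_right_zero
          integrable_e integrable_e_Y integrable_e_Y_Y Bochner_Integration.integrable_diff Bochner_Integration.integrable_add integrable_mult_right)
    also have "cmod \<dots> \<le> \<bar>v\<bar>^3 / 6"
    proof (rule abs_expectation_le)
      fix \<omega>
      show "cmod (e B v k \<omega> - (e B v (k-1) \<omega> + \<i> * v * (e B v (k-1) \<omega> * Y B k \<omega>) - v\<^sup>2 / 2 * (e B v (k-1) \<omega> * of_real (Y B k \<omega> * Y B k \<omega>)))) \<le> \<bar>v\<bar>^3 / 6"
        using e_step2[OF k, of B v \<omega>] by (simp add: algebra_simps)
    qed measurable
    finally show ?thesis .
  qed
  \<comment> \<open>Small lags: \<bar>v\<bar> times the Taylor error \<open>v\<^sup>2 / 2\<close>,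
    plus \<open>v\<^sup>2\<close> times the decoupling error. Large lags: 8 from the covariance
    inequality for an increment of size \<bar>v\<bar>, and 1 from \<open>gamma_le\<close> for the
    compensating term.\<close>
  define bd where "bd i = (if i \<le> m then \<bar>v\<bar>^3 / 2 + v\<^sup>2 * \<theta> else 9 * v\<^sup>2 * \<alpha> i)" for i
  have Dj: "cmod (\<i> * v * D j + v\<^sup>2 * A B v (k-1) * \<gamma> B (k-j)) \<le> bd (k - j)" if j: "j \<in> {1..<k}" for j
  proof (cases "k - j \<le> m")
    case True
    define P where "P = ?I (\<lambda>\<omega>. e B v (j-1) \<omega> * of_real (Y B j \<omega> * Y B k \<omega>))"
    have "D j - \<i> * v * P = ?I (\<lambda>\<omega>. (e B v j \<omega> - e B v (j-1) \<omega> * (1 + \<i> * v * Y B j \<omega>)) * Y B k \<omega>)"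
    proof -
      have "?I (\<lambda>\<omega>. (e B v j \<omega> - e B v (j-1) \<omega> * (1 + \<i> * v * Y B j \<omega>)) * Y B k \<omega>)
         = ?I (\<lambda>\<omega>. (e B v j \<omega> * Y B k \<omega> - e B v (j-1) \<omega> * Y B k \<omega>) - \<i> * v * (e B v (j-1) \<omega> * of_real (Y B j \<omega> * Y B k \<omega>)))"
        by (rule Bochner_Integration.integral_cong) (simp_all add: algebra_simps)
      also have "\<dots> = D j - \<i> * v * P"
        unfolding Deq P_def
        by (simp only: Bochner_Integration.integral_diff integral_mult_right_zero integrable_e_Y integrable_e_Y_Y Bochner_Integration.integrable_diff integrable_mult_right)
      finally show ?thesis ..
    qed
    also have "cmod \<dots> \<le> v\<^sup>2 / 2"
    proof (rule abs_expectation_le)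
      fix \<omega>
      have "1 \<le> j" using j by simp
      from mult_mono[OF e_step1[OF this, of B v \<omega>] Y_bound[of B k \<omega>]]
      show "cmod ((e B v j \<omega> - e B v (j-1) \<omega> * (1 + \<i> * v * Y B j \<omega>)) * Y B k \<omega>) \<le> v\<^sup>2 / 2"
        by (simp add: norm_mult)
    qed measurable
    finally have D1: "cmod (D j - \<i> * v * P) \<le> v\<^sup>2 / 2" .
    have "cmod (P - A B v (k-1) * \<gamma> B (k-j)) \<le> \<bar>v\<bar> * (2 * real L + real (k - j)) + 8 * \<alpha> (L+1)"
      unfolding P_def by (rule three_fold_decoupling) (use j in auto)
    also have "\<dots> \<le> \<theta>" unfolding \<theta>_def using True by (intro add_right_mono mult_left_mono) auto
    finally have P1: "cmod (P - A B v (k-1) * \<gamma> B (k-j)) \<le> \<theta>" .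
    have "\<i> * v * D j + v\<^sup>2 * A B v (k-1) * \<gamma> B (k-j) = \<i> * v * (D j - \<i> * v * P) - v\<^sup>2 * (P - A B v (k-1) * \<gamma> B (k-j))"
      by (simp add: algebra_simps power2_eq_square)
    also have "cmod \<dots> \<le> \<bar>v\<bar> * (v\<^sup>2 / 2) + v\<^sup>2 * \<theta>"
      by (rule order_trans[OF norm_triangle_ineq4], rule add_mono)
         (simp_all add: norm_mult norm_power mult_left_mono[OF D1, of "\<bar>v\<bar>", simplified] mult_left_mono[OF P1[unfolded One_nat_def]])
    also have "\<dots> = \<bar>v\<bar>^3 / 2 + v\<^sup>2 * \<theta>" by (simp add: power3_eq_cube power2_eq_square)
    finally show ?thesis using True by (simp add: bd_def)
  next
    case False
    have "cmod (?I (\<lambda>\<omega>. (e B v j \<omega> - e B v (j-1) \<omega>) * Y B k \<omega>) - ?I (\<lambda>\<omega>. e B v j \<omega> - e B v (j-1) \<omega>) * expectation (Y B k)) \<le> 8 * \<bar>v\<bar> * 1 * \<alpha> (k - j)"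
    proof (rule cov_le_complex)
      have "e B v (j-1) \<in> borel_measurable (sub {1..int j})"
      proof -
        have "S B (j-1) \<in> borel_measurable (sub {1..int j})"
          unfolding S_def[abs_def] by (intro borel_measurable_sum Y_measurable_sub[OF B]) auto
        then show ?thesis unfolding e_def[abs_def] by measurable
      qed
      then show "(\<lambda>\<omega>. e B v j \<omega> - e B v (j-1) \<omega>) \<in> borel_measurable (sub {1..int j})"
        by (intro borel_measurable_diff e_measurable_sub)
      show "cmod (e B v j \<omega> - e B v (j-1) \<omega>) \<le> \<bar>v\<bar>" for \<omega>
        using e_diff_bound[of "j-1" j B v \<omega>] j by (auto simp: Suc_diff_le)
      show "Y B k \<in> borel_measurable (sub {int j + int (k - j)..})"
        by (rule Y_measurable_sub[OF B]) (use j in auto)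
    qed (rule Y_bound)
    then have D1: "cmod (D j) \<le> 8 * \<bar>v\<bar> * \<alpha> (k-j)" unfolding expectation_Y[OF B] D_def by simp
    have "cmod (A B v (k-1)) * \<bar>\<gamma> B (k-j)\<bar> \<le> 1 * \<alpha> (k-j)"
      by (intro mult_mono A_bound gamma_le) auto
    then have A1: "v\<^sup>2 * (cmod (A B v (k-1)) * \<bar>\<gamma> B (k-j)\<bar>) \<le> v\<^sup>2 * (1 * \<alpha> (k-j))"
      by (intro mult_left_mono) auto
    have "\<bar>v\<bar> * cmod (D j) \<le> \<bar>v\<bar> * (8 * \<bar>v\<bar> * \<alpha> (k-j))"
      by (intro mult_left_mono D1) auto
    then have "cmod (\<i> * v * D j + v\<^sup>2 * A B v (k-1) * \<gamma> B (k-j)) \<le> \<bar>v\<bar> * (8 * \<bar>v\<bar> * \<alpha> (k-j)) + v\<^sup>2 * (1 * \<alpha> (k-j))"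
      using A1 by (intro order_trans[OF norm_triangle_ineq] add_mono) (simp_all add: norm_mult norm_power mult.assoc)
    also have "\<dots> = 9 * v\<^sup>2 * \<alpha> (k-j)" by (simp add: power2_eq_square)
    finally show ?thesis using False by (simp add: bd_def)
  qed
  have bdsum: "(\<Sum>i\<in>{1..<k}. bd i) \<le> real m * (\<bar>v\<bar>^3 / 2 + v\<^sup>2 * \<theta>) + 9 * v\<^sup>2 * (\<Sum>i. \<alpha> (i + m))"
  proof -
    have nn: "0 \<le> bd i" "0 \<le> 9 * v\<^sup>2 * \<alpha> i" for i using \<theta>0 \<alpha>_nonneg by (auto simp: bd_def)
    \<comment> \<open>The second range starts at \<open>m\<close> rather than \<open>m + 1\<close>,
      so that a shift by \<open>m\<close> makes it an initial segment of the tail series.\<close>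
    have "(\<Sum>i\<in>{1..<k}. bd i) \<le> (\<Sum>i\<in>{1..<k}. (if i \<in> {1..m} then \<bar>v\<bar>^3 / 2 + v\<^sup>2 * \<theta> else 0) + (if i \<in> {m..<m+k} then 9 * v\<^sup>2 * \<alpha> i else 0))"
      using nn by (intro sum_mono) (auto simp: bd_def)
    also have "\<dots> = (\<Sum>i\<in>{1..<k} \<inter> {1..m}. \<bar>v\<bar>^3 / 2 + v\<^sup>2 * \<theta>) + (\<Sum>i\<in>{1..<k} \<inter> {m..<m+k}. 9 * v\<^sup>2 * \<alpha> i)"
      by (subst sum.distrib) (simp only: sum.inter_restrict finite_atLeastLessThan)
    also have "\<dots> \<le> (\<Sum>i\<in>{1..m}. \<bar>v\<bar>^3 / 2 + v\<^sup>2 * \<theta>) + (\<Sum>i\<in>{m..<m+k}. 9 * v\<^sup>2 * \<alpha> i)"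
      by (intro add_mono sum_mono2) (use nn \<theta>0 in auto)
    also have "(\<Sum>i\<in>{m..<m+k}. 9 * v\<^sup>2 * \<alpha> i) = 9 * v\<^sup>2 * (\<Sum>i<k. \<alpha> (i + m))"
      unfolding sum_distrib_left[symmetric]
      by (simp add: sum.shift_bounds_nat_ivl[of \<alpha> 0 m k, simplified add_0] lessThan_atLeast0 add.commute)
    also have "\<dots> \<le> 9 * v\<^sup>2 * (\<Sum>i. \<alpha> (i + m))"
      by (intro mult_left_mono sum_le_suminf) (use \<alpha>_nonneg summable_\<alpha> in \<open>auto simp: summable_iff_shift\<close>)
    finally show ?thesis by simp
  qed
  have R1: "cmod (R - A B v (k-1) * \<gamma> B 0) \<le> \<theta>"
  proof -
    have "cmod (R - A B v (k-1) * \<gamma> B (k-k)) \<le> \<bar>v\<bar> * (2 * real L + real (k - k)) + 8 * \<alpha> (L+1)"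
      unfolding R_def by (rule three_fold_decoupling) (use k in auto)
    also have "\<dots> \<le> \<theta>" unfolding \<theta>_def by (intro add_right_mono mult_left_mono) auto
    finally show ?thesis by simp
  qed
  have gs: "(\<Sum>i\<in>{1..<k}. \<gamma> B i) = (\<Sum>j\<in>{1..<k}. \<gamma> B (k-j))"
    by (rule sum.reindex_bij_witness[of _ "\<lambda>i. k - i" "\<lambda>i. k - i"]) auto
  have "A B v k - A B v (k-1) * of_real (1 - v\<^sup>2 / 2 * g B k) =
     (A B v k - (A B v (k-1) + \<i> * v * Q - v\<^sup>2 / 2 * R)) + (\<Sum>j\<in>{1..<k}. \<i> * v * D j + v\<^sup>2 * A B v (k-1) * \<gamma> B (k-j))
     - v\<^sup>2 / 2 * (R - A B v (k-1) * \<gamma> B 0)"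
  proof -
    have "(\<Sum>j\<in>{1..<k}. \<i> * v * D j + v\<^sup>2 * A B v (k-1) * \<gamma> B (k-j)) =
      \<i> * v * Q + v\<^sup>2 * A B v (k-1) * of_real (\<Sum>j\<in>{1..<k}. \<gamma> B (k-j))"
      unfolding Qsum sum.distrib sum_distrib_left[symmetric] of_real_sum ..
    then show ?thesis unfolding g_def gs by (simp add: algebra_simps)
  qed
  also have "cmod \<dots> \<le> \<bar>v\<bar>^3 / 6 + (\<Sum>j\<in>{1..<k}. bd (k - j)) + v\<^sup>2 / 2 * \<theta>"
  proof (rule order_trans[OF norm_triangle_ineq4], rule add_mono)
    show "cmod ((A B v k - (A B v (k-1) + \<i> * v * Q - v\<^sup>2 / 2 * R)) + (\<Sum>j\<in>{1..<k}. \<i> * v * D j + v\<^sup>2 * A B v (k-1) * \<gamma> B (k-j)))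
       \<le> \<bar>v\<bar>^3 / 6 + (\<Sum>j\<in>{1..<k}. bd (k - j))"
      by (rule order_trans[OF norm_triangle_ineq], rule add_mono[OF err]) (rule sum_norm_le, rule Dj)
    have "cmod (v\<^sup>2 / 2 * (R - A B v (k-1) * \<gamma> B 0)) = v\<^sup>2 / 2 * cmod (R - A B v (k-1) * \<gamma> B 0)"
      by (simp add: norm_mult norm_divide norm_power)
    then show "cmod (v\<^sup>2 / 2 * (R - A B v (k-1) * \<gamma> B 0)) \<le> v\<^sup>2 / 2 * \<theta>"
      using R1 by (simp add: mult_left_mono)
  qed
  also have "(\<Sum>j\<in>{1..<k}. bd (k - j)) = (\<Sum>i\<in>{1..<k}. bd i)"
    by (rule sum.reindex_bij_witness[of _ "\<lambda>i. k - i" "\<lambda>i. k - i"]) auto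
  finally show ?thesis using bdsum by linarith
qed

end

end

section \<open>Convergence of the characteristic functions\<close>

context mixing_process
begin

text \<open>The factors \<open>1 - v\<^sup>2 / 2 * g B k\<close> vary with \<open>k\<close>.
  Replacing \<open>g B k\<close> by its limit makes the recursion a power; the total cost is
  \<open>w / 2\<close> times the Cesaro mean of \<bar>\<open>g B k - \<sigma>2 B\<close>\<bar>,
  which tends to 0.\<close>

lemma char_sum_tendsto:
  assumes B[measurable]: "B \<in> sets borel" and v: "\<And>n. 1 \<le> n \<Longrightarrow> real n * (v n)\<^sup>2 = w"
  shows "(\<lambda>n. A B (v n) n) \<longlonglongrightarrow> exp (- (w * \<sigma>2 B / 2))"
proof -
  define T where "T m = (\<Sum>i. \<alpha> (i + m))" for m
  have w0: "0 \<le> w" using v[of 1] by (simp add: mult_nonneg_nonneg flip: v[of 1])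
  have Tlim: "T \<longlonglongrightarrow> 0" unfolding T_def by (rule suminf_exist_split2[OF summable_\<alpha>])
  have \<alpha>1: "(\<lambda>L. \<alpha> (L + 1)) \<longlonglongrightarrow> 0" using LIMSEQ_Suc[OF \<alpha>_tendsto] by simp
  have vlim: "(\<lambda>n. \<bar>v n\<bar>) \<longlonglongrightarrow> 0"
  proof (rule Lim_transform_eventually)
    show "(\<lambda>n. sqrt (w / real n)) \<longlonglongrightarrow> 0"
      using tendsto_real_sqrt[OF tendsto_divide_0[OF tendsto_const filterlim_real_sequentially[THEN filterlim_at_top_imp_at_infinity]], of w] by simp
    show "\<forall>\<^sub>F n in sequentially. sqrt (w / real n) = \<bar>v n\<bar>"
      using eventually_ge_at_top[of 1]
    proof eventually_elim
      case (elim n)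
      have "w / real n = (v n)\<^sup>2" using v[OF elim] elim by (simp add: field_simps)
      then show ?case by simp
    qed
  qed
  define r where "r n = (1 + (- (w * \<sigma>2 B / 2)) / real n) ^ n" for n
  have rlim: "r \<longlonglongrightarrow> exp (- (w * \<sigma>2 B / 2))" unfolding r_def by (rule tendsto_exp_limit_sequentially)
  have ces: "(\<lambda>n. (\<Sum>k=1..n. \<bar>g B k - \<sigma>2 B\<bar>) / real n) \<longlonglongrightarrow> 0"
    by (rule cesaro_mean) (use g_tendsto[OF B] in \<open>simp add: LIM_zero tendsto_rabs_zero\<close>)
  \<comment> \<open>\<open>n\<close> times the one-step error, with \<open>n * v\<^sup>2\<close>
    replaced by \<open>w\<close>. A cubic term keeps one factor \<bar>\<open>v n\<close>\<bar> and
    dies as \<open>n\<close> grows.\<close>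
  define E where "E m L n = w * (\<bar>v n\<bar> / 6 + (real m * (\<bar>v n\<bar> / 2 + (\<bar>v n\<bar> * (2 * real L + real m) + 8 * \<alpha> (L+1))) + 9 * T m)
       + (\<bar>v n\<bar> * (2 * real L + real m) + 8 * \<alpha> (L+1)) / 2)
       + w / 2 * ((\<Sum>k=1..n. \<bar>g B k - \<sigma>2 B\<bar>) / real n)" for m L n
  have bound: "cmod (A B (v n) n - of_real (r n)) \<le> E m L n" if n: "1 \<le> n" "w * \<sigma>2 B / 2 \<le> real n" "\<bar>w * \<sigma>2 B / 2\<bar> \<le> real n" for m L n
  proof -
    let ?v = "v n"
    let ?\<rho> = "complex_of_real (1 - ?v\<^sup>2 / 2 * \<sigma>2 B)"
    define \<theta> where "\<theta> = \<bar>?v\<bar> * (2 * real L + real m) + 8 * \<alpha> (L+1)"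
    define st where "st = \<bar>?v\<bar>^3 / 6 + (real m * (\<bar>?v\<bar>^3 / 2 + ?v\<^sup>2 * \<theta>) + 9 * ?v\<^sup>2 * T m) + ?v\<^sup>2 / 2 * \<theta>"
    have v2: "?v\<^sup>2 = w / real n" using v[OF n(1)] n by (simp add: field_simps)
    have \<sigma>0: "0 \<le> \<sigma>2 B"
      by (rule tendsto_lowerbound[OF second_moment_S_tendsto[OF B]]) (auto intro!: always_eventually divide_nonneg_nonneg Bochner_Integration.integral_nonneg)
    \<comment> \<open>For \<open>n\<close> this large the base of the power lies between 0 and 1, as
      \<open>linear_recursion_bound\<close> requires.\<close>
    have "w * \<sigma>2 B / 2 / real n \<le> 1" using n by (simp add: divide_le_eq)
    then have \<rho>: "cmod ?\<rho> \<le> 1" unfolding norm_of_real v2 using w0 \<sigma>0 n by (auto simp: abs_le_iff mult.commute)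
    have "cmod (A B ?v n - A B ?v 0 * ?\<rho> ^ n) \<le> (\<Sum>k=1..n. st + ?v\<^sup>2 / 2 * \<bar>g B k - \<sigma>2 B\<bar>)"
    proof (rule linear_recursion_bound[OF \<rho>])
      fix k :: nat assume k: "1 \<le> k"
      have "A B ?v k - A B ?v (k - 1) * ?\<rho> = (A B ?v k - A B ?v (k-1) * of_real (1 - ?v\<^sup>2 / 2 * g B k)) - A B ?v (k-1) * of_real (?v\<^sup>2 / 2 * (g B k - \<sigma>2 B))"
        by (simp add: field_simps)
      also have "cmod \<dots> \<le> st + ?v\<^sup>2 / 2 * \<bar>g B k - \<sigma>2 B\<bar>"
      proof (rule order_trans[OF norm_triangle_ineq4], rule add_mono)
        show "cmod (A B ?v k - A B ?v (k-1) * of_real (1 - ?v\<^sup>2 / 2 * g B k)) \<le> st"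
          using one_step_bound[OF B k, of ?v m L] unfolding st_def \<theta>_def T_def .
        have "cmod (A B ?v (k-1)) * \<bar>?v\<^sup>2 / 2 * (g B k - \<sigma>2 B)\<bar> \<le> 1 * \<bar>?v\<^sup>2 / 2 * (g B k - \<sigma>2 B)\<bar>"
          by (intro mult_right_mono A_bound[OF B]) auto
        then show "cmod (A B ?v (k-1) * of_real (?v\<^sup>2 / 2 * (g B k - \<sigma>2 B))) \<le> ?v\<^sup>2 / 2 * \<bar>g B k - \<sigma>2 B\<bar>"
          unfolding norm_mult norm_of_real by (simp add: abs_mult)
      qed
      finally show "cmod (A B ?v k - A B ?v (k - 1) * ?\<rho>) \<le> st + ?v\<^sup>2 / 2 * \<bar>g B k - \<sigma>2 B\<bar>" .
    qed
    also have "\<dots> = real n * st + real n * ?v\<^sup>2 / 2 * ((\<Sum>k=1..n. \<bar>g B k - \<sigma>2 B\<bar>) / real n)"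
      unfolding sum.distrib sum_distrib_left[symmetric] using n by simp
    also have "real n * st = (real n * ?v\<^sup>2) * (\<bar>?v\<bar> / 6 + (real m * (\<bar>?v\<bar> / 2 + \<theta>) + 9 * T m) + \<theta> / 2)"
      unfolding st_def power3_eq_cube by (simp add: algebra_simps power2_eq_square)
    finally have "cmod (A B ?v n - A B ?v 0 * ?\<rho> ^ n) \<le> E m L n"
      unfolding v[OF n(1)] E_def \<theta>_def by simp
    moreover have "e B ?v 0 = (\<lambda>_. 1)" by (rule ext) simp
    then have "A B ?v 0 = 1" unfolding A_def by (simp add: prob_space)
    moreover have "?\<rho> ^ n = of_real (r n)" unfolding r_def v2 of_real_power[symmetric] by (simp add: mult.commute)
    ultimately show ?thesis by simp
  qed
  have "(\<lambda>n. A B (v n) n - of_real (r n)) \<longlonglongrightarrow> 0"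
  proof (rule tendstoI)
    fix \<epsilon> :: real assume \<epsilon>: "0 < \<epsilon>"
    have "(\<lambda>m. w * (9 * T m)) \<longlonglongrightarrow> w * (9 * 0)" by (intro tendsto_intros Tlim)
    then have "\<forall>\<^sub>F m in sequentially. w * (9 * T m) < \<epsilon> / 2" using \<epsilon> by (intro order_tendstoD) auto
    then obtain m where m: "w * (9 * T m) < \<epsilon> / 2" using eventually_happens'[OF sequentially_bot] by blast
    \<comment> \<open>The decoupling error enters once for each of the \<open>m\<close> short lags
      and with weight 1/2 in the quadratic term. \<open>L\<close> is chosen after
      \<open>m\<close>.\<close>
    have "(\<lambda>L. w * ((real m + 1/2) * (8 * \<alpha> (L + 1)))) \<longlonglongrightarrow> w * ((real m + 1/2) * (8 * 0))" by (intro tendsto_intros \<alpha>1)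
    then have "\<forall>\<^sub>F L in sequentially. w * ((real m + 1/2) * (8 * \<alpha> (L + 1))) < \<epsilon> / 2" using \<epsilon> by (intro order_tendstoD) auto
    then obtain L where L: "w * ((real m + 1/2) * (8 * \<alpha> (L + 1))) < \<epsilon> / 2" using eventually_happens'[OF sequentially_bot] by blast
    have "E m L \<longlonglongrightarrow> w * (0 / 6 + (real m * (0 / 2 + (0 * (2 * real L + real m) + 8 * \<alpha> (L+1))) + 9 * T m)
       + (0 * (2 * real L + real m) + 8 * \<alpha> (L+1)) / 2) + w / 2 * 0"
      unfolding E_def[abs_def] by (intro tendsto_intros vlim ces) auto
    moreover have "w * (0 / 6 + (real m * (0 / 2 + (0 * (2 * real L + real m) + 8 * \<alpha> (L+1))) + 9 * T m)
       + (0 * (2 * real L + real m) + 8 * \<alpha> (L+1)) / 2) + w / 2 * 0 < \<epsilon>"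
      using m L by (simp add: algebra_simps)
    ultimately have "\<forall>\<^sub>F n in sequentially. E m L n < \<epsilon>" by (rule order_tendstoD(2))
    moreover have "\<forall>\<^sub>F n in sequentially. n \<ge> nat \<lceil>\<bar>w * \<sigma>2 B / 2\<bar>\<rceil> + 1" by (rule eventually_ge_at_top)
    ultimately show "\<forall>\<^sub>F n in sequentially. dist (A B (v n) n - of_real (r n)) 0 < \<epsilon>"
    proof eventually_elim
      case (elim n)
      have "\<bar>w * \<sigma>2 B / 2\<bar> \<le> real n" using elim(2) by linarith
      then have "cmod (A B (v n) n - of_real (r n)) \<le> E m L n"
        using elim(2) by (intro bound) auto
      then show ?case using elim(1) by simp
    qed
  qed
  moreover have "(\<lambda>n. complex_of_real (r n)) \<longlonglongrightarrow> of_real (exp (- (w * \<sigma>2 B / 2)))" by (rule tendsto_of_real[OF rlim])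
  ultimately have "(\<lambda>n. (A B (v n) n - of_real (r n)) + of_real (r n)) \<longlonglongrightarrow> 0 + of_real (exp (- (w * \<sigma>2 B / 2)))"
    by (rule tendsto_add)
  then show ?thesis by simp
qed

theorem mixing_clt:
  assumes B[measurable]: "B \<in> sets borel" and \<sigma>: "\<sigma> > 0" "\<sigma>2 B = \<sigma>\<^sup>2"
  shows "weak_conv_m (\<lambda>n. distr M borel (\<lambda>\<omega>. S B n \<omega> / sqrt n / \<sigma>)) std_normal_distribution"
proof (rule levy_continuity)
  fix u
  let ?v = "\<lambda>n::nat. u / (sqrt n * \<sigma>)"
  have "char (distr M borel (\<lambda>\<omega>. S B n \<omega> / sqrt n / \<sigma>)) u = A B (?v n) n" for n
    unfolding char_def A_def e_def using S_measurable[OF B]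
    by (subst integral_distr) (auto simp: field_simps)
  moreover have "(\<lambda>n. A B (?v n) n) \<longlonglongrightarrow> exp (- (u\<^sup>2 / \<sigma>\<^sup>2 * \<sigma>2 B / 2))"
    by (rule char_sum_tendsto[OF B]) (simp add: power_mult_distrib power_divide)
  ultimately show "(\<lambda>n. char (distr M borel (\<lambda>\<omega>. S B n \<omega> / sqrt n / \<sigma>)) u) \<longlonglongrightarrow> char std_normal_distribution u"
    using \<sigma> by (simp add: char_std_normal_distribution)
qed (use S_measurable[OF B] in \<open>auto intro!: real_dist_normal_dist\<close>)

end

subsection \<open>Circular blocks\<close>

context prob_space
begin

text \<open>Outer probability: exceptional sets need not be measurable, only covered by a small event.\<close>

definition whp :: "real \<Rightarrow> (nat \<Rightarrow> 'a \<Rightarrow> bool) \<Rightarrow> bool" where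
  "whp \<eta> P \<longleftrightarrow> (\<forall>\<^sub>F n in sequentially. \<exists>A\<in>events. prob A \<le> \<eta> \<and> {\<omega>\<in>space M. \<not> P n \<omega>} \<subseteq> A)"

lemma whp_conj:
  assumes "whp \<eta> P" "whp \<eta>' Q"
  shows "whp (\<eta> + \<eta>') (\<lambda>n \<omega>. P n \<omega> \<and> Q n \<omega>)"
  using assms unfolding whp_def
proof eventually_elim
  case (elim n)
  then obtain A C where "A \<in> events" "prob A \<le> \<eta>" "{\<omega>\<in>space M. \<not> P n \<omega>} \<subseteq> A"
    and "C \<in> events" "prob C \<le> \<eta>'" "{\<omega>\<in>space M. \<not> Q n \<omega>} \<subseteq> C" by blast
  then show ?case
    using measure_Un_le[of A M C] by (intro bexI[of _ "A \<union> C"]) auto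
qed

lemma whp_mono:
  assumes "whp \<eta> P" "\<forall>\<^sub>F n in sequentially. \<forall>\<omega>\<in>space M. P n \<omega> \<longrightarrow> Q n \<omega>"
  shows "whp \<eta> Q"
  using assms unfolding whp_def
proof eventually_elim
  case (elim n)
  then show ?case by blast
qed

lemma whp_finite_Ball:
  assumes "finite T" "\<And>t \<eta>. t \<in> T \<Longrightarrow> 0 < \<eta> \<Longrightarrow> whp \<eta> (P t)"
  shows "0 < \<eta> \<Longrightarrow> whp \<eta> (\<lambda>n \<omega>. \<forall>t\<in>T. P t n \<omega>)"
  using assms
proof (induction T arbitrary: \<eta> rule: finite_induct)
  case empty
  then show ?case by (auto simp: whp_def intro!: always_eventually bexI[of _ "{}"])
next
  case (insert t T)
  have "whp (\<eta>/2) (P t)" by (rule insert.prems(2)) (use insert.prems in auto)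
  moreover have "whp (\<eta>/2) (\<lambda>n \<omega>. \<forall>t\<in>T. P t n \<omega>)"
    by (rule insert.IH) (use insert.prems in auto)
  ultimately have "whp (\<eta>/2 + \<eta>/2) (\<lambda>n \<omega>. P t n \<omega> \<and> (\<forall>t\<in>T. P t n \<omega>))" by (rule whp_conj)
  then show ?case by simp
qed

text \<open>The means need only be eventually small, not convergent to 0: the truncation error has a
  positive limit at each fixed level, and tightness uses a mere bound.\<close>

lemma whp_markov:
  fixes Z :: "nat \<Rightarrow> 'a \<Rightarrow> real"
  assumes int: "\<And>n. integrable M (Z n)" and nn: "\<And>n \<omega>. \<omega> \<in> space M \<Longrightarrow> 0 \<le> Z n \<omega>"
    and ev: "\<forall>\<^sub>F n in sequentially. expectation (Z n) \<le> \<tau>" and \<tau>: "\<tau> \<le> \<eta> * \<delta>" "0 < \<delta>"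
  shows "whp \<eta> (\<lambda>n \<omega>. Z n \<omega> < \<delta>)"
  unfolding whp_def using ev
proof eventually_elim
  case (elim n)
  have [measurable]: "Z n \<in> borel_measurable M" using int by auto
  have "prob {\<omega>\<in>space M. Z n \<omega> \<ge> \<delta>} \<le> expectation (Z n) / \<delta>"
    by (rule integral_Markov_inequality_measure[where A="{}"]) (use int nn \<tau> in auto)
  also have "\<dots> \<le> \<eta>" using elim \<tau> by (simp add: divide_le_eq)
  finally show ?case by (intro bexI[of _ "{\<omega>\<in>space M. Z n \<omega> \<ge> \<delta>}"]) auto
qed

lemma whp_markov_0:
  fixes Z :: "nat \<Rightarrow> 'a \<Rightarrow> real"
  assumes "\<And>n. integrable M (Z n)" "\<And>n \<omega>. \<omega> \<in> space M \<Longrightarrow> 0 \<le> Z n \<omega>"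
    and "(\<lambda>n. expectation (Z n)) \<longlonglongrightarrow> 0" and "0 < \<eta>" "0 < \<delta>"
  shows "whp \<eta> (\<lambda>n \<omega>. Z n \<omega> < \<delta>)"
proof (rule whp_markov[OF assms(1,2)])
  show "\<forall>\<^sub>F n in sequentially. expectation (Z n) \<le> \<eta> * \<delta>"
    using order_tendstoD(2)[OF assms(3), of "\<eta> * \<delta>"] assms(4,5)
    by (auto elim: eventually_mono)
qed (use assms in auto)

lemma whp_L2:
  fixes Z :: "nat \<Rightarrow> 'a \<Rightarrow> real"
  assumes "\<And>n. integrable M (\<lambda>\<omega>. (Z n \<omega>)\<^sup>2)"
    and "(\<lambda>n. expectation (\<lambda>\<omega>. (Z n \<omega>)\<^sup>2)) \<longlonglongrightarrow> 0" and "0 < \<eta>" "0 < \<delta>"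
  shows "whp \<eta> (\<lambda>n \<omega>. \<bar>Z n \<omega>\<bar> < \<delta>)"
proof -
  have "whp \<eta> (\<lambda>n \<omega>. (Z n \<omega>)\<^sup>2 < \<delta>\<^sup>2)"
    by (rule whp_markov_0) (use assms in auto)
  then show ?thesis
  proof (rule whp_mono, intro always_eventually allI ballI impI)
    fix n \<omega> assume "(Z n \<omega>)\<^sup>2 < \<delta>\<^sup>2"
    then show "\<bar>Z n \<omega>\<bar> < \<delta>" using assms(4) by (intro power2_less_imp_less[of "\<bar>Z n \<omega>\<bar>"]) auto
  qed
qed

end

text \<open>The conditional expectation of a function of one uniformly drawn block start; see
  \<open>expectation_pmf_of_set_interval\<close>.\<close>

definition avg :: "nat \<Rightarrow> (nat \<Rightarrow> real) \<Rightarrow> real" where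
  "avg n f = (\<Sum>j=1..n. f j) / real n"

lemma avg_mono: "(\<And>j. j \<in> {1..n} \<Longrightarrow> f j \<le> h j) \<Longrightarrow> avg n f \<le> avg n h"
  unfolding avg_def by (intro divide_right_mono sum_mono) auto

lemma avg_nonneg: "(\<And>j. j \<in> {1..n} \<Longrightarrow> 0 \<le> f j) \<Longrightarrow> 0 \<le> avg n f"
  unfolding avg_def by (intro divide_nonneg_nonneg sum_nonneg) auto

lemma avg_add: "avg n (\<lambda>j. f j + h j) = avg n f + avg n h"
  by (simp add: avg_def sum.distrib add_divide_distrib)

lemma avg_diff: "avg n (\<lambda>j. f j - h j) = avg n f - avg n h"
  by (simp add: avg_def sum_subtractf diff_divide_distrib)

lemma avg_mult: "avg n (\<lambda>j. c * f j) = c * avg n f"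
  by (simp add: avg_def sum_distrib_left)

lemma avg_le_const: "0 \<le> c \<Longrightarrow> (\<And>j. j \<in> {1..n} \<Longrightarrow> f j \<le> c) \<Longrightarrow> avg n f \<le> c"
  using sum_mono[of "{1..n}" f "\<lambda>_. c"] by (cases "n = 0") (auto simp: avg_def divide_le_eq mult.commute)

text \<open>Transfers second moment and truncation error from \<eta> to \<xi> when only mean-square
  closeness is known. The weighted inequality \<open>2 * \<bar>x * d\<bar> \<le> \<delta> *
  x\<^sup>2 + d\<^sup>2 / \<delta>\<close> is matched to closeness \<open>\<delta>\<^sup>2\<close>,
  so both of its terms cost order \<delta>.\<close>

lemma avg_square_perturbation:
  fixes \<xi> \<eta> :: "nat \<Rightarrow> real"
  assumes \<delta>: "0 < \<delta>" "\<delta> \<le> 1" and \<Delta>: "avg n (\<lambda>j. (\<xi> j - \<eta> j)\<^sup>2) < \<delta>\<^sup>2"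
    and trunc: "avg n (\<lambda>j. (\<eta> j)\<^sup>2 - min ((\<eta> j)\<^sup>2) K) < \<delta>"
    and AK: "\<bar>avg n (\<lambda>j. min ((\<eta> j)\<^sup>2) K) - c\<bar> < \<delta>" and c: "\<bar>c - v\<bar> < \<delta>"
  shows "\<bar>avg n (\<lambda>j. (\<xi> j)\<^sup>2) - v\<bar> < \<delta> * (v + 8)"
    and "avg n (\<lambda>j. (\<xi> j)\<^sup>2 - min ((\<xi> j)\<^sup>2) (2 * K)) < 4 * \<delta>"
proof -
  let ?A = "avg n (\<lambda>j. (\<eta> j)\<^sup>2)" and ?\<Delta> = "avg n (\<lambda>j. (\<xi> j - \<eta> j)\<^sup>2)"
  have "0 \<le> avg n (\<lambda>j. (\<eta> j)\<^sup>2 - min ((\<eta> j)\<^sup>2) K)" by (rule avg_nonneg) simp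
  then have A: "\<bar>?A - v\<bar> < 3 * \<delta>" using trunc AK c unfolding avg_diff by linarith
  have amgm: "2 * \<bar>x * d\<bar> \<le> \<delta> * x\<^sup>2 + d\<^sup>2 / \<delta>" for x d :: real
  proof -
    have "0 \<le> (\<delta> * \<bar>x\<bar> - \<bar>d\<bar>)\<^sup>2 / \<delta>" using \<delta> by simp
    also have "\<dots> = \<delta> * x\<^sup>2 + d\<^sup>2 / \<delta> - 2 * (\<bar>x\<bar> * \<bar>d\<bar>)" using \<delta> by (simp add: power2_diff field_simps power2_eq_square)
    finally show ?thesis by (simp add: abs_mult)
  qed
  have pt: "\<bar>x\<^sup>2 - y\<^sup>2\<bar> \<le> \<delta> * y\<^sup>2 + (1 + 1/\<delta>) * (x - y)\<^sup>2" for x y :: real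
  proof -
    have "x\<^sup>2 - y\<^sup>2 = 2 * (y * (x - y)) + (x - y)\<^sup>2" by (simp add: power2_eq_square algebra_simps)
    then have "\<bar>x\<^sup>2 - y\<^sup>2\<bar> \<le> 2 * \<bar>y * (x - y)\<bar> + (x - y)\<^sup>2" using zero_le_power2[of "x - y"] by linarith
    then show ?thesis using amgm[of y "x - y"] by (simp add: distrib_right)
  qed
  have "avg n (\<lambda>j. (\<xi> j)\<^sup>2 - (\<eta> j)\<^sup>2) \<le> avg n (\<lambda>j. \<delta> * (\<eta> j)\<^sup>2 + (1 + 1/\<delta>) * (\<xi> j - \<eta> j)\<^sup>2)"
  proof (rule avg_mono)
    fix j show "(\<xi> j)\<^sup>2 - (\<eta> j)\<^sup>2 \<le> \<delta> * (\<eta> j)\<^sup>2 + (1 + 1/\<delta>) * (\<xi> j - \<eta> j)\<^sup>2"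
      by (rule order_trans[OF abs_ge_self pt])
  qed
  moreover have "avg n (\<lambda>j. (\<eta> j)\<^sup>2 - (\<xi> j)\<^sup>2) \<le> avg n (\<lambda>j. \<delta> * (\<eta> j)\<^sup>2 + (1 + 1/\<delta>) * (\<xi> j - \<eta> j)\<^sup>2)"
  proof (rule avg_mono)
    fix j show "(\<eta> j)\<^sup>2 - (\<xi> j)\<^sup>2 \<le> \<delta> * (\<eta> j)\<^sup>2 + (1 + 1/\<delta>) * (\<xi> j - \<eta> j)\<^sup>2"
      by (rule order_trans[OF abs_ge_self]) (subst abs_minus_commute, rule pt)
  qed
  ultimately have "\<bar>avg n (\<lambda>j. (\<xi> j)\<^sup>2) - ?A\<bar> \<le> \<delta> * ?A + (1 + 1/\<delta>) * ?\<Delta>"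
    unfolding avg_diff avg_add avg_mult by (simp add: abs_le_iff)
  also have "(1 + 1/\<delta>) * ?\<Delta> \<le> (1 + 1/\<delta>) * \<delta>\<^sup>2" using \<Delta> \<delta> by (intro mult_left_mono) auto
  also have "(1 + 1/\<delta>) * \<delta>\<^sup>2 = \<delta> * \<delta> + \<delta>" using \<delta> by (simp add: field_simps power2_eq_square)
  also have "\<delta> * \<delta> \<le> \<delta> * 1" using \<delta> by (intro mult_left_mono) auto
  also have "\<delta> * ?A \<le> \<delta> * (v + 3)" using A \<delta> by (intro mult_left_mono) auto
  \<comment> \<open>The 8 is 3 + 2 + 3: the bound \<open>v + 3\<close> for the average square of
    \<eta>, the perturbation term \<open>\<delta> * \<delta> + \<delta>\<close>, and the distance of
    that average from \<open>v\<close>.\<close>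
  finally show "\<bar>avg n (\<lambda>j. (\<xi> j)\<^sup>2) - v\<bar> < \<delta> * (v + 8)" using A by (simp add: algebra_simps)
  \<comment> \<open>Doubling the level absorbs the 2 in
    \<open>x\<^sup>2 \<le> 2 * y\<^sup>2 + 2 * (x - y)\<^sup>2\<close>; below the level the left
    side is 0.\<close>
  have pt2: "x\<^sup>2 - min (x\<^sup>2) (2 * K) \<le> 2 * (y\<^sup>2 - min (y\<^sup>2) K) + 2 * (x - y)\<^sup>2" for x y :: real
  proof -
    have "x\<^sup>2 \<le> 2 * y\<^sup>2 + 2 * (x - y)\<^sup>2" using sum_squares_ge_zero[of "2 * y - x" 0] by (simp add: power2_eq_square algebra_simps)
    moreover have "0 \<le> (x - y)\<^sup>2" by simp
    moreover have "min (y\<^sup>2) K \<le> K" "min (y\<^sup>2) K \<le> y\<^sup>2" by auto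
    moreover have "min (x\<^sup>2) (2 * K) = x\<^sup>2 \<or> min (x\<^sup>2) (2 * K) = 2 * K" by (auto simp: min_def)
    moreover have "a \<le> 2 * b + 2 * d \<Longrightarrow> 0 \<le> d \<Longrightarrow> u \<le> K \<Longrightarrow> u \<le> b \<Longrightarrow> w = a \<or> w = 2 * K
        \<Longrightarrow> a - w \<le> 2 * (b - u) + 2 * d" for a b d u w :: real
      by auto
    ultimately show ?thesis by blast
  qed
  have "avg n (\<lambda>j. (\<xi> j)\<^sup>2 - min ((\<xi> j)\<^sup>2) (2 * K)) \<le> 2 * avg n (\<lambda>j. (\<eta> j)\<^sup>2 - min ((\<eta> j)\<^sup>2) K) + 2 * ?\<Delta>"
    unfolding avg_mult[symmetric] avg_add[symmetric] by (rule avg_mono) (rule pt2)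
  also have "\<dots> < 2 * \<delta> + 2 * (\<delta> * \<delta>)" using trunc \<Delta> by (simp add: power2_eq_square)
  also have "\<delta> * \<delta> \<le> \<delta> * 1" using \<delta> by (intro mult_left_mono) auto
  finally show "avg n (\<lambda>j. (\<xi> j)\<^sup>2 - min ((\<xi> j)\<^sup>2) (2 * K)) < 4 * \<delta>" by simp
qed

section \<open>Circular block sums and their weak law\<close>

context mixing_process
begin

definition Zc :: "real set \<Rightarrow> nat \<Rightarrow> nat \<Rightarrow> nat \<Rightarrow> 'a \<Rightarrow> real" where
  "Zc B n l j \<omega> = (\<Sum>r<l. Y B ((j + r - 1) mod n + 1) \<omega>)"

text \<open>A block running past \<open>n\<close> is a contiguous block of \<open>a\<close> indices
  ending at \<open>n\<close> followed by one starting at 1, so estimates for contiguous blocks apply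
  to each piece. \<open>l \<le> n\<close> excludes a second wrap.\<close>

lemma Zc_split:
  assumes "1 \<le> j" "j \<le> n" "l \<le> n"
  defines "a \<equiv> min l (n + 1 - j)"
  shows "Zc B n l j \<omega> = (\<Sum>i\<in>{j..<j+a}. Y B i \<omega>) + (\<Sum>i\<in>{1..<1+(l-a)}. Y B i \<omega>)"
proof -
  have al: "a \<le> l" and ja: "j + a \<le> n + 1" using assms(1,2) unfolding a_def by linarith+
  have un: "{..<l} = {..<a} \<union> {a..<l}" using al by auto
  have "Zc B n l j \<omega> = (\<Sum>r<a. Y B ((j + r - 1) mod n + 1) \<omega>) + (\<Sum>r\<in>{a..<l}. Y B ((j + r - 1) mod n + 1) \<omega>)"
    unfolding Zc_def un by (rule sum.union_disjoint) auto
  also have "(\<Sum>r<a. Y B ((j + r - 1) mod n + 1) \<omega>) = (\<Sum>i\<in>{j..<j+a}. Y B i \<omega>)"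
  proof (rule sum.reindex_bij_witness[of _ "\<lambda>i. i - j" "\<lambda>r. j + r"])
    fix r assume "r \<in> {..<a}"
    then have "(j + r - 1) mod n = j + r - 1" using ja assms(1) by (intro mod_less) auto
    then show "Y B (j + r) \<omega> = Y B ((j + r - 1) mod n + 1) \<omega>" using assms(1) by simp
  qed auto
  also have "(\<Sum>r\<in>{a..<l}. Y B ((j + r - 1) mod n + 1) \<omega>) = (\<Sum>i\<in>{1..<1+(l-a)}. Y B i \<omega>)"
  proof (rule sum.reindex_bij_witness[of _ "\<lambda>i. i - 1 + a" "\<lambda>r. r - a + 1"])
    fix r assume r: "r \<in> {a..<l}"
    then have "\<not> l \<le> n + 1 - j" unfolding a_def by (auto simp: min_def split: if_splits)
    then have a: "a = n + 1 - j" unfolding a_def by simp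
    have "j + r - 1 = n + (r - a)" using r a assms(1,2) by auto
    moreover have "r - a < n" using r assms(3) by auto
    ultimately have "(j + r - 1) mod n = r - a" by simp
    then show "Y B (r - a + 1) \<omega> = Y B ((j + r - 1) mod n + 1) \<omega>" by simp
  qed auto
  finally show ?thesis .
qed

lemma Zc_regular:
  assumes "1 \<le> j" "j + l \<le> n + 1" "1 \<le> l"
  shows "Zc B n l j \<omega> = (\<Sum>i\<in>{j..<j+l}. Y B i \<omega>)"
  using Zc_split[of j n l B \<omega>] assms by auto

lemma Zc_bound: "\<bar>Zc B n l j \<omega>\<bar> \<le> real l"
proof -
  have "\<bar>Zc B n l j \<omega>\<bar> \<le> (\<Sum>r<l. 1)" unfolding Zc_def
    by (rule order_trans[OF sum_abs sum_mono]) (rule Y_bound)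
  then show ?thesis by simp
qed

lemma \<kappa>_mono: "0 \<le> x \<Longrightarrow> x \<le> y \<Longrightarrow> \<kappa> x \<le> \<kappa> y"
proof -
  have "summable (\<lambda>k. min (\<alpha> k) z)" if "0 \<le> z" for z
    by (rule summable_comparison_test[OF _ summable_\<alpha>]) (use that \<alpha>_nonneg in auto)
  then show "0 \<le> x \<Longrightarrow> x \<le> y \<Longrightarrow> \<kappa> x \<le> \<kappa> y" unfolding \<kappa>_def by (intro suminf_le) auto
qed

context
  fixes B :: "real set"
  assumes B[measurable]: "B \<in> sets borel"
begin

lemma Zc_measurable[measurable]: "Zc B n l j \<in> borel_measurable M"
  unfolding Zc_def[abs_def] using Y_measurable[OF B] by measurable

lemma integrable_Zc2[simp]: "integrable M (\<lambda>\<omega>. (Zc B n l j \<omega>)\<^sup>2)"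
proof (rule integrable_bounded[of _ "(real l)\<^sup>2"])
  show "norm ((Zc B n l j x)\<^sup>2) \<le> (real l)\<^sup>2" for x
    using power_mono[OF Zc_bound[of B n l j x], of 2] by simp
qed measurable

lemma integrable_sum_Y2: "integrable M (\<lambda>\<omega>. (\<Sum>i\<in>I. Y B i \<omega>)\<^sup>2)"
  unfolding power2_eq_square sum_product by (intro Bochner_Integration.integrable_sum integrable_Y_mult[OF B])

lemma integrable_S2[simp]: "integrable M (\<lambda>\<omega>. (S B n \<omega>)\<^sup>2)"
  unfolding S_def by (rule integrable_sum_Y2)

lemma second_moment_S_le: "expectation (\<lambda>\<omega>. (S B n \<omega>)\<^sup>2) \<le> 2 * real n * \<kappa> (\<pi> B)"
  using second_moment_sum_le[OF B, of 1 n] unfolding S_def \<kappa>_def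
  by (simp add: atLeastLessThanSuc_atLeastAtMost)

text \<open>The lengths of the two pieces add up to \<open>l\<close>; splitting the square doubles
  the constant 2 of a contiguous block.\<close>

lemma second_moment_Zc_le:
  assumes "1 \<le> j" "j \<le> n" "l \<le> n"
  shows "expectation (\<lambda>\<omega>. (Zc B n l j \<omega>)\<^sup>2) \<le> 4 * real l * \<kappa> (\<pi> B)"
proof -
  define a where "a = min l (n + 1 - j)"
  let ?U = "\<lambda>\<omega>. \<Sum>i\<in>{j..<j+a}. Y B i \<omega>" and ?V = "\<lambda>\<omega>. \<Sum>i\<in>{1..<1+(l-a)}. Y B i \<omega>"
  have "(Zc B n l j \<omega>)\<^sup>2 \<le> 2 * (?U \<omega>)\<^sup>2 + 2 * (?V \<omega>)\<^sup>2" for \<omega>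
    unfolding Zc_split[OF assms] a_def[symmetric]
    using sum_squares_ge_zero[of "?U \<omega> - ?V \<omega>" 0] by (simp add: power2_eq_square algebra_simps)
  then have "expectation (\<lambda>\<omega>. (Zc B n l j \<omega>)\<^sup>2) \<le> expectation (\<lambda>\<omega>. 2 * (?U \<omega>)\<^sup>2 + 2 * (?V \<omega>)\<^sup>2)"
    by (intro integral_mono Bochner_Integration.integrable_add integrable_mult_right integrable_sum_Y2 integrable_Zc2)
  also have "\<dots> = 2 * expectation (\<lambda>\<omega>. (?U \<omega>)\<^sup>2) + 2 * expectation (\<lambda>\<omega>. (?V \<omega>)\<^sup>2)"
    by (simp only: Bochner_Integration.integral_add integrable_mult_right integrable_sum_Y2 integral_mult_right_zero)
  also have "\<dots> \<le> 2 * (2 * real a * \<kappa> (\<pi> B)) + 2 * (2 * real (l - a) * \<kappa> (\<pi> B))"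
    unfolding \<kappa>_def by (intro add_mono mult_left_mono second_moment_sum_le[OF B] assms) auto
  also have "\<dots> = 4 * (real a + real (l - a)) * \<kappa> (\<pi> B)" by (simp add: algebra_simps)
  also have "real a + real (l - a) = real l" by (simp add: a_def)
  finally show ?thesis .
qed

lemma expectation_block:
  fixes \<phi> :: "real \<Rightarrow> real"
  assumes [measurable]: "\<phi> \<in> borel_measurable borel" and j: "1 \<le> j"
  shows "expectation (\<lambda>\<omega>. \<phi> (\<Sum>i\<in>{j..<j+l}. Y B i \<omega>)) = expectation (\<lambda>\<omega>. \<phi> (S B l \<omega>))"
proof -
  let ?f = "\<lambda>x :: int \<Rightarrow> real. \<phi> (\<Sum>i\<in>{1..l}. indicat_real B (x (int i)) - \<pi> B)"
  have "(\<Sum>i\<in>{j..<j+l}. Y B i \<omega>) = (\<Sum>i\<in>{1..l}. indicat_real B (X (int i + (int j - 1)) \<omega>) - \<pi> B)" for \<omega>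
    unfolding Y_def
  proof (rule sum.reindex_bij_witness[of _ "\<lambda>i. i + (j - 1)" "\<lambda>i. i - (j - 1)"])
    fix a assume "a \<in> {j..<j+l}"
    then have "int (a - (j - 1)) + (int j - 1) = int a" using j by auto
    then show "indicat_real B (X (int (a - (j - 1)) + (int j - 1)) \<omega>) - \<pi> B = indicat_real B (X (int a) \<omega>) - \<pi> B" by simp
  qed (use j in auto)
  then have "expectation (\<lambda>\<omega>. \<phi> (\<Sum>i\<in>{j..<j+l}. Y B i \<omega>)) = expectation (\<lambda>\<omega>. ?f (\<lambda>i. X (i + (int j - 1)) \<omega>))" by simp
  also have "\<dots> = expectation (\<lambda>\<omega>. ?f (\<lambda>i. X i \<omega>))" by (rule stationary_expectation) measurable
  finally show ?thesis by (simp add: S_def Y_def)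
qed

text \<open>Blocks more than \<open>l\<close> apart decorrelate, so bounded functions of the \<open>l\<close>-blocks obey a
  weak law as soon as \<open>l = o(n)\<close>.\<close>

lemma block_weak_law:
  fixes h :: "real \<Rightarrow> real"
  assumes h[measurable]: "h \<in> borel_measurable borel" and hK: "\<And>x. 0 \<le> h x \<and> h x \<le> K"
    and l: "1 \<le> l" "l \<le> n"
  defines "\<mu> \<equiv> expectation (\<lambda>\<omega>. h (S B l \<omega>))"
  shows "expectation (\<lambda>\<omega>. (avg n (\<lambda>j. h (Zc B n l j \<omega>)) - \<mu>)\<^sup>2)
    \<le> 4 * K\<^sup>2 * (real l / real n) + 16 * K\<^sup>2 * (\<Sum>k. \<alpha> k) / real n + 2 * K\<^sup>2 * (real l / real n)\<^sup>2"
proof -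
  \<comment> \<open>The number of starts whose block does not wrap. The other \<open>l - 1\<close>
    blocks are not contiguous, so stationarity does not identify their law; they are handled by size
    alone.\<close>
  define N where "N = n - l + 1"
  have N: "1 \<le> N" "N \<le> n" using l by (auto simp: N_def)
  have n0: "0 < real n" using l by simp
  define u where "u j \<omega> = h (\<Sum>i\<in>{j..<j+l}. Y B i \<omega>) - \<mu>" for j \<omega>
  have K0: "0 \<le> K" using hK[of 0] by linarith
  have um[measurable]: "u j \<in> borel_measurable M" for j
    unfolding u_def using Y_measurable[OF B] by measurable
  have hS: "integrable M (\<lambda>\<omega>. h (S B l \<omega>))"
    by (rule integrable_bounded[of _ K]) (use S_measurable[OF B] hK in auto)
  have \<mu>: "0 \<le> \<mu>" "\<mu> \<le> K"
  proof -
    show "0 \<le> \<mu>" unfolding \<mu>_def by (rule Bochner_Integration.integral_nonneg) (use hK in auto)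
    have "\<mu> \<le> expectation (\<lambda>_. K)" unfolding \<mu>_def by (rule integral_mono) (use hS hK in auto)
    then show "\<mu> \<le> K" by (simp add: prob_space)
  qed
  have ub: "\<bar>u j \<omega>\<bar> \<le> K" for j \<omega> using hK[of "\<Sum>i\<in>{j..<j+l}. Y B i \<omega>"] \<mu> unfolding u_def by linarith
  have u0: "expectation (u j) = 0" if "1 \<le> j" for j
  proof -
    have "integrable M (\<lambda>\<omega>. h (\<Sum>i\<in>{j..<j+l}. Y B i \<omega>))"
      by (rule integrable_bounded[of _ K]) (use Y_measurable[OF B] hK in auto)
    then show ?thesis
      unfolding u_def[abs_def] using expectation_block[OF h that, of l] by (simp add: \<mu>_def prob_space)
  qed
  have uu: "integrable M (\<lambda>\<omega>. u i \<omega> * u j \<omega>)" for i j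
    by (rule integrable_bounded[of _ "K * K"]) (auto simp: abs_mult intro!: mult_mono ub K0)
  \<comment> \<open>Blocks at lag below \<open>l\<close> overlap and get the trivial bound.
    Otherwise \<open>k - l + 1\<close> is the distance from the last index of the first block to the
    first index of the second.\<close>
  define c where "c k = (if k < l then K\<^sup>2 else 4 * K\<^sup>2 * \<alpha> (k - l + 1))" for k
  have cov: "\<bar>expectation (\<lambda>\<omega>. u i \<omega> * u (i + k) \<omega>)\<bar> \<le> c k" if i: "1 \<le> i" for i k
  proof (cases "k < l")
    case True
    have "\<bar>expectation (\<lambda>\<omega>. u i \<omega> * u (i + k) \<omega>)\<bar> \<le> K * K"
      unfolding real_norm_def[symmetric]
      by (rule abs_expectation_le) (auto simp: abs_mult intro!: mult_mono ub K0)
    then show ?thesis using True by (simp add: c_def power2_eq_square)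
  next
    case False
    have "\<bar>expectation (\<lambda>\<omega>. u i \<omega> * u (i + k) \<omega>) - expectation (u i) * expectation (u (i + k))\<bar> \<le> 4 * K * K * \<alpha> (k - l + 1)"
    proof (rule cov_le[where n="int (i + l - 1)"])
      show "u i \<in> borel_measurable (sub {1..int (i + l - 1)})"
        unfolding u_def[abs_def]
        by (intro borel_measurable_diff measurable_compose[OF _ h] borel_measurable_sum Y_measurable_sub[OF B]) (use i in auto)
      show "u (i + k) \<in> borel_measurable (sub {int (i + l - 1) + int (k - l + 1)..})"
        unfolding u_def[abs_def]
        by (intro borel_measurable_diff measurable_compose[OF _ h] borel_measurable_sum Y_measurable_sub[OF B]) (use i l False in auto)
    qed (rule ub)+
    then show ?thesis using False u0[OF i] by (simp add: c_def power2_eq_square)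
  qed
  have c0: "0 \<le> c k" for k by (simp add: c_def \<alpha>_nonneg)
  have csum: "(\<Sum>k<N. c k) \<le> K\<^sup>2 * real l + 4 * K\<^sup>2 * (\<Sum>k. \<alpha> k)"
  proof -
    have "(\<Sum>k<N. c k) \<le> (\<Sum>k<l+N. c k)" by (rule sum_mono2) (use c0 in auto)
    also have "(\<Sum>k<l+N. c k) = (\<Sum>k<l. c k) + (\<Sum>k<N. c (l + k))"
      by (induction N) simp_all
    also have "(\<Sum>k<l. c k) = K\<^sup>2 * real l" by (simp add: c_def)
    also have "(\<Sum>k<N. c (l + k)) = 4 * K\<^sup>2 * (\<Sum>k<N. \<alpha> (Suc k))"
      by (simp add: c_def sum_distrib_left)
    also have "(\<Sum>k<N. \<alpha> (Suc k)) \<le> (\<Sum>k<Suc N. \<alpha> k)" unfolding sum.lessThan_Suc_shift using \<alpha>_nonneg by simp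
    also have "\<dots> \<le> (\<Sum>k. \<alpha> k)" by (rule sum_le_suminf) (use \<alpha>_nonneg summable_\<alpha> in auto)
    finally show ?thesis by (simp add: mult_left_mono)
  qed
  define U where "U \<omega> = (\<Sum>j\<in>{1..<1+N}. u j \<omega>)" for \<omega>
  have U2: "integrable M (\<lambda>\<omega>. (U \<omega>)\<^sup>2)" unfolding U_def power2_eq_square sum_product
    by (intro Bochner_Integration.integrable_sum uu)
  have EU: "expectation (\<lambda>\<omega>. (U \<omega>)\<^sup>2) \<le> 2 * real N * (\<Sum>k<N. c k)"
  proof -
    have "expectation (\<lambda>\<omega>. (U \<omega>)\<^sup>2) = (\<Sum>i\<in>{1..<1+N}. \<Sum>j\<in>{1..<1+N}. expectation (\<lambda>\<omega>. u i \<omega> * u j \<omega>))"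
      unfolding U_def power2_eq_square sum_product using uu by (simp add: Bochner_Integration.integral_sum)
    also have "\<dots> \<le> 2 * real N * (\<Sum>k<N. c k)"
    proof (rule sum_abs_diff_le[OF c0])
      fix i k assume "i \<in> {1..<1+N}"
      then show "expectation (\<lambda>\<omega>. u i \<omega> * u (i + k) \<omega>) \<le> c k \<and> expectation (\<lambda>\<omega>. u (i + k) \<omega> * u i \<omega>) \<le> c k"
        using cov[of i k] by (simp add: mult.commute abs_le_iff)
    qed
    finally show ?thesis .
  qed
  define R where "R \<omega> = (\<Sum>j\<in>{1+N..n}. h (Zc B n l j \<omega>) - \<mu>)" for \<omega>
  have Rb: "\<bar>R \<omega>\<bar> \<le> real l * K" for \<omega>
  proof -
    have "\<bar>h x - \<mu>\<bar> \<le> K" for x using hK[of x] \<mu> by linarith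
    then have "\<bar>R \<omega>\<bar> \<le> (\<Sum>j\<in>{1+N..n}. K)" unfolding R_def by (intro order_trans[OF sum_abs sum_mono])
    also have "\<dots> = real (n - N) * K" by simp
    also have "\<dots> \<le> real l * K" by (intro mult_right_mono K0) (use l in \<open>auto simp: N_def\<close>)
    finally show ?thesis .
  qed
  have Rm[measurable]: "R \<in> borel_measurable M" unfolding R_def[abs_def] by measurable
  have R2: "(R \<omega>)\<^sup>2 \<le> (real l * K)\<^sup>2" for \<omega> using power_mono[OF Rb[of \<omega>], of 2] by simp
  have dec: "avg n (\<lambda>j. h (Zc B n l j \<omega>)) - \<mu> = (U \<omega> + R \<omega>) / real n" for \<omega>
  proof -
    have "avg n (\<lambda>j. h (Zc B n l j \<omega>)) - \<mu> = (\<Sum>j=1..n. h (Zc B n l j \<omega>) - \<mu>) / real n"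
      using n0 by (simp add: avg_def sum_subtractf field_simps)
    also have "{1..n} = {1..<1+N} \<union> {1+N..n}" using N by auto
    also have "(\<Sum>j\<in>{1..<1+N} \<union> {1+N..n}. h (Zc B n l j \<omega>) - \<mu>) = (\<Sum>j\<in>{1..<1+N}. h (Zc B n l j \<omega>) - \<mu>) + R \<omega>"
      unfolding R_def by (rule sum.union_disjoint) auto
    also have "(\<Sum>j\<in>{1..<1+N}. h (Zc B n l j \<omega>) - \<mu>) = U \<omega>"
      unfolding U_def u_def by (rule sum.cong[OF refl], subst Zc_regular) (use l in \<open>auto simp: N_def\<close>)
    finally show ?thesis .
  qed
  have "expectation (\<lambda>\<omega>. (avg n (\<lambda>j. h (Zc B n l j \<omega>)) - \<mu>)\<^sup>2) \<le> expectation (\<lambda>\<omega>. 2 / (real n)\<^sup>2 * (U \<omega>)\<^sup>2 + 2 * K\<^sup>2 * (real l / real n)\<^sup>2)"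
  proof (rule integral_mono)
    have "(avg n (\<lambda>j. h (Zc B n l j \<omega>)) - \<mu>)\<^sup>2 \<le> 2 / (real n)\<^sup>2 * (U \<omega>)\<^sup>2 + 2 * K\<^sup>2 * (real l / real n)\<^sup>2" for \<omega>
    proof -
      have "(U \<omega> + R \<omega>)\<^sup>2 \<le> 2 * (U \<omega>)\<^sup>2 + 2 * (R \<omega>)\<^sup>2"
        using sum_squares_ge_zero[of "U \<omega> - R \<omega>" 0] by (simp add: power2_eq_square algebra_simps)
      also have "\<dots> \<le> 2 * (U \<omega>)\<^sup>2 + 2 * (real l * K)\<^sup>2" using R2[of \<omega>] by simp
      finally have "(U \<omega> + R \<omega>)\<^sup>2 / (real n)\<^sup>2 \<le> (2 * (U \<omega>)\<^sup>2 + 2 * (real l * K)\<^sup>2) / (real n)\<^sup>2"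
        by (intro divide_right_mono) auto
      then show ?thesis unfolding dec power_divide
        by (simp add: power_mult_distrib add_divide_distrib mult.commute mult.left_commute)
    qed
    then show "(avg n (\<lambda>j. h (Zc B n l j \<omega>)) - \<mu>)\<^sup>2 \<le> 2 / (real n)\<^sup>2 * (U \<omega>)\<^sup>2 + 2 * K\<^sup>2 * (real l / real n)\<^sup>2" for \<omega> .
    show "integrable M (\<lambda>\<omega>. (avg n (\<lambda>j. h (Zc B n l j \<omega>)) - \<mu>)\<^sup>2)"
    proof (rule integrable_bounded[of _ "K\<^sup>2"])
      fix \<omega>
      have "0 \<le> avg n (\<lambda>j. h (Zc B n l j \<omega>))" "avg n (\<lambda>j. h (Zc B n l j \<omega>)) \<le> K"
        by (rule avg_nonneg, use hK in auto) (rule avg_le_const[OF K0], use hK in auto)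
      then have "\<bar>avg n (\<lambda>j. h (Zc B n l j \<omega>)) - \<mu>\<bar> \<le> K" using \<mu> by linarith
      from power_mono[OF this, of 2] show "norm ((avg n (\<lambda>j. h (Zc B n l j \<omega>)) - \<mu>)\<^sup>2) \<le> K\<^sup>2" by simp
    qed (simp add: avg_def)
    show "integrable M (\<lambda>\<omega>. 2 / (real n)\<^sup>2 * (U \<omega>)\<^sup>2 + 2 * K\<^sup>2 * (real l / real n)\<^sup>2)" using U2 by simp
  qed
  also have "\<dots> = 2 / (real n)\<^sup>2 * expectation (\<lambda>\<omega>. (U \<omega>)\<^sup>2) + 2 * K\<^sup>2 * (real l / real n)\<^sup>2"
    using U2 by (simp add: prob_space)
  also have "2 / (real n)\<^sup>2 * expectation (\<lambda>\<omega>. (U \<omega>)\<^sup>2) \<le> 2 / (real n)\<^sup>2 * (2 * real n * (K\<^sup>2 * real l + 4 * K\<^sup>2 * (\<Sum>k. \<alpha> k)))"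
    by (rule mult_left_mono[OF order_trans[OF EU mult_mono]]) (use N csum in \<open>auto intro!: sum_nonneg c0\<close>)
  also have "2 / (real n)\<^sup>2 * (2 * real n * (K\<^sup>2 * real l + 4 * K\<^sup>2 * (\<Sum>k. \<alpha> k))) = 4 * K\<^sup>2 * (real l / real n) + 16 * K\<^sup>2 * (\<Sum>k. \<alpha> k) / real n"
    using n0 by (simp add: field_simps power2_eq_square)
  finally show ?thesis by simp
qed

end

end

subsection \<open>The conditional central limit theorem\<close>

lemma power2_sum_le: "(a + b)\<^sup>2 \<le> 2 * a\<^sup>2 + 2 * b\<^sup>2" for a b :: real
  using sum_squares_ge_zero[of "a - b" 0] by (simp add: power2_eq_square algebra_simps)

lemma power2_diff_le: "(a - b)\<^sup>2 \<le> 2 * a\<^sup>2 + 2 * b\<^sup>2" for a b :: real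
  using power2_sum_le[of a "- b"] by simp

text \<open>The characteristic function is even, so uniqueness gives symmetry of the law; continuity
  of \<open>Phi\<close> removes the mass at \<open>x\<close>. This converts upper tails of
  \<open>W\<close> into values of \<open>Phi\<close>.\<close>

lemma Phi_uminus: "Phi (- x) = 1 - Phi x"
proof -
  let ?N = "std_normal_distribution"
  interpret N: real_distribution ?N by (rule real_dist_normal_dist)
  interpret N': real_distribution "distr ?N borel uminus" by (rule N.real_distribution_distr) simp
  have "char (distr ?N borel uminus) t = char ?N t" for t
  proof -
    have "char (distr ?N borel uminus) t = char ?N (- t)"
      unfolding char_def by (subst integral_distr) auto
    then show ?thesis by (simp add: char_std_normal_distribution)
  qed
  then have eq: "distr ?N borel uminus = ?N"
    by (intro Levy_uniqueness N'.real_distribution_axioms N.real_distribution_axioms ext)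
  have "Phi (- x) = measure (distr ?N borel uminus) {..- x}" unfolding eq by (simp add: cdf_def)
  also have "\<dots> = measure ?N {x..}" by (subst measure_distr) (auto intro!: arg_cong[of _ _ "measure ?N"])
  also have "{x..} = {x} \<union> (UNIV - {..x})" by auto
  also have "measure ?N \<dots> = measure ?N {x} + measure ?N (UNIV - {..x})"
    by (rule N.finite_measure_Union) auto
  also have "measure ?N {x} = 0" using isCont_Phi N.isCont_cdf by blast
  also have "measure ?N (UNIV - {..x}) = 1 - measure ?N {..x}"
    using N.prob_compl[of "{..x}"] by (simp)
  finally show ?thesis by (simp add: cdf_def)
qed

lemma expectation_pmf_of_set_interval:
  "1 \<le> n \<Longrightarrow> measure_pmf.expectation (pmf_of_set {1..n}) f = avg n f"
  by (subst integral_pmf_of_set) (auto simp: avg_def)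

lemma bij_rotate: "1 \<le> n \<Longrightarrow> bij_betw (\<lambda>j. (j + r - 1) mod n + 1) {1..n} {1..n::nat}"
proof -
  assume n: "1 \<le> n"
  let ?f = "\<lambda>j. (j + r - 1) mod n + 1"
  have "inj_on ?f {1..n}"
  proof (rule linorder_inj_onI)
    fix x y assume xy: "x < y" "x \<in> {1..n}" "y \<in> {1..n}"
    show "?f x \<noteq> ?f y"
    proof
      assume "?f x = ?f y"
      then have "(y + r - 1) mod n = (x + r - 1) mod n" by simp
      then have "n dvd (y + r - 1) - (x + r - 1)" using xy by (subst (asm) mod_eq_dvd_iff_nat) auto
      moreover have "(y + r - 1) - (x + r - 1) = y - x" using xy by auto
      ultimately show False using xy by (auto dest: dvd_imp_le)
    qed
  qed auto
  moreover have "?f ` {1..n} \<subseteq> {1..n}" using n by (auto simp: Suc_le_eq)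
  ultimately show ?thesis using endo_inj_surj[of "{1..n}" ?f] by (auto simp: bij_betw_def)
qed

section \<open>Resampled averages and increments in the level\<close>

context mixing_process
begin

text \<open>The benefit of circularity: rotation permutes the indices, so every observation is
  covered equally often. The bootstrap is therefore centred exactly at the empirical distribution
  function, without edge correction.\<close>

lemma sum_Zc: "1 \<le> n \<Longrightarrow> (\<Sum>j=1..n. Zc B n l j \<omega>) = real l * S B n \<omega>"
proof -
  assume n: "1 \<le> n"
  have "(\<Sum>j=1..n. Zc B n l j \<omega>) = (\<Sum>r<l. \<Sum>j=1..n. Y B ((j + r - 1) mod n + 1) \<omega>)"
    unfolding Zc_def by (rule sum.swap)
  also have "\<dots> = (\<Sum>r<l. S B n \<omega>)"
    unfolding S_def by (intro sum.cong refl sum.reindex_bij_betw[OF bij_rotate[OF n], of "\<lambda>i. Y B i \<omega>"])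
  finally show ?thesis by simp
qed

lemma ecdf_eq: "1 \<le> n \<Longrightarrow> ecdf n (\<lambda>i. X (int i) \<omega>) t = S {..t} n \<omega> / n + \<pi> {..t}"
  by (simp add: ecdf_def S_def Y_def sum_subtractf field_simps)

lemma ecdf_cbb_sample:
  assumes "1 \<le> b" "1 \<le> l"
  shows "ecdf (b * l) (cbb_sample n l (\<lambda>i. X (int i) \<omega>) J) t =
     (\<Sum>k<b. Zc {..t} n l (J k) \<omega>) / (real b * real l) + \<pi> {..t}"
proof -
  let ?f = "\<lambda>i. indicat_real {..t} (cbb_sample n l (\<lambda>i. X (int i) \<omega>) J (i + 1))"
  have "(\<Sum>i=1..b*l. indicat_real {..t} (cbb_sample n l (\<lambda>i. X (int i) \<omega>) J i)) = (\<Sum>i<b*l. ?f i)"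
    by (rule sum.reindex_bij_witness[of _ "\<lambda>i. i + 1" "\<lambda>i. i - 1"]) auto
  also have "\<dots> = (\<Sum>k<b. \<Sum>i\<in>{k*l..<k*l+l}. ?f i)" by (rule sum.nat_group[symmetric])
  also have "\<dots> = (\<Sum>k<b. Zc {..t} n l (J k) \<omega> + real l * \<pi> {..t})"
  proof (rule sum.cong[OF refl])
    fix k
    have "(\<Sum>i\<in>{k*l..<k*l+l}. ?f i) = (\<Sum>r<l. ?f (k * l + r))"
      by (rule sum.reindex_bij_witness[of _ "\<lambda>r. k*l+r" "\<lambda>i. i - k*l"]) auto
    also have "\<dots> = (\<Sum>r<l. Y {..t} ((J k + r - 1) mod n + 1) \<omega> + \<pi> {..t})"
      using assms by (intro sum.cong refl) (simp add: cbb_sample_def periodic_ext_def Y_def)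
    finally show "(\<Sum>i\<in>{k*l..<k*l+l}. ?f i) = Zc {..t} n l (J k) \<omega> + real l * \<pi> {..t}"
      by (simp add: Zc_def sum.distrib)
  qed
  finally show ?thesis using assms by (simp add: ecdf_def sum.distrib field_simps)
qed

text \<open>The interval between two levels in either order. A difference of half-line indicators
  is, up to sign, the indicator of this set, so increments are again sums of \<open>Y\<close> and
  the variance bounds apply; squaring removes the sign.\<close>

definition V :: "real \<Rightarrow> real \<Rightarrow> real set" where "V s t = {min s t<..max s t}"

lemma V_borel[measurable, simp]: "V s t \<in> sets borel"
  by (simp add: V_def)

lemma \<pi>_V: "\<pi> (V s t) = \<bar>\<pi> {..s} - \<pi> {..t}\<bar>"
proof -
  have *: "\<pi> {t<..s} = \<pi> {..s} - \<pi> {..t}" if "t \<le> s" for s t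
  proof -
    have "\<pi> {t<..s} = prob ({\<omega>\<in>space M. X 1 \<omega> \<in> {..s}} - {\<omega>\<in>space M. X 1 \<omega> \<in> {..t}})"
      unfolding \<pi>_def by (rule arg_cong[of _ _ prob]) auto
    also have "\<dots> = \<pi> {..s} - \<pi> {..t}" unfolding \<pi>_def
      by (rule finite_measure_Diff) (use that in auto)
    finally show ?thesis .
  qed
  have "0 \<le> \<pi> (V s t)" by (rule \<pi>_bounds)
  then show ?thesis using *[of s t] *[of t s] by (cases "s \<le> t") (auto simp: V_def)
qed

lemma Y_diff: "Y {..s} i \<omega> - Y {..t} i \<omega> = (if t \<le> s then 1 else -1) * Y (V s t) i \<omega>"
proof -
  have "\<pi> {..s} - \<pi> {..t} = (if t \<le> s then 1 else -1) * \<pi> (V s t)"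
  proof (cases "t \<le> s")
    case True
    have "\<pi> {..t} \<le> \<pi> {..s}" unfolding \<pi>_def by (rule finite_measure_mono) (use True in auto)
    then show ?thesis using True by (simp add: \<pi>_V)
  next
    case False
    have "\<pi> {..s} \<le> \<pi> {..t}" unfolding \<pi>_def by (rule finite_measure_mono) (use False in auto)
    then show ?thesis using False by (simp add: \<pi>_V)
  qed
  moreover have "indicat_real {..s} x - indicat_real {..t} x = (if t \<le> s then 1 else -1) * indicat_real (V s t) x" for x
    by (auto simp: V_def indicator_def)
  ultimately show ?thesis unfolding Y_def by (auto simp: algebra_simps)
qed

lemma S_diff_sq: "(S {..s} n \<omega> - S {..t} n \<omega>)\<^sup>2 = (S (V s t) n \<omega>)\<^sup>2"
proof -
  have "S {..s} n \<omega> - S {..t} n \<omega> = (if t \<le> s then 1 else -1) * S (V s t) n \<omega>"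
    unfolding S_def sum_subtractf[symmetric] Y_diff sum_distrib_left ..
  then show ?thesis by (simp add: power_mult_distrib)
qed

lemma Zc_diff_sq: "(Zc {..s} n l j \<omega> - Zc {..t} n l j \<omega>)\<^sup>2 = (Zc (V s t) n l j \<omega>)\<^sup>2"
proof -
  have "Zc {..s} n l j \<omega> - Zc {..t} n l j \<omega> = (if t \<le> s then 1 else -1) * Zc (V s t) n l j \<omega>"
    unfolding Zc_def sum_subtractf[symmetric] Y_diff sum_distrib_left ..
  then show ?thesis by (simp add: power_mult_distrib)
qed

end

section \<open>The empirical process near the quantile\<close>

text \<open>\<open>D\<close> is the slope called M in the theorem, here already known to be
  positive. Differentiability is recorded only along the levels \<open>tp + y / sqrt n\<close> that
  the argument visits.\<close>

locale quantile_bootstrap = mixing_process M X for M :: "'a measure" and X +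
  fixes l :: "nat \<Rightarrow> nat" and p tp D \<sigma> :: real
  assumes p: "0 < p" "p < 1" and \<pi>_tp: "\<pi> {..tp} = p" and D: "0 < D" and \<sigma>: "0 < \<sigma>" "\<sigma>2 {..tp} = \<sigma>\<^sup>2"
    and deriv: "\<And>y. (\<lambda>n. sqrt (real n) * (\<pi> {..tp + y / sqrt (real n)} - p)) \<longlonglongrightarrow> D * y"
    and l: "\<And>n. 1 \<le> n \<Longrightarrow> 1 \<le> l n \<and> l n \<le> n"
    and l_inf: "filterlim l at_top sequentially"
    and l_small: "(\<lambda>n. real (l n) / real n) \<longlonglongrightarrow> 0"
begin

abbreviation s :: "real \<Rightarrow> nat \<Rightarrow> real" where "s y n \<equiv> tp + y / sqrt (real n)"

definition W :: "nat \<Rightarrow> 'a \<Rightarrow> real" where "W n \<omega> = S {..tp} n \<omega> / sqrt (real n)"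

text \<open>\<open>G y n\<close> is \<open>sqrt n (F\<^sub>n(s y n) - p)\<close>. The summands \<open>\<xi> y n \<omega> j\<close> are \<open>sqrt l (F\<^sub>n - B\<^sub>j)\<close> at \<open>s y n\<close>,
  where \<open>B\<^sub>j\<close> is the mean over the block starting at \<open>j\<close>; the sign turns \<open>p \<le> F\<^sub>n\<^sup>*\<close> into an upper bound
  on their sum. \<open>\<eta> n \<omega> j\<close> is the analogue at \<open>tp\<close>, centred at \<open>p\<close> instead of \<open>F\<^sub>n(tp)\<close>.\<close>

definition G :: "real \<Rightarrow> nat \<Rightarrow> 'a \<Rightarrow> real" where
  "G y n \<omega> = S {..s y n} n \<omega> / sqrt (real n) + sqrt (real n) * (\<pi> {..s y n} - p)"

definition \<xi> :: "real \<Rightarrow> nat \<Rightarrow> 'a \<Rightarrow> nat \<Rightarrow> real" where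
  "\<xi> y n \<omega> j = sqrt (l n) * S {..s y n} n \<omega> / n - Zc {..s y n} n (l n) j \<omega> / sqrt (l n)"

definition \<eta> :: "nat \<Rightarrow> 'a \<Rightarrow> nat \<Rightarrow> real" where
  "\<eta> n \<omega> j = - (Zc {..tp} n (l n) j \<omega> / sqrt (l n))"

definition trunc_var :: "nat \<Rightarrow> real" where
  "trunc_var m = (LINT x|std_normal_distribution. min (\<sigma>\<^sup>2 * x\<^sup>2) (real m))"

lemma \<pi>_s_tendsto: "(\<lambda>n. \<pi> (V (s y n) tp)) \<longlonglongrightarrow> 0"
proof -
  have "(\<lambda>n. 1 / sqrt (real n)) \<longlonglongrightarrow> 0" 
    by (intro tendsto_divide_0[OF tendsto_const] filterlim_at_top_imp_at_infinity filterlim_compose[OF sqrt_at_top filterlim_real_sequentially])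
  from tendsto_mult[OF this deriv[of y]]
  have "(\<lambda>n. 1 / sqrt (real n) * (sqrt (real n) * (\<pi> {..s y n} - p))) \<longlonglongrightarrow> 0" by simp
  then have "(\<lambda>n. \<pi> {..s y n} - p) \<longlonglongrightarrow> 0"
  proof (rule Lim_transform_eventually)
    show "\<forall>\<^sub>F n in sequentially. 1 / sqrt (real n) * (sqrt (real n) * (\<pi> {..s y n} - p)) = \<pi> {..s y n} - p"
      using eventually_gt_at_top[of 0] by eventually_elim simp
  qed
  then show ?thesis unfolding \<pi>_V \<pi>_tp by (rule tendsto_rabs_zero)
qed

lemma \<kappa>_V_tendsto: "(\<lambda>n. \<kappa> (\<pi> (V (s y n) tp))) \<longlonglongrightarrow> 0"
  by (rule \<kappa>_tendsto[OF \<pi>_s_tendsto \<pi>_bounds(1)])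

text \<open>The fluctuation at \<open>s y n\<close> minus that at \<open>tp\<close> has second
  moment at most \<open>2 * \<kappa> (\<pi> (V (s y n) tp))\<close>, which tends to 0; the drift is
  \<open>deriv\<close>. A statement for each fixed \<open>y\<close> is enough, as it is only used on
  finite grids.\<close>

lemma G_approx:
  assumes "0 < h" "0 < \<delta>"
  shows "whp h (\<lambda>n \<omega>. \<bar>G y n \<omega> - (W n \<omega> + D * y)\<bar> < \<delta>)"
proof -
  let ?Z = "\<lambda>n \<omega>. (S {..s y n} n \<omega> - S {..tp} n \<omega>) / sqrt (real n)"
  have "whp h (\<lambda>n \<omega>. \<bar>?Z n \<omega>\<bar> < \<delta>/2)"
  proof (rule whp_L2)
    have eq: "(?Z n \<omega>)\<^sup>2 = (S (V (s y n) tp) n \<omega>)\<^sup>2 / real n" for n \<omega>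
      by (simp add: power_divide S_diff_sq)
    show "integrable M (\<lambda>\<omega>. (?Z n \<omega>)\<^sup>2)" for n unfolding eq by simp
    have le: "expectation (\<lambda>\<omega>. (?Z n \<omega>)\<^sup>2) \<le> 2 * \<kappa> (\<pi> (V (s y n) tp))" for n
    proof (cases "n = 0")
      case True
      then show ?thesis using \<kappa>_nonneg[OF \<pi>_bounds(1), of "V (s y n) tp"] by simp
    next
      case False
      have "expectation (\<lambda>\<omega>. (?Z n \<omega>)\<^sup>2) = expectation (\<lambda>\<omega>. (S (V (s y n) tp) n \<omega>)\<^sup>2) / real n"
        unfolding eq by simp
      also have "\<dots> \<le> (2 * real n * \<kappa> (\<pi> (V (s y n) tp))) / real n"
        by (intro divide_right_mono second_moment_S_le) auto
      finally show ?thesis using False by simp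
    qed
    have lim: "(\<lambda>n. 2 * \<kappa> (\<pi> (V (s y n) tp))) \<longlonglongrightarrow> 0"
      using tendsto_mult[OF tendsto_const \<kappa>_V_tendsto, of 2 y] by simp
    show "(\<lambda>n. expectation (\<lambda>\<omega>. (?Z n \<omega>)\<^sup>2)) \<longlonglongrightarrow> 0"
    proof (rule tendsto_sandwich[OF _ _ tendsto_const lim])
      show "\<forall>\<^sub>F n in sequentially. 0 \<le> expectation (\<lambda>\<omega>. (?Z n \<omega>)\<^sup>2)"
        by (intro always_eventually allI Bochner_Integration.integral_nonneg) simp
      show "\<forall>\<^sub>F n in sequentially. expectation (\<lambda>\<omega>. (?Z n \<omega>)\<^sup>2) \<le> 2 * \<kappa> (\<pi> (V (s y n) tp))"
        by (intro always_eventually allI le)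
    qed
    show "0 < h" "0 < \<delta>/2" using assms by simp_all
  qed
  then show ?thesis
  proof (rule whp_mono)
    have "\<forall>\<^sub>F n in sequentially. dist (sqrt (real n) * (\<pi> {..s y n} - p)) (D * y) < \<delta>/2"
      by (rule tendstoD[OF deriv]) (use assms in simp)
    then show "\<forall>\<^sub>F n in sequentially. \<forall>\<omega>\<in>space M. \<bar>?Z n \<omega>\<bar> < \<delta>/2 \<longrightarrow> \<bar>G y n \<omega> - (W n \<omega> + D * y)\<bar> < \<delta>"
    proof eventually_elim
      case (elim n)
      show ?case
      proof (intro ballI impI)
        fix \<omega> assume Z: "\<bar>?Z n \<omega>\<bar> < \<delta>/2"
        have "G y n \<omega> - (W n \<omega> + D * y) = ?Z n \<omega> + (sqrt (real n) * (\<pi> {..s y n} - p) - D * y)"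
          by (simp add: G_def W_def diff_divide_distrib)
        moreover have "\<bar>sqrt (real n) * (\<pi> {..s y n} - p) - D * y\<bar> < \<delta>/2" using elim by (simp only: dist_real_def)
        ultimately show "\<bar>G y n \<omega> - (W n \<omega> + D * y)\<bar> < \<delta>"
          using Z abs_triangle_ineq[of "?Z n \<omega>" "sqrt (real n) * (\<pi> {..s y n} - p) - D * y"] by linarith
      qed
    qed
  qed
qed

lemma W_tight:
  assumes "0 < h"
  shows "\<exists>C>0. whp h (\<lambda>n \<omega>. \<bar>W n \<omega>\<bar> < C)"
proof -
  define c where "c = 2 * \<kappa> (\<pi> {..tp})"
  have c0: "0 \<le> c" using \<kappa>_nonneg[OF \<pi>_bounds(1), of "{..tp}"] by (simp add: c_def)
  \<comment> \<open>Solves \<open>c \<le> h * C\<^sup>2\<close> for the Markov bound; the summand 1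
    keeps \<open>C\<close> positive even when \<open>c\<close> is 0.\<close>
  define C where "C = sqrt (c / h) + 1"
  have C: "0 < C" using c0 assms by (simp add: C_def add_nonneg_pos)
  have "c / h \<le> C\<^sup>2"
    using c0 assms by (simp add: C_def power2_sum)
  then have ch: "c \<le> h * C\<^sup>2" using assms by (simp add: divide_le_eq mult.commute)
  have W2: "(W n \<omega>)\<^sup>2 = (S {..tp} n \<omega>)\<^sup>2 / real n" for n \<omega> by (simp add: W_def power_divide)
  have "whp h (\<lambda>n \<omega>. (W n \<omega>)\<^sup>2 < C\<^sup>2)"
  proof (rule whp_markov[where \<tau>=c])
    show "integrable M (\<lambda>\<omega>. (W n \<omega>)\<^sup>2)" for n unfolding W2 by simp
    show "\<forall>\<^sub>F n in sequentially. expectation (\<lambda>\<omega>. (W n \<omega>)\<^sup>2) \<le> c"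
      using eventually_gt_at_top[of 0]
    proof eventually_elim
      case (elim n)
      then show ?case using second_moment_S_le[of "{..tp}" n] unfolding W2 c_def
        by (simp add: divide_le_eq mult.commute mult.left_commute)
    qed
  qed (use ch C in auto)
  then have "whp h (\<lambda>n \<omega>. \<bar>W n \<omega>\<bar> < C)"
  proof (rule whp_mono, intro always_eventually allI ballI impI)
    fix n \<omega> assume "(W n \<omega>)\<^sup>2 < C\<^sup>2"
    then show "\<bar>W n \<omega>\<bar> < C" using C by (intro power2_less_imp_less[of "\<bar>W n \<omega>\<bar>"]) auto
  qed
  with C show ?thesis by blast
qed

text \<open>A bootstrap sample has \<open>n div l n * l n\<close> points instead of
  \<open>n\<close>, which puts the square root of the ratio in front of \<open>G\<close>. The ratio
  tends to 1, and tightness of \<open>W\<close> makes the correction negligible.\<close>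

lemma threshold_approx:
  assumes "0 < h" "0 < \<delta>"
  shows "whp h (\<lambda>n \<omega>. \<bar>sqrt (real (n div l n * l n) / real n) * G y n \<omega> - (W n \<omega> + D * y)\<bar> < \<delta>)"
proof -
  define r where "r n = sqrt (real (n div l n * l n) / real n)" for n
  obtain C where C: "C > 0" "whp (h/2) (\<lambda>n \<omega>. \<bar>W n \<omega>\<bar> < C)" using W_tight[of "h/2"] assms by auto
  have "whp (h/2 + h/2) (\<lambda>n \<omega>. \<bar>W n \<omega>\<bar> < C \<and> \<bar>G y n \<omega> - (W n \<omega> + D * y)\<bar> < \<delta>/2)"
    by (rule whp_conj[OF C(2) G_approx]) (use assms in auto)
  moreover have rlim: "r \<longlonglongrightarrow> 1"
  proof -
    have "(\<lambda>n. real (n div l n * l n) / real n) \<longlonglongrightarrow> 1"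
    proof (rule tendsto_sandwich)
      show "\<forall>\<^sub>F n in sequentially. 1 - real (l n) / real n \<le> real (n div l n * l n) / real n"
        using eventually_ge_at_top[of 1]
      proof eventually_elim
        case (elim n)
        have "n \<le> n div l n * l n + l n" using l[OF elim] by (metis add_left_mono div_mult_mod_eq le_less less_le_trans mod_less_divisor not_less zero_less_one)
        then have "real n \<le> real (n div l n * l n) + real (l n)" by linarith
        then have "(real n - real (l n)) / real n \<le> real (n div l n * l n) / real n" by (intro divide_right_mono) auto
        then show ?case using elim by (simp add: diff_divide_distrib)
      qed
      show "\<forall>\<^sub>F n in sequentially. real (n div l n * l n) / real n \<le> 1"
      proof (rule always_eventually, rule allI)
        fix n
        have "n div l n * l n \<le> n" by simp
        then have "real (n div l n * l n) \<le> real n" by linarith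
        then show "real (n div l n * l n) / real n \<le> 1" by (cases "n = 0") (simp_all add: divide_le_eq_1_pos)
      qed
      show "(\<lambda>n. 1 - real (l n) / real n) \<longlonglongrightarrow> 1" using tendsto_diff[OF tendsto_const l_small, of 1] by simp
    qed simp
    from tendsto_real_sqrt[OF this] show ?thesis by (simp add: r_def[abs_def])
  qed
  have r01: "0 \<le> r n" "r n \<le> 1" for n
  proof -
    have "n div l n * l n \<le> n" by simp
    then have "real (n div l n * l n) \<le> real n" by linarith
    then have "real (n div l n * l n) / real n \<le> 1" by (cases "n = 0") (simp_all add: divide_le_eq_1_pos)
    then show "0 \<le> r n" "r n \<le> 1" by (auto simp: r_def)
  qed
  have "(\<lambda>n. \<bar>r n - 1\<bar> * (C + D * \<bar>y\<bar>)) \<longlonglongrightarrow> \<bar>1 - 1\<bar> * (C + D * \<bar>y\<bar>)"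
    by (intro tendsto_intros rlim)
  then have "\<forall>\<^sub>F n in sequentially. \<bar>r n - 1\<bar> * (C + D * \<bar>y\<bar>) < \<delta>/2"
    using assms by (intro order_tendstoD) auto
  then have "\<forall>\<^sub>F n in sequentially. \<forall>\<omega>\<in>space M. \<bar>W n \<omega>\<bar> < C \<and> \<bar>G y n \<omega> - (W n \<omega> + D * y)\<bar> < \<delta>/2
      \<longrightarrow> \<bar>r n * G y n \<omega> - (W n \<omega> + D * y)\<bar> < \<delta>"
  proof eventually_elim
    case (elim n)
    show ?case
    proof (intro ballI impI)
      fix \<omega> assume *: "\<bar>W n \<omega>\<bar> < C \<and> \<bar>G y n \<omega> - (W n \<omega> + D * y)\<bar> < \<delta>/2"
      have "r n * G y n \<omega> - (W n \<omega> + D * y) = r n * (G y n \<omega> - (W n \<omega> + D * y)) + (r n - 1) * (W n \<omega> + D * y)"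
        by (simp add: algebra_simps)
      also have "\<bar>\<dots>\<bar> \<le> r n * \<bar>G y n \<omega> - (W n \<omega> + D * y)\<bar> + \<bar>r n - 1\<bar> * \<bar>W n \<omega> + D * y\<bar>"
        using r01[of n] by (intro order_trans[OF abs_triangle_ineq]) (simp add: abs_mult)
      also have "r n * \<bar>G y n \<omega> - (W n \<omega> + D * y)\<bar> \<le> 1 * \<bar>G y n \<omega> - (W n \<omega> + D * y)\<bar>"
        using r01 by (intro mult_right_mono) auto
      also have "\<bar>r n - 1\<bar> * \<bar>W n \<omega> + D * y\<bar> \<le> \<bar>r n - 1\<bar> * (C + D * \<bar>y\<bar>)"
        using * D by (intro mult_left_mono order_trans[OF abs_triangle_ineq]) (auto simp: abs_mult)
      finally show "\<bar>r n * G y n \<omega> - (W n \<omega> + D * y)\<bar> < \<delta>" using elim * by simp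
    qed
  qed
  ultimately show ?thesis unfolding r_def using whp_mono by fastforce
qed

section \<open>Conditional second moments of the blocks\<close>

lemma perturbation_integrable: "integrable M (\<lambda>\<omega>. avg n (\<lambda>j. (\<xi> y n \<omega> j - \<eta> n \<omega> j)\<^sup>2))"
proof -
  have "integrable M (\<lambda>\<omega>. (\<xi> y n \<omega> j - \<eta> n \<omega> j)\<^sup>2)" for j
  proof (rule integrable_bounded[of _ "(sqrt (l n) + 2 * real (l n))\<^sup>2"])
    show "(\<lambda>\<omega>. (\<xi> y n \<omega> j - \<eta> n \<omega> j)\<^sup>2) \<in> borel_measurable M"
      unfolding \<xi>_def \<eta>_def using S_measurable[of "{..s y n}"] Zc_measurable[of "{..s y n}"] Zc_measurable[of "{..tp}"] by measurable
    fix \<omega>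
    have 1: "\<bar>sqrt (l n) * S {..s y n} n \<omega> / n\<bar> \<le> sqrt (l n)"
    proof -
      have "\<bar>S {..s y n} n \<omega>\<bar> \<le> real n" using S_diff_bound[of 0 n "{..s y n}" \<omega>] by (simp add: S_def)
      then have "\<bar>S {..s y n} n \<omega> / n\<bar> \<le> 1" by (cases "n = 0") (simp_all add: abs_divide)
      from mult_left_mono[OF this, of "sqrt (l n)"] show ?thesis by (simp add: abs_mult)
    qed
    have 2: "\<bar>Zc B n (l n) j \<omega> / sqrt (l n)\<bar> \<le> real (l n)" for B
    proof (cases "l n = 0")
      case True then show ?thesis by simp
    next
      case False
      then have "1 \<le> sqrt (real (l n))" by simp
      then have "\<bar>Zc B n (l n) j \<omega> / sqrt (l n)\<bar> \<le> \<bar>Zc B n (l n) j \<omega>\<bar> / 1" unfolding abs_divide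
        by (intro divide_left_mono) (auto intro: mult_pos_pos)
      then show ?thesis using Zc_bound[of B n "l n" j \<omega>] by simp
    qed
    have "\<bar>\<xi> y n \<omega> j - \<eta> n \<omega> j\<bar> \<le> sqrt (l n) + 2 * real (l n)"
      unfolding \<xi>_def \<eta>_def using 1 2[of "{..s y n}"] 2[of "{..tp}"] by argo
    from power_mono[OF this, of 2] show "norm ((\<xi> y n \<omega> j - \<eta> n \<omega> j)\<^sup>2) \<le> (sqrt (l n) + 2 * real (l n))\<^sup>2" by simp
  qed
  then show ?thesis unfolding avg_def by simp
qed

text \<open>Two changes lead from \<eta> to \<xi>. Recentring at the empirical value costs order
  \<open>l n / n\<close>; moving the level from \<open>tp\<close> to \<open>s y n\<close> costs a
  multiple of \<open>\<kappa> (\<pi> (V (s y n) tp))\<close>. Afterwards one \<open>y\<close>-free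
  array carries the whole moment analysis.\<close>

lemma perturbation_tendsto: "(\<lambda>n. expectation (\<lambda>\<omega>. avg n (\<lambda>j. (\<xi> y n \<omega> j - \<eta> n \<omega> j)\<^sup>2))) \<longlonglongrightarrow> 0"
proof (rule Lim_null_comparison)
  let ?b = "\<lambda>n. 4 * (real (l n) / real n) * \<kappa> 1 + 8 * \<kappa> (\<pi> (V (s y n) tp))"
  have "?b \<longlonglongrightarrow> 4 * 0 * \<kappa> 1 + 8 * 0" by (intro tendsto_intros l_small \<kappa>_V_tendsto)
  then show "?b \<longlonglongrightarrow> 0" by simp
  show "\<forall>\<^sub>F n in sequentially. norm (expectation (\<lambda>\<omega>. avg n (\<lambda>j. (\<xi> y n \<omega> j - \<eta> n \<omega> j)\<^sup>2))) \<le> ?b n"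
    using eventually_ge_at_top[of 1]
  proof eventually_elim
    case (elim n)
    let ?B = "{..s y n}" and ?V = "V (s y n) tp"
    have L: "1 \<le> l n" "l n \<le> n" using l[OF elim] by auto
    let ?R = "\<lambda>j \<omega>. 2 * (real (l n) / (real n)\<^sup>2) * (S ?B n \<omega>)\<^sup>2 + 2 / real (l n) * (Zc ?V n (l n) j \<omega>)\<^sup>2"
    have pt: "(\<xi> y n \<omega> j - \<eta> n \<omega> j)\<^sup>2 \<le> ?R j \<omega>" for j \<omega>
    proof -
      let ?u = "sqrt (l n) * S ?B n \<omega> / n" and ?v = "(Zc ?B n (l n) j \<omega> - Zc {..tp} n (l n) j \<omega>) / sqrt (l n)"
      have "\<xi> y n \<omega> j - \<eta> n \<omega> j = ?u - ?v" by (simp add: \<xi>_def \<eta>_def diff_divide_distrib)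
      moreover have "(?u - ?v)\<^sup>2 \<le> 2 * ?u\<^sup>2 + 2 * ?v\<^sup>2"
        by (rule power2_diff_le)
      moreover have "?u\<^sup>2 = real (l n) / (real n)\<^sup>2 * (S ?B n \<omega>)\<^sup>2" by (simp add: power_divide power_mult_distrib)
      moreover have "?v\<^sup>2 = 1 / real (l n) * (Zc ?V n (l n) j \<omega>)\<^sup>2" by (simp add: power_divide Zc_diff_sq)
      ultimately show ?thesis by simp
    qed
    have int: "integrable M (?R j)" for j by simp
    have ER: "expectation (?R j) \<le> ?b n" if j: "j \<in> {1..n}" for j
    proof -
      have "expectation (?R j) = 2 * (real (l n) / (real n)\<^sup>2) * expectation (\<lambda>\<omega>. (S ?B n \<omega>)\<^sup>2) + 2 / real (l n) * expectation (\<lambda>\<omega>. (Zc ?V n (l n) j \<omega>)\<^sup>2)"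
        by simp
      also have "\<dots> \<le> 2 * (real (l n) / (real n)\<^sup>2) * (2 * real n * \<kappa> 1) + 2 / real (l n) * (4 * real (l n) * \<kappa> (\<pi> ?V))"
      proof (intro add_mono mult_left_mono)
        show "expectation (\<lambda>\<omega>. (S ?B n \<omega>)\<^sup>2) \<le> 2 * real n * \<kappa> 1"
          by (rule order_trans[OF second_moment_S_le]) (auto intro!: mult_left_mono \<kappa>_mono \<pi>_bounds)
        show "expectation (\<lambda>\<omega>. (Zc ?V n (l n) j \<omega>)\<^sup>2) \<le> 4 * real (l n) * \<kappa> (\<pi> ?V)"
          by (rule second_moment_Zc_le) (use j L in auto)
      qed auto
      also have "2 * (real (l n) / (real n)\<^sup>2) * (2 * real n * \<kappa> 1) = 4 * (real (l n) / real n) * \<kappa> 1"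
        using elim by (simp add: power2_eq_square)
      also have "2 / real (l n) * (4 * real (l n) * \<kappa> (\<pi> ?V)) = 8 * \<kappa> (\<pi> ?V)" using L by simp
      finally show ?thesis .
    qed
    have b0: "0 \<le> ?b n" using \<kappa>_nonneg[OF \<pi>_bounds(1), of ?V] \<kappa>_nonneg[of 1] by (intro add_nonneg_nonneg mult_nonneg_nonneg) auto
    have "expectation (\<lambda>\<omega>. avg n (\<lambda>j. (\<xi> y n \<omega> j - \<eta> n \<omega> j)\<^sup>2)) \<le> expectation (\<lambda>\<omega>. avg n (\<lambda>j. ?R j \<omega>))"
    proof (rule integral_mono[OF perturbation_integrable])
      show "integrable M (\<lambda>\<omega>. avg n (\<lambda>j. ?R j \<omega>))"
        unfolding avg_def by (intro integrable_divide_zero Bochner_Integration.integrable_sum int)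
      show "avg n (\<lambda>j. (\<xi> y n \<omega> j - \<eta> n \<omega> j)\<^sup>2) \<le> avg n (\<lambda>j. ?R j \<omega>)" for \<omega>
        by (rule avg_mono) (rule pt)
    qed
    also have "\<dots> = avg n (\<lambda>j. expectation (?R j))"
      unfolding avg_def using int by (simp only: integral_divide_zero Bochner_Integration.integral_sum)
    also have "\<dots> \<le> ?b n" by (rule avg_le_const[OF b0 ER])
    finally have "expectation (\<lambda>\<omega>. avg n (\<lambda>j. (\<xi> y n \<omega> j - \<eta> n \<omega> j)\<^sup>2)) \<le> ?b n" .
    moreover have "0 \<le> expectation (\<lambda>\<omega>. avg n (\<lambda>j. (\<xi> y n \<omega> j - \<eta> n \<omega> j)\<^sup>2))"
      by (intro Bochner_Integration.integral_nonneg avg_nonneg) auto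
    ultimately show ?case by simp
  qed
qed

lemma trunc_var_tendsto: "trunc_var \<longlonglongrightarrow> \<sigma>\<^sup>2"
proof -
  have i: "integrable std_normal_distribution (\<lambda>x. \<sigma>\<^sup>2 * x\<^sup>2)" using integrable_std_normal_distribution_moment[of 2] by simp
  have e: "(LINT x|std_normal_distribution. \<sigma>\<^sup>2 * x\<^sup>2) = \<sigma>\<^sup>2"
    using std_normal_distribution_even_moments[of 1] by (simp add: has_bochner_integral_iff)
  have "(\<lambda>m. LINT x|std_normal_distribution. min (\<sigma>\<^sup>2 * x\<^sup>2) (real m)) \<longlonglongrightarrow> (LINT x|std_normal_distribution. \<sigma>\<^sup>2 * x\<^sup>2)"
  proof (rule integral_dominated_convergence[OF _ _ i])
    show "AE x in std_normal_distribution. (\<lambda>m. min (\<sigma>\<^sup>2 * x\<^sup>2) (real m)) \<longlonglongrightarrow> \<sigma>\<^sup>2 * x\<^sup>2"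
    proof (rule AE_I2, rule tendsto_eventually)
      fix x :: real
      show "\<forall>\<^sub>F m in sequentially. min (\<sigma>\<^sup>2 * x\<^sup>2) (real m) = \<sigma>\<^sup>2 * x\<^sup>2"
        using eventually_ge_at_top[of "nat \<lceil>\<sigma>\<^sup>2 * x\<^sup>2\<rceil>"]
      proof eventually_elim
        case (elim m)
        then have "\<sigma>\<^sup>2 * x\<^sup>2 \<le> real m" by linarith
        then show ?case by (rule min_absorb1)
      qed
    qed
  qed auto
  then show ?thesis unfolding trunc_var_def[abs_def] e .
qed

text \<open>After truncation the square is a bounded continuous function, so the weak convergence of
  \<open>mixing_clt\<close>, taken along the block lengths, identifies the limit.\<close>

lemma truncated_block_tendsto:
  "(\<lambda>n. expectation (\<lambda>\<omega>. min ((S {..tp} (l n) \<omega>)\<^sup>2 / l n) (real m))) \<longlonglongrightarrow> trunc_var m"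
proof -
  let ?\<mu> = "\<lambda>n. distr M borel (\<lambda>\<omega>. S {..tp} n \<omega> / sqrt n / \<sigma>)"
  have Sm[measurable]: "S {..tp} n \<in> borel_measurable M" for n by (rule S_measurable) simp
  have "(\<lambda>n. integral\<^sup>L (?\<mu> n) (\<lambda>x. min (\<sigma>\<^sup>2 * x\<^sup>2) (real m))) \<longlonglongrightarrow> trunc_var m"
    unfolding trunc_var_def
  proof (rule weak_conv_imp_integral_bdd_continuous_conv[where B="real m"])
    show "weak_conv_m ?\<mu> std_normal_distribution" by (rule mixing_clt) (use \<sigma> in auto)
    show "isCont (\<lambda>x. min (\<sigma>\<^sup>2 * x\<^sup>2) (real m)) x" for x by (intro continuous_intros)
  qed (auto intro!: real_dist_normal_dist)
  moreover have "integral\<^sup>L (?\<mu> n) (\<lambda>x. min (\<sigma>\<^sup>2 * x\<^sup>2) (real m)) = expectation (\<lambda>\<omega>. min ((S {..tp} n \<omega>)\<^sup>2 / n) (real m))" for n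
    using \<sigma>(1) by (subst integral_distr) (auto simp: power_divide power_mult_distrib)
  ultimately have "(\<lambda>n. expectation (\<lambda>\<omega>. min ((S {..tp} n \<omega>)\<^sup>2 / n) (real m))) \<longlonglongrightarrow> trunc_var m" by simp
  from filterlim_compose[OF this l_inf] show ?thesis .
qed

lemma \<eta>_sq: "(\<eta> n \<omega> j)\<^sup>2 = (Zc {..tp} n (l n) j \<omega>)\<^sup>2 / l n"
  by (simp add: \<eta>_def power_divide)

text \<open>\<open>block_weak_law\<close> with bound \<open>m\<close> controls the deviation from
  the block expectation; \<open>truncated_block_tendsto\<close> controls the bias of that
  expectation.\<close>

lemma truncated_avg_tendsto:
  "(\<lambda>n. expectation (\<lambda>\<omega>. (avg n (\<lambda>j. min ((\<eta> n \<omega> j)\<^sup>2) (real m)) - trunc_var m)\<^sup>2)) \<longlonglongrightarrow> 0"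
  and truncated_avg_integrable: "integrable M (\<lambda>\<omega>. (avg n (\<lambda>j. min ((\<eta> n \<omega> j)\<^sup>2) (real m)) - trunc_var m)\<^sup>2)"
  and truncated_avg_measurable: "(\<lambda>\<omega>. avg n (\<lambda>j. min ((\<eta> n \<omega> j)\<^sup>2) (real m))) \<in> borel_measurable M"
proof -
  define \<mu> where "\<mu> n = expectation (\<lambda>\<omega>. min ((S {..tp} (l n) \<omega>)\<^sup>2 / l n) (real m))" for n
  let ?a = "\<lambda>n \<omega>. avg n (\<lambda>j. min ((\<eta> n \<omega> j)\<^sup>2) (real m))"
  have am[measurable]: "?a n \<in> borel_measurable M" for n
    unfolding \<eta>_sq avg_def using Zc_measurable[of "{..tp}"] by measurable
  then show "?a n \<in> borel_measurable M" .
  have a0: "0 \<le> ?a n \<omega>" and a1: "?a n \<omega> \<le> real m" for n \<omega> by (auto intro!: avg_nonneg avg_le_const)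
  have int: "integrable M (\<lambda>\<omega>. (?a n \<omega> - c)\<^sup>2)" for n c
  proof (rule integrable_bounded[of _ "(real m + \<bar>c\<bar>)\<^sup>2"])
    fix \<omega>
    have "\<bar>?a n \<omega> - c\<bar> \<le> real m + \<bar>c\<bar>" using a0[of n \<omega>] a1[of n \<omega>] by linarith
    from power_mono[OF this, of 2] show "norm ((?a n \<omega> - c)\<^sup>2) \<le> (real m + \<bar>c\<bar>)\<^sup>2" by simp
  qed measurable
  show "integrable M (\<lambda>\<omega>. (?a n \<omega> - trunc_var m)\<^sup>2)" by (rule int)
  let ?b = "\<lambda>n. 4 * (real m)\<^sup>2 * (real (l n) / real n) + 16 * (real m)\<^sup>2 * (\<Sum>k. \<alpha> k) / real n + 2 * (real m)\<^sup>2 * (real (l n) / real n)\<^sup>2"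
  have \<mu>lim: "\<mu> \<longlonglongrightarrow> trunc_var m" unfolding \<mu>_def[abs_def] by (rule truncated_block_tendsto)
  have "(\<lambda>n. 2 * ?b n + 2 * (\<mu> n - trunc_var m)\<^sup>2) \<longlonglongrightarrow> 2 * (4 * (real m)\<^sup>2 * 0 + 0 + 2 * (real m)\<^sup>2 * 0\<^sup>2) + 2 * (trunc_var m - trunc_var m)\<^sup>2"
    by (intro tendsto_intros l_small \<mu>lim tendsto_divide_0[OF tendsto_const] filterlim_at_top_imp_at_infinity filterlim_real_sequentially)
  then have lim: "(\<lambda>n. 2 * ?b n + 2 * (\<mu> n - trunc_var m)\<^sup>2) \<longlonglongrightarrow> 0" by simp
  show "(\<lambda>n. expectation (\<lambda>\<omega>. (?a n \<omega> - trunc_var m)\<^sup>2)) \<longlonglongrightarrow> 0"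
  proof (rule Lim_null_comparison[OF _ lim])
    show "\<forall>\<^sub>F n in sequentially. norm (expectation (\<lambda>\<omega>. (?a n \<omega> - trunc_var m)\<^sup>2)) \<le> 2 * ?b n + 2 * (\<mu> n - trunc_var m)\<^sup>2"
      using eventually_ge_at_top[of 1]
    proof eventually_elim
      case (elim n)
      have L: "1 \<le> l n" "l n \<le> n" using l[OF elim] by auto
      have w: "expectation (\<lambda>\<omega>. (?a n \<omega> - \<mu> n)\<^sup>2) \<le> ?b n"
        unfolding \<eta>_sq \<mu>_def
        by (rule block_weak_law[of "{..tp}" "\<lambda>x. min (x\<^sup>2 / l n) (real m)", OF _ _ _ L]) auto
      have "expectation (\<lambda>\<omega>. (?a n \<omega> - trunc_var m)\<^sup>2) \<le> expectation (\<lambda>\<omega>. 2 * (?a n \<omega> - \<mu> n)\<^sup>2 + 2 * (\<mu> n - trunc_var m)\<^sup>2)"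
      proof (rule integral_mono)
        fix \<omega>
        show "(?a n \<omega> - trunc_var m)\<^sup>2 \<le> 2 * (?a n \<omega> - \<mu> n)\<^sup>2 + 2 * (\<mu> n - trunc_var m)\<^sup>2"
          using power2_sum_le[of "?a n \<omega> - \<mu> n" "\<mu> n - trunc_var m"] by simp
      qed (use int in auto)
      also have "\<dots> = 2 * expectation (\<lambda>\<omega>. (?a n \<omega> - \<mu> n)\<^sup>2) + 2 * (\<mu> n - trunc_var m)\<^sup>2"
        using int by (simp add: prob_space)
      finally have "expectation (\<lambda>\<omega>. (?a n \<omega> - trunc_var m)\<^sup>2) \<le> 2 * ?b n + 2 * (\<mu> n - trunc_var m)\<^sup>2" using w by simp
      moreover have "0 \<le> expectation (\<lambda>\<omega>. (?a n \<omega> - trunc_var m)\<^sup>2)" by (rule Bochner_Integration.integral_nonneg) simp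
      ultimately show ?case by simp
    qed
  qed
qed

lemma second_moment_avg_integrable: "integrable M (\<lambda>\<omega>. avg n (\<lambda>j. (\<eta> n \<omega> j)\<^sup>2))"
  unfolding \<eta>_sq avg_def by simp

text \<open>By stationarity every block that does not wrap contributes the same value
  \<open>t n\<close>; fewer than \<open>l n\<close> blocks wrap, and their share is of order
  \<open>l n / n\<close>.\<close>

lemma second_moment_avg_tendsto: "(\<lambda>n. expectation (\<lambda>\<omega>. avg n (\<lambda>j. (\<eta> n \<omega> j)\<^sup>2))) \<longlonglongrightarrow> \<sigma>\<^sup>2"
proof -
  define t where "t n = expectation (\<lambda>\<omega>. (S {..tp} (l n) \<omega>)\<^sup>2) / l n" for n
  have tlim: "t \<longlonglongrightarrow> \<sigma>\<^sup>2"
    using filterlim_compose[OF second_moment_S_tendsto[of "{..tp}"] l_inf] \<sigma> by (simp add: t_def[abs_def])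
  \<comment> \<open>6 is 4 from \<open>second_moment_Zc_le\<close> plus 2 from
    \<open>second_moment_S_le\<close>.\<close>
  define c where "c = 6 * \<kappa> (\<pi> {..tp})"
  have \<kappa>0: "0 \<le> \<kappa> (\<pi> {..tp})" by (rule \<kappa>_nonneg[OF \<pi>_bounds(1)])
  have "(\<lambda>n. expectation (\<lambda>\<omega>. avg n (\<lambda>j. (\<eta> n \<omega> j)\<^sup>2)) - t n) \<longlonglongrightarrow> 0"
  proof (rule Lim_null_comparison)
    show "(\<lambda>n. c * (real (l n) / real n)) \<longlonglongrightarrow> 0" using tendsto_mult[OF tendsto_const l_small, of c] by simp
    show "\<forall>\<^sub>F n in sequentially. norm (expectation (\<lambda>\<omega>. avg n (\<lambda>j. (\<eta> n \<omega> j)\<^sup>2)) - t n) \<le> c * (real (l n) / real n)"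
      using eventually_ge_at_top[of 1]
    proof eventually_elim
      case (elim n)
      have L: "1 \<le> l n" "l n \<le> n" using l[OF elim] by auto
      define E where "E j = expectation (\<lambda>\<omega>. (Zc {..tp} n (l n) j \<omega>)\<^sup>2) / l n" for j
      have E: "expectation (\<lambda>\<omega>. avg n (\<lambda>j. (\<eta> n \<omega> j)\<^sup>2)) = avg n E"
        unfolding \<eta>_sq avg_def E_def by simp
      have t2: "0 \<le> t n" "t n \<le> 2 * \<kappa> (\<pi> {..tp})"
        unfolding t_def using second_moment_S_le[of "{..tp}" "l n"] L
        by (auto simp: divide_le_eq mult.commute mult.left_commute intro!: divide_nonneg_nonneg Bochner_Integration.integral_nonneg)
      have Ej: "\<bar>E j - t n\<bar> \<le> (if n - l n + 1 < j then c else 0)" if j: "j \<in> {1..n}" for j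
      proof (cases "n - l n + 1 < j")
        case True
        have "0 \<le> E j" unfolding E_def by (auto intro!: divide_nonneg_nonneg Bochner_Integration.integral_nonneg)
        moreover have "E j \<le> 4 * \<kappa> (\<pi> {..tp})"
          unfolding E_def using second_moment_Zc_le[of "{..tp}" j n "l n"] j L by (simp add: divide_le_eq mult.commute mult.left_commute)
        ultimately show ?thesis using True t2 unfolding c_def by auto
      next
        case False
        have "(Zc {..tp} n (l n) j \<omega>)\<^sup>2 = (\<Sum>i\<in>{j..<j + l n}. Y {..tp} i \<omega>)\<^sup>2" for \<omega>
          by (subst Zc_regular) (use False j L in auto)
        then have "E j = t n"
          unfolding E_def t_def using expectation_block[of "{..tp}" "\<lambda>x. x\<^sup>2" j "l n"] j by simp
        then show ?thesis using False by simp
      qed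
      have "avg n E - t n = avg n (\<lambda>j. E j - t n)" unfolding avg_diff using elim by (simp add: avg_def)
      also have "\<bar>\<dots>\<bar> \<le> avg n (\<lambda>j. \<bar>E j - t n\<bar>)" unfolding avg_def by (simp add: divide_right_mono)
      also have "\<dots> \<le> avg n (\<lambda>j. if n - l n + 1 < j then c else 0)" by (rule avg_mono[OF Ej])
      also have "\<dots> = real (card ({1..n} \<inter> {n - l n + 1<..})) * c / real n"
        unfolding avg_def by (subst sum.If_cases) (auto simp: greaterThan_def)
      also have "\<dots> \<le> real (l n) * c / real n"
      proof (intro divide_right_mono mult_right_mono)
        have "{1..n} \<inter> {n - l n + 1<..} \<subseteq> {n - l n + 1..<n - l n + 1 + l n}" using L by auto
        from card_mono[OF _ this] show "real (card ({1..n} \<inter> {n - l n + 1<..})) \<le> real (l n)" by simp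
      qed (use \<kappa>0 in \<open>auto simp: c_def\<close>)
      finally show ?case unfolding E by (simp add: mult.commute)
    qed
  qed
  from tendsto_add[OF this tlim] show ?thesis by simp
qed

text \<open>The truncation error is nonnegative, so its mean controls it in probability, and the
  mean is a difference of two known limits. Choosing \<open>m\<close> large makes the limit
  small.\<close>

lemma truncation_error_tendsto:
  "(\<lambda>n. expectation (\<lambda>\<omega>. avg n (\<lambda>j. (\<eta> n \<omega> j)\<^sup>2 - min ((\<eta> n \<omega> j)\<^sup>2) (real m)))) \<longlonglongrightarrow> \<sigma>\<^sup>2 - trunc_var m"
  and truncation_error_integrable:
  "integrable M (\<lambda>\<omega>. avg n (\<lambda>j. (\<eta> n \<omega> j)\<^sup>2 - min ((\<eta> n \<omega> j)\<^sup>2) (real m)))"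
proof -
  let ?a = "\<lambda>n \<omega>. avg n (\<lambda>j. min ((\<eta> n \<omega> j)\<^sup>2) (real m))"
  have ai: "integrable M (?a n)" for n
  proof (rule integrable_bounded[OF truncated_avg_measurable])
    fix \<omega>
    have "0 \<le> ?a n \<omega>" "?a n \<omega> \<le> real m" by (auto intro!: avg_nonneg avg_le_const)
    then show "norm (?a n \<omega>) \<le> real m" by simp
  qed
  show "integrable M (\<lambda>\<omega>. avg n (\<lambda>j. (\<eta> n \<omega> j)\<^sup>2 - min ((\<eta> n \<omega> j)\<^sup>2) (real m)))"
    unfolding avg_diff using second_moment_avg_integrable ai by simp
  have "(\<lambda>n. expectation (?a n) - trunc_var m) \<longlonglongrightarrow> 0"
  proof -
    \<comment> \<open>Jensen's inequality, read off from nonnegativity of a variance: mean-square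
      convergence implies convergence of the means.\<close>
    have "(expectation (?a n) - trunc_var m)\<^sup>2 \<le> expectation (\<lambda>\<omega>. (?a n \<omega> - trunc_var m)\<^sup>2)" for n
    proof -
      have "0 \<le> variance (\<lambda>\<omega>. ?a n \<omega> - trunc_var m)" by (rule variance_positive)
      also have "\<dots> = expectation (\<lambda>\<omega>. (?a n \<omega> - trunc_var m)\<^sup>2) - (expectation (\<lambda>\<omega>. ?a n \<omega> - trunc_var m))\<^sup>2"
        by (rule variance_eq) (use ai truncated_avg_integrable in auto)
      finally show ?thesis using ai by (simp add: prob_space)
    qed
    then have "(\<lambda>n. (expectation (?a n) - trunc_var m)\<^sup>2) \<longlonglongrightarrow> 0"
      by (intro Lim_null_comparison[OF always_eventually truncated_avg_tendsto]) auto
    from tendsto_real_sqrt[OF this] show ?thesis by (simp add: tendsto_rabs_zero_iff)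
  qed
  from tendsto_diff[OF second_moment_avg_tendsto LIM_zero_cancel[OF this]]
  show "(\<lambda>n. expectation (\<lambda>\<omega>. avg n (\<lambda>j. (\<eta> n \<omega> j)\<^sup>2 - min ((\<eta> n \<omega> j)\<^sup>2) (real m)))) \<longlonglongrightarrow> \<sigma>\<^sup>2 - trunc_var m"
    unfolding avg_diff using second_moment_avg_integrable ai by simp
qed

lemma \<xi>_mean: "1 \<le> n \<Longrightarrow> avg n (\<xi> y n \<omega>) = 0"
proof -
  assume n: "1 \<le> n"
  have "(\<Sum>j=1..n. \<xi> y n \<omega> j) = real n * (sqrt (l n) * S {..s y n} n \<omega> / n) - (\<Sum>j=1..n. Zc {..s y n} n (l n) j \<omega>) / sqrt (l n)"
    unfolding \<xi>_def by (simp add: sum_subtractf sum_divide_distrib)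
  also have "\<dots> = 0" unfolding sum_Zc[OF n] using l[OF n] n by (simp add: field_simps)
  finally show ?thesis by (simp add: avg_def)
qed

section \<open>The conditional law of the bootstrap distribution function\<close>

text \<open>The event is multiplied by \<open>r\<close>, the square root of the bootstrap sample
  size, and \<open>r * S {..s y n} n \<omega> / n\<close> is added to both sides: on the left it
  centres the block sums, on the right it completes \<open>G\<close>.\<close>

lemma bootstrap_event_iff:
  assumes n: "1 \<le> n"
  shows "p \<le> ecdf (n div l n * l n) (cbb_sample n (l n) (\<lambda>i. X (int i) \<omega>) J) (s y n) \<longleftrightarrow>
    (\<Sum>k<n div l n. \<xi> y n \<omega> (J k)) / sqrt (real (n div l n)) \<le> sqrt (real (n div l n * l n) / real n) * G y n \<omega>"
proof -
  define b where "b = n div l n"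
  have L: "1 \<le> l n" "l n \<le> n" using l[OF n] by auto
  then have b: "1 \<le> b" by (simp add: b_def Suc_le_eq div_greater_zero_iff)
  define T where "T = (\<Sum>k<b. Zc {..s y n} n (l n) (J k) \<omega>)"
  define q where "q = \<pi> {..s y n}"
  define r where "r = sqrt (real b * real (l n))"
  have r: "0 < r" using b L by (simp add: r_def)
  have r2: "r * r = real b * real (l n)" by (simp add: r_def)
  have rb: "r = sqrt (real b) * sqrt (real (l n))" by (simp add: r_def real_sqrt_mult)
  have b0: "sqrt (real b) > 0" "sqrt (real b) * sqrt (real b) = real b" using b by auto
  have "(\<Sum>k<b. \<xi> y n \<omega> (J k)) = real b * (sqrt (l n) * S {..s y n} n \<omega> / n) - T / sqrt (l n)"
    unfolding \<xi>_def T_def by (simp add: sum_subtractf sum_divide_distrib)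
  then have "(\<Sum>k<b. \<xi> y n \<omega> (J k)) / sqrt (real b) = (real b / sqrt (real b)) * (sqrt (l n) * S {..s y n} n \<omega> / n) - T / r"
    by (simp add: rb diff_divide_distrib mult.commute)
  also have "real b / sqrt (real b) = sqrt (real b)" using b by (simp add: real_div_sqrt)
  finally have lhs: "(\<Sum>k<b. \<xi> y n \<omega> (J k)) / sqrt (real b) = r * S {..s y n} n \<omega> / n - T / r"
    by (simp add: rb)
  have "sqrt (real (b * l n) / real n) * G y n \<omega> = r / sqrt n * (S {..s y n} n \<omega> / sqrt n + sqrt n * (q - p))"
    by (simp add: G_def q_def r_def real_sqrt_divide)
  also have "\<dots> = r * S {..s y n} n \<omega> / (sqrt n * sqrt n) + r * (q - p)"
    using n by (simp add: distrib_left)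
  finally have rhs: "sqrt (real (b * l n) / real n) * G y n \<omega> = r * S {..s y n} n \<omega> / n + r * (q - p)" by simp
  have "p \<le> ecdf (b * l n) (cbb_sample n (l n) (\<lambda>i. X (int i) \<omega>) J) (s y n) \<longleftrightarrow> p - q \<le> T / (r * r)"
    unfolding ecdf_cbb_sample[OF b L(1)] T_def[symmetric] q_def[symmetric] r2 by (simp add: algebra_simps)
  also have "\<dots> \<longleftrightarrow> r * (p - q) \<le> T / r"
    using r by (simp add: pos_le_divide_eq mult.commute mult.left_commute)
  also have "\<dots> \<longleftrightarrow> (\<Sum>k<b. \<xi> y n \<omega> (J k)) / sqrt (real b) \<le> sqrt (real (b * l n) / real n) * G y n \<omega>"
    unfolding lhs rhs by (simp add: algebra_simps)
  finally show ?thesis unfolding b_def .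
qed

lemma filterlim_block_count: "filterlim (\<lambda>n. n div l n) at_top sequentially"
  unfolding filterlim_at_top
proof
  fix N :: nat
  have "\<forall>\<^sub>F n in sequentially. real (l n) / real n < 1 / real (N + 1)"
    by (rule order_tendstoD(2)[OF l_small]) simp
  then show "\<forall>\<^sub>F n in sequentially. N \<le> n div l n"
    using eventually_ge_at_top[of 1]
  proof eventually_elim
    case (elim n)
    then have "real (l n) * real (N + 1) < real n" by (simp add: field_simps)
    then have "l n * (N + 1) < n" by (metis of_nat_less_iff of_nat_mult)
    then have "N * l n \<le> n" by (simp add: algebra_simps)
    then show ?case using l[OF elim(2)] by (simp add: less_eq_div_iff_mult_less_eq)
  qed
qed

text \<open>By \<open>quantile_ecdf_le_iff\<close> this is the conditional distribution function of
  the bootstrap quantile at \<open>u\<close> once \<open>1 \<le> n\<close>, written over starting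
  indices so that the product law does not depend on \<omega>.\<close>

definition HB :: "nat \<Rightarrow> 'a \<Rightarrow> real \<Rightarrow> real" where
  "HB n \<omega> u = measure_pmf.prob (Pi_pmf {..<n div l n} 1 (\<lambda>_. pmf_of_set {1..n}))
      {J. p \<le> ecdf (n div l n * l n) (cbb_sample n (l n) (\<lambda>i. X (int i) \<omega>) J) u}"

lemma bootstrap_conditional_clt:
  assumes h: "0 < h" and \<epsilon>: "0 < \<epsilon>"
  shows "whp h (\<lambda>n \<omega>. \<bar>HB n \<omega> (s y n) - Phi ((W n \<omega> + D * y) / \<sigma>)\<bar> \<le> \<epsilon>)"
proof -
  have "0 < \<epsilon> / 2" using \<epsilon> by simp
  from iid_clt_uniform[OF \<sigma>(1) this, where d="1::nat"]
  obtain \<delta> where \<delta>: "\<delta> > 0" and clt: "\<forall>K\<ge>0. \<exists>N. \<forall>b\<ge>N. \<forall>(q :: nat pmf) \<xi>. finite (set_pmf q) \<longrightarrow>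
     measure_pmf.expectation q \<xi> = 0 \<longrightarrow>
     \<bar>measure_pmf.expectation q (\<lambda>x. (\<xi> x)\<^sup>2) - \<sigma>\<^sup>2\<bar> < \<delta> \<longrightarrow>
     measure_pmf.expectation q (\<lambda>x. (\<xi> x)\<^sup>2 - min ((\<xi> x)\<^sup>2) K) < \<delta> \<longrightarrow>
     (\<forall>x. \<bar>measure_pmf.prob (Pi_pmf {..<b} 1 (\<lambda>_. q)) {J. (\<Sum>k<b. \<xi> (J k)) / sqrt (real b) \<le> x} - Phi (x / \<sigma>)\<bar> \<le> \<epsilon> / 2)"
    by blast
  \<comment> \<open>Chosen so that the two conclusions of \<open>avg_square_perturbation\<close>,
    \<open>d * (\<sigma>\<^sup>2 + 8)\<close> and \<open>4 * d\<close>, are both at most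
    \<delta>.\<close>
  define d where "d = min 1 (min (\<delta> / (\<sigma>\<^sup>2 + 8)) (\<delta> / 4))"
  have s8: "0 < \<sigma>\<^sup>2 + 8" by (rule add_nonneg_pos) auto
  have d: "0 < d" "d \<le> 1" "d * (\<sigma>\<^sup>2 + 8) \<le> \<delta>" "4 * d \<le> \<delta>"
  proof -
    show "0 < d" "d \<le> 1" using \<delta> s8 by (auto simp: d_def)
    have "d \<le> \<delta> / (\<sigma>\<^sup>2 + 8)" "d \<le> \<delta> / 4" by (simp_all only: d_def min_le_iff_disj order_refl simp_thms)
    then show "d * (\<sigma>\<^sup>2 + 8) \<le> \<delta>" "4 * d \<le> \<delta>" using s8 by (simp_all add: pos_le_divide_eq)
  qed
  \<comment> \<open>Closeness \<open>d\<close> is what the perturbation lemma asks of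
    \<open>trunc_var m\<close>; closeness \<open>h / 4 * d\<close> is what Markov's inequality needs
    for an exceptional set of probability \<open>h / 4\<close>.\<close>
  define e where "e = min d (h / 4 * d)"
  have e: "0 < e" using d h by (simp add: e_def)
  obtain m where m: "\<bar>trunc_var m - \<sigma>\<^sup>2\<bar> < e"
    using eventually_happens'[OF sequentially_bot tendstoD[OF trunc_var_tendsto e]] by (auto simp: dist_real_def)
  have m1: "\<bar>trunc_var m - \<sigma>\<^sup>2\<bar> < d" using m by (simp add: e_def)
  have "\<bar>trunc_var m - \<sigma>\<^sup>2\<bar> < h / 4 * d" using m unfolding e_def min_less_iff_conj by blast
  then have m2: "\<sigma>\<^sup>2 - trunc_var m < h / 4 * d" by argo
  \<comment> \<open>The truncation level is \<open>2 * m\<close> because the passage from \<eta> to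
    \<xi> doubles it. Only now, with \<open>m\<close> fixed, is the threshold \<open>N\<close> for
    the block count obtained.\<close>
  have "0 \<le> 2 * real m" by simp
  with clt obtain N where N: "\<And>b (q :: nat pmf) \<xi> x. N \<le> b \<Longrightarrow> finite (set_pmf q) \<Longrightarrow>
     measure_pmf.expectation q \<xi> = 0 \<Longrightarrow>
     \<bar>measure_pmf.expectation q (\<lambda>x. (\<xi> x)\<^sup>2) - \<sigma>\<^sup>2\<bar> < \<delta> \<Longrightarrow>
     measure_pmf.expectation q (\<lambda>x. (\<xi> x)\<^sup>2 - min ((\<xi> x)\<^sup>2) (2 * real m)) < \<delta> \<Longrightarrow>
     \<bar>measure_pmf.prob (Pi_pmf {..<b} 1 (\<lambda>_. q)) {J. (\<Sum>k<b. \<xi> (J k)) / sqrt (real b) \<le> x} - Phi (x / \<sigma>)\<bar> \<le> \<epsilon> / 2"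
    by blast
  have h4: "0 < h / 4" using h by simp
  have w1: "whp (h/4) (\<lambda>n \<omega>. avg n (\<lambda>j. (\<xi> y n \<omega> j - \<eta> n \<omega> j)\<^sup>2) < d\<^sup>2)"
    by (rule whp_markov_0[OF perturbation_integrable _ perturbation_tendsto h4]) (use d in \<open>auto intro: avg_nonneg\<close>)
  have w2: "whp (h/4) (\<lambda>n \<omega>. avg n (\<lambda>j. (\<eta> n \<omega> j)\<^sup>2 - min ((\<eta> n \<omega> j)\<^sup>2) (real m)) < d)"
  proof (rule whp_markov[OF truncation_error_integrable])
    show "\<forall>\<^sub>F n in sequentially. expectation (\<lambda>\<omega>. avg n (\<lambda>j. (\<eta> n \<omega> j)\<^sup>2 - min ((\<eta> n \<omega> j)\<^sup>2) (real m))) \<le> h / 4 * d"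
      using order_tendstoD(2)[OF truncation_error_tendsto m2] by (rule eventually_mono) simp
  qed (use d in \<open>auto intro: avg_nonneg\<close>)
  have w3: "whp (h/4) (\<lambda>n \<omega>. \<bar>avg n (\<lambda>j. min ((\<eta> n \<omega> j)\<^sup>2) (real m)) - trunc_var m\<bar> < d)"
    by (rule whp_L2[OF truncated_avg_integrable truncated_avg_tendsto h4 d(1)])
  \<comment> \<open>The factor \<sigma> cancels against the Lipschitz constant of
    \<open>Phi (x / \<sigma>)\<close> in \<open>x\<close>.\<close>
  have w4: "whp (h/4) (\<lambda>n \<omega>. \<bar>sqrt (real (n div l n * l n) / real n) * G y n \<omega> - (W n \<omega> + D * y)\<bar> < \<epsilon> / 2 * \<sigma>)"
    by (rule threshold_approx[OF h4]) (use \<epsilon> \<sigma> in simp)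
  have "h/4 + h/4 + (h/4 + h/4) = h" by simp
  from whp_conj[OF whp_conj[OF w1 w2] whp_conj[OF w3 w4], unfolded this]
  show ?thesis
  proof (rule whp_mono)
    have "\<forall>\<^sub>F n in sequentially. N \<le> n div l n" using filterlim_block_count unfolding filterlim_at_top by blast
    then show "\<forall>\<^sub>F n in sequentially. \<forall>\<omega>\<in>space M.
        (avg n (\<lambda>j. (\<xi> y n \<omega> j - \<eta> n \<omega> j)\<^sup>2) < d\<^sup>2 \<and>
           avg n (\<lambda>j. (\<eta> n \<omega> j)\<^sup>2 - min ((\<eta> n \<omega> j)\<^sup>2) (real m)) < d) \<and>
           \<bar>avg n (\<lambda>j. min ((\<eta> n \<omega> j)\<^sup>2) (real m)) - trunc_var m\<bar> < d \<and>
           \<bar>sqrt (real (n div l n * l n) / real n) * G y n \<omega> - (W n \<omega> + D * y)\<bar> < \<epsilon> / 2 * \<sigma> \<longrightarrow>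
        \<bar>HB n \<omega> (s y n) - Phi ((W n \<omega> + D * y) / \<sigma>)\<bar> \<le> \<epsilon>"
      using eventually_ge_at_top[of 1]
    proof eventually_elim
      case (elim n)
      show ?case
      proof (intro ballI impI)
        fix \<omega>
        let ?x = "sqrt (real (n div l n * l n) / real n) * G y n \<omega>"
        assume *: "(avg n (\<lambda>j. (\<xi> y n \<omega> j - \<eta> n \<omega> j)\<^sup>2) < d\<^sup>2 \<and>
           avg n (\<lambda>j. (\<eta> n \<omega> j)\<^sup>2 - min ((\<eta> n \<omega> j)\<^sup>2) (real m)) < d) \<and>
           \<bar>avg n (\<lambda>j. min ((\<eta> n \<omega> j)\<^sup>2) (real m)) - trunc_var m\<bar> < d \<and>
           \<bar>?x - (W n \<omega> + D * y)\<bar> < \<epsilon> / 2 * \<sigma>"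
        note pert = avg_square_perturbation[OF d(1,2), of n "\<xi> y n \<omega>" "\<eta> n \<omega>" "real m" "trunc_var m" "\<sigma>\<^sup>2"]
        have c1: "\<bar>measure_pmf.prob (Pi_pmf {..<n div l n} 1 (\<lambda>_. pmf_of_set {1..n})) {J. (\<Sum>k<n div l n. \<xi> y n \<omega> (J k)) / sqrt (real (n div l n)) \<le> ?x} - Phi (?x / \<sigma>)\<bar> \<le> \<epsilon> / 2"
        proof (rule N[OF elim(1)])
          show "finite (set_pmf (pmf_of_set {1..n}))" using elim by (subst set_pmf_of_set) auto
          show "measure_pmf.expectation (pmf_of_set {1..n}) (\<xi> y n \<omega>) = 0"
            unfolding expectation_pmf_of_set_interval[OF elim(2)] by (rule \<xi>_mean[OF elim(2)])
          show "\<bar>measure_pmf.expectation (pmf_of_set {1..n}) (\<lambda>x. (\<xi> y n \<omega> x)\<^sup>2) - \<sigma>\<^sup>2\<bar> < \<delta>"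
            unfolding expectation_pmf_of_set_interval[OF elim(2)] using pert(1) * m1 d(3) by auto
          show "measure_pmf.expectation (pmf_of_set {1..n}) (\<lambda>x. (\<xi> y n \<omega> x)\<^sup>2 - min ((\<xi> y n \<omega> x)\<^sup>2) (2 * real m)) < \<delta>"
            unfolding expectation_pmf_of_set_interval[OF elim(2)] using pert(2) * m1 d(4) by auto
        qed
        have "\<bar>Phi (?x / \<sigma>) - Phi ((W n \<omega> + D * y) / \<sigma>)\<bar> \<le> \<bar>?x / \<sigma> - (W n \<omega> + D * y) / \<sigma>\<bar>" by (rule Phi_lipschitz)
        also have "\<dots> = \<bar>?x - (W n \<omega> + D * y)\<bar> / \<sigma>" using \<sigma>(1) by (simp flip: diff_divide_distrib add: abs_divide)
        also have "\<dots> \<le> \<epsilon> / 2" using * \<sigma>(1) by (simp add: divide_le_eq)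
        finally have c2: "\<bar>Phi (?x / \<sigma>) - Phi ((W n \<omega> + D * y) / \<sigma>)\<bar> \<le> \<epsilon> / 2" .
        show "\<bar>HB n \<omega> (s y n) - Phi ((W n \<omega> + D * y) / \<sigma>)\<bar> \<le> \<epsilon>"
          unfolding HB_def bootstrap_event_iff[OF elim(2)] using c1 c2 by linarith
      qed
    qed
  qed
qed

end

subsection \<open>Bootstrap quantiles\<close>

text \<open>Makes the supremum over all \<open>t\<close> in the theorem a countable one, hence measurable.\<close>

lemma cSUP_right_continuous_eq_Rats:
  fixes h :: "real \<Rightarrow> real"
  assumes cont: "\<And>t. continuous (at_right t) h" and bdd: "\<And>t. h t \<le> K"
  shows "(SUP t. h t) = (SUP t\<in>\<rat>. h t)"
proof (rule antisym)
  have b: "bdd_above (h ` A)" for A by (rule bdd_aboveI[of _ K]) (use bdd in auto)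
  show "(SUP t. h t) \<le> (SUP t\<in>\<rat>. h t)"
  proof (rule cSUP_least, simp, rule ccontr)
    fix t assume "\<not> h t \<le> (SUP t\<in>\<rat>. h t)"
    then have "\<forall>\<^sub>F u in at_right t. (SUP t\<in>\<rat>. h t) < h u"
      using cont[of t] by (intro order_tendstoD(1)[of h "h t"]) (auto simp: continuous_within)
    then obtain c where c: "t < c" "\<And>u. t < u \<Longrightarrow> u < c \<Longrightarrow> (SUP t\<in>\<rat>. h t) < h u"
      by (auto simp: eventually_at_right_field)
    obtain q where q: "q \<in> \<rat>" "t < q" "q < c" using Rats_dense_in_real[OF c(1)] by blast
    have "h q \<le> (SUP t\<in>\<rat>. h t)" by (rule cSUP_upper[OF q(1) b])
    then show False using c(2)[OF q(2,3)] by simp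
  qed
  show "(SUP t\<in>\<rat>. h t) \<le> (SUP t. h t)"
    by (rule cSUP_subset_mono[OF _ b]) auto
qed

lemma continuous_prob_le:
  fixes Z :: "'b \<Rightarrow> real"
  assumes "prob_space N" "Z \<in> borel_measurable N"
  shows "continuous (at_right t) (\<lambda>t. measure N {\<omega>\<in>space N. Z \<omega> \<le> t})"
proof -
  interpret prob_space N by fact
  interpret R: real_distribution "distr N borel Z" by (rule real_distribution_distr[OF assms(2)])
  have "(\<lambda>t. measure N {\<omega>\<in>space N. Z \<omega> \<le> t}) = cdf (distr N borel Z)"
    using assms(2) by (auto simp: cdf_def measure_distr vimage_def Int_def conj_commute)
  then show ?thesis using R.cdf_is_right_cont by simp
qed

lemma measure_pmf_finite_sum:
  assumes "finite (set_pmf P)"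
  shows "measure_pmf.prob P A = (\<Sum>J\<in>set_pmf P. pmf P J * indicat_real A J)"
proof -
  have "measure_pmf.prob P A = measure_pmf.prob P (A \<inter> set_pmf P)" by (simp add: measure_Int_set_pmf)
  also have "\<dots> = (\<Sum>J\<in>A \<inter> set_pmf P. pmf P J)" using assms by (intro measure_measure_pmf_finite) auto
  also have "\<dots> = (\<Sum>J\<in>set_pmf P. if J \<in> A then pmf P J else 0)"
    using assms by (simp add: sum.inter_restrict[symmetric] Int_commute)
  also have "\<dots> = (\<Sum>J\<in>set_pmf P. pmf P J * indicat_real A J)"
    by (intro sum.cong) auto
  finally show ?thesis .
qed

lemma quantile_ecdf_measurable:
  assumes u[measurable]: "\<And>i. u i \<in> borel_measurable M" and p: "0 < p" "p < 1"
  shows "(\<lambda>\<omega>. quantile (ecdf m (\<lambda>i. u i \<omega>)) p) \<in> borel_measurable M"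
\<comment> \<open>For an empty sample the distribution function is constantly 0, since division by 0
  gives 0; the quantile is then the infimum of the empty set, the same value for all
  \<omega>.\<close>
proof (cases "m = 0")
  case True
  then show ?thesis by (simp add: ecdf_def[abs_def])
next
  case False
  show ?thesis
  proof (rule borel_measurableI_le)
    fix t
    have "{\<omega>\<in>space M. quantile (ecdf m (\<lambda>i. u i \<omega>)) p \<le> t} = {\<omega>\<in>space M. p \<le> ecdf m (\<lambda>i. u i \<omega>) t}"
      using quantile_ecdf_le_iff[of m p] False p by auto
    also have "\<dots> \<in> sets M" unfolding ecdf_def by measurable
    finally show "{\<omega>\<in>space M. quantile (ecdf m (\<lambda>i. u i \<omega>)) p \<le> t} \<in> sets M" .
  qed
qed

text \<open>\<open>tendsto_in_prob\<close> demands measurability at every index, including 0, so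
  nothing is assumed about \<open>n\<close>, \<open>m\<close> and \<open>l\<close>.\<close>

lemma bootstrap_distance_measurable:
  fixes X :: "int \<Rightarrow> 'a \<Rightarrow> real"
  assumes M: "prob_space M" and X[measurable]: "\<And>i. X i \<in> borel_measurable M" and p: "0 < p" "p < 1"
  shows "(\<lambda>\<omega>. SUP t.
       \<bar>measure_pmf.prob (cbb_pmf n l (\<lambda>i. X (int i) \<omega>))
           {y. quantile (ecdf m y) p - quantile (ecdf n (\<lambda>i. X (int i) \<omega>)) p \<le> t}
        - measure M {\<omega>' \<in> space M. quantile (ecdf n (\<lambda>i. X (int i) \<omega>')) p - tp \<le> t}\<bar>) \<in> borel_measurable M"
proof -
  interpret prob_space M by fact
  define Q where "Q \<omega> = quantile (ecdf n (\<lambda>i. X (int i) \<omega>)) p" for \<omega>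
  have Q[measurable]: "Q \<in> borel_measurable M"
    unfolding Q_def[abs_def] by (rule quantile_ecdf_measurable[OF _ p]) measurable
  define f where "f \<omega> t = measure_pmf.prob (cbb_pmf n l (\<lambda>i. X (int i) \<omega>)) {y. quantile (ecdf m y) p - Q \<omega> \<le> t}" for \<omega> t
  define g where "g t = prob {\<omega>'\<in>space M. Q \<omega>' - tp \<le> t}" for t
  have cf: "continuous (at_right t) (f \<omega>)" for t \<omega>
    using continuous_prob_le[OF measure_pmf.prob_space_axioms, of "\<lambda>y. quantile (ecdf m y) p - Q \<omega>" "cbb_pmf n l (\<lambda>i. X (int i) \<omega>)" t]
    by (simp add: f_def[abs_def])
  have cg: "continuous (at_right t) g" for t
    unfolding g_def[abs_def] by (rule continuous_prob_le[OF M]) measurable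
  have b: "\<bar>f \<omega> t - g t\<bar> \<le> 1" for \<omega> t
  proof -
    have "0 \<le> f \<omega> t" "f \<omega> t \<le> 1" "0 \<le> g t" "g t \<le> 1" by (simp_all add: f_def g_def)
    then show ?thesis by argo
  qed
  have fm[measurable]: "(\<lambda>\<omega>. f \<omega> t) \<in> borel_measurable M" for t
  proof -
    let ?P = "Pi_pmf {..<n div l} 1 (\<lambda>_. pmf_of_set {1..n})"
    have fin: "finite (set_pmf ?P)"
    \<comment> \<open>For \<open>n = 0\<close> the uniform law on the empty set is unspecified, but
      there are no blocks, so the product is a point mass.\<close>
    proof (cases "n = 0")
      case False
      then have "finite (set_pmf (pmf_of_set {1..n}))" by (subst set_pmf_of_set) auto
      then show ?thesis by (intro finite_subset[OF set_Pi_pmf_subset'] finite_PiE_dflt) auto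
    qed simp
    \<comment> \<open>The weights are deterministic and only the events depend on \<omega>; this
      turns the random probability into a finite sum of measurable terms.\<close>
    have "f \<omega> t = (\<Sum>J\<in>set_pmf ?P. pmf ?P J * indicat_real {..t} (quantile (ecdf m (cbb_sample n l (\<lambda>i. X (int i) \<omega>) J)) p - Q \<omega>))" for \<omega>
      unfolding f_def cbb_pmf_def measure_map_pmf measure_pmf_finite_sum[OF fin]
      by (intro sum.cong) (auto simp: indicator_def)
    moreover have "(\<lambda>\<omega>. quantile (ecdf m (cbb_sample n l (\<lambda>i. X (int i) \<omega>) J)) p) \<in> borel_measurable M" for J
    proof -
      have "cbb_sample n l (\<lambda>i. X (int i) \<omega>) J = (\<lambda>i. X (int ((J ((i - 1) div l) + (i - 1) mod l - 1) mod n + 1)) \<omega>)" for \<omega>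
        by (rule ext) (simp add: cbb_sample_def periodic_ext_def)
      then show ?thesis by (simp only:) (rule quantile_ecdf_measurable[OF X p])
    qed
    ultimately show ?thesis by simp
  qed
  have "(SUP t. \<bar>f \<omega> t - g t\<bar>) = (SUP t\<in>\<rat>. \<bar>f \<omega> t - g t\<bar>)" for \<omega>
    by (rule cSUP_right_continuous_eq_Rats[OF _ b]) (intro continuous_intros cf cg)
  moreover have "(\<lambda>\<omega>. SUP t\<in>\<rat>. \<bar>f \<omega> t - g t\<bar>) \<in> borel_measurable M"
  proof (rule borel_measurable_cSUP)
    show "bdd_above ((\<lambda>t. \<bar>f \<omega> t - g t\<bar>) ` \<rat>)" for \<omega> by (rule bdd_aboveI[of _ 1]) (use b in auto)
  qed (auto intro: countable_rat)
  ultimately show ?thesis unfolding f_def g_def Q_def by simp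
qed

section \<open>From distribution functions to quantiles\<close>

context quantile_bootstrap
begin

definition Q :: "nat \<Rightarrow> 'a \<Rightarrow> real" where
  "Q n \<omega> = quantile (ecdf n (\<lambda>i. X (int i) \<omega>)) p"

lemma HB_mono: "u \<le> v \<Longrightarrow> HB n \<omega> u \<le> HB n \<omega> v"
  unfolding HB_def using mono_ecdf
  by (intro measure_pmf.finite_measure_mono) (auto simp: mono_def intro: order_trans)

lemma Q_G:
  assumes n: "1 \<le> n"
  shows "sqrt (real n) * (Q n \<omega> - tp) \<le> y \<longleftrightarrow> 0 \<le> G y n \<omega>"
proof -
  have s: "0 < sqrt (real n)" "sqrt (real n) * sqrt (real n) = real n" using n by auto
  have "sqrt (real n) * (Q n \<omega> - tp) \<le> y \<longleftrightarrow> Q n \<omega> \<le> s y n"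
  proof -
    have "sqrt (real n) * (Q n \<omega> - tp) \<le> y \<longleftrightarrow> Q n \<omega> - tp \<le> y / sqrt (real n)"
      unfolding pos_le_divide_eq[OF s(1)] by (simp only: mult.commute)
    then show ?thesis by (simp only: diff_le_eq add.commute)
  qed
  also have "\<dots> \<longleftrightarrow> 0 \<le> S {..s y n} n \<omega> / n + \<pi> {..s y n} - p"
    unfolding Q_def using quantile_ecdf_le_iff[OF n p] ecdf_eq[OF n] by simp
  also have "\<dots> \<longleftrightarrow> 0 \<le> sqrt (real n) * (S {..s y n} n \<omega> / n + \<pi> {..s y n} - p)"
    using s(1) by (simp only: zero_le_mult_iff) auto
  also have "sqrt (real n) * (S {..s y n} n \<omega> / n + \<pi> {..s y n} - p) = G y n \<omega>"
  proof -
    have "S {..s y n} n \<omega> / sqrt (real n) = sqrt (real n) * (S {..s y n} n \<omega> / n)"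
    proof -
      have "c \<noteq> 0 \<Longrightarrow> v / c = c * (v / (c * c))" for c v :: real by (simp add: field_simps)
      moreover have "sqrt (real n) \<noteq> 0" using s(1) by simp
      ultimately have "S {..s y n} n \<omega> / sqrt (real n) = sqrt (real n) * (S {..s y n} n \<omega> / (sqrt (real n) * sqrt (real n)))"
        by blast
      then show ?thesis unfolding s(2) .
    qed
    then show ?thesis by (simp add: G_def algebra_simps)
  qed
  finally show ?thesis .
qed

lemma G_measurable[measurable]: "G y n \<in> borel_measurable M"
  unfolding G_def[abs_def] using S_measurable[of "{..s y n}"] by measurable

lemma W_measurable[measurable]: "W n \<in> borel_measurable M"
  unfolding W_def[abs_def] using S_measurable[of "{..tp}"] by measurable

lemma W_clt: "(\<lambda>n. prob {\<omega>\<in>space M. W n \<omega> \<le> x}) \<longlonglongrightarrow> Phi (x / \<sigma>)"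
proof -
  have [measurable]: "S {..tp} n \<in> borel_measurable M" for n by (rule S_measurable) simp
  have "weak_conv_m (\<lambda>n. distr M borel (\<lambda>\<omega>. S {..tp} n \<omega> / sqrt n / \<sigma>)) std_normal_distribution"
    by (rule mixing_clt) (use \<sigma> in auto)
  then have "(\<lambda>n. cdf (distr M borel (\<lambda>\<omega>. S {..tp} n \<omega> / sqrt n / \<sigma>)) (x / \<sigma>)) \<longlonglongrightarrow> Phi (x / \<sigma>)"
    unfolding weak_conv_m_def weak_conv_def using isCont_Phi by blast
  moreover have "cdf (distr M borel (\<lambda>\<omega>. S {..tp} n \<omega> / sqrt n / \<sigma>)) (x / \<sigma>) = prob {\<omega>\<in>space M. W n \<omega> \<le> x}" for n
  proof -
    have "v / \<sigma> \<le> x / \<sigma> \<longleftrightarrow> v \<le> x" for v using \<sigma>(1) by (simp add: divide_le_cancel)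
    then have "(\<lambda>\<omega>. S {..tp} n \<omega> / sqrt n / \<sigma>) -` {..x / \<sigma>} \<inter> space M = {\<omega>\<in>space M. W n \<omega> \<le> x}"
      by (auto simp: W_def simp del: divide_divide_eq_left)
    then show ?thesis by (simp add: cdf_def measure_distr del: divide_divide_eq_left)
  qed
  ultimately show ?thesis by simp
qed

lemma quantile_clt:
  "(\<lambda>n. prob {\<omega>\<in>space M. sqrt (real n) * (Q n \<omega> - tp) \<le> t}) \<longlonglongrightarrow> Phi (D / \<sigma> * t)"
proof (rule tendstoI)
  fix \<epsilon> :: real assume \<epsilon>: "0 < \<epsilon>"
  \<comment> \<open>A shift of the argument by \<delta>/\<sigma> costs \<epsilon>/4 by the Lipschitz
    bound. The limit of \<open>W\<close> and the exceptional set cost another \<epsilon>/4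
    each.\<close>
  define \<delta> where "\<delta> = \<epsilon> / 4 * \<sigma>"
  have \<delta>: "0 < \<delta>" using \<epsilon> \<sigma> by (simp add: \<delta>_def)
  \<comment> \<open>\<open>0 \<le> G t n \<omega>\<close> is approximately a lower bound on
    \<open>W\<close>, so upper tails are needed; \<open>Phi_uminus\<close> gives their
    limit.\<close>
  have w: "(\<lambda>n. prob {\<omega>\<in>space M. \<not> W n \<omega> \<le> - x}) \<longlonglongrightarrow> Phi (x / \<sigma>)" for x
  proof -
    have "(\<lambda>n. 1 - prob {\<omega>\<in>space M. W n \<omega> \<le> - x}) \<longlonglongrightarrow> 1 - Phi ((- x) / \<sigma>)"
      by (intro tendsto_intros W_clt)
    moreover have "prob {\<omega>\<in>space M. \<not> W n \<omega> \<le> - x} = 1 - prob {\<omega>\<in>space M. W n \<omega> \<le> - x}" for n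
      by (rule prob_neg) measurable
    ultimately show ?thesis by (simp add: Phi_uminus)
  qed
  have "\<epsilon> / 4 > 0" using \<epsilon> by simp
  have "\<forall>\<^sub>F n in sequentially. \<exists>A\<in>events. prob A \<le> \<epsilon> / 4 \<and> {\<omega>\<in>space M. \<not> \<bar>G t n \<omega> - (W n \<omega> + D * t)\<bar> < \<delta>} \<subseteq> A"
    using G_approx[OF \<open>\<epsilon> / 4 > 0\<close> \<delta>, of t] unfolding whp_def .
  with tendstoD[OF w[of "D * t + \<delta>"] \<open>\<epsilon> / 4 > 0\<close>] tendstoD[OF w[of "D * t - \<delta>"] \<open>\<epsilon> / 4 > 0\<close>] eventually_ge_at_top[of 1]
  show "\<forall>\<^sub>F n in sequentially. dist (prob {\<omega>\<in>space M. sqrt (real n) * (Q n \<omega> - tp) \<le> t}) (Phi (D / \<sigma> * t)) < \<epsilon>"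
  proof eventually_elim
    case (elim n)
    let ?E = "{\<omega>\<in>space M. 0 \<le> G t n \<omega>}"
    let ?U = "\<lambda>x. {\<omega>\<in>space M. \<not> W n \<omega> \<le> - x}"
    obtain A where A: "A \<in> events" "prob A \<le> \<epsilon> / 4" "{\<omega>\<in>space M. \<not> \<bar>G t n \<omega> - (W n \<omega> + D * t)\<bar> < \<delta>} \<subseteq> A"
      using elim(4) by blast
    have m: "?E \<in> events" "?U x \<in> events" for x by measurable
    have "?E \<subseteq> ?U (D * t + \<delta>) \<union> A"
    proof
      fix \<omega> assume "\<omega> \<in> ?E"
      then show "\<omega> \<in> ?U (D * t + \<delta>) \<union> A"
        using A(3) by (cases "\<bar>G t n \<omega> - (W n \<omega> + D * t)\<bar> < \<delta>") auto
    qed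
    then have up: "prob ?E \<le> prob (?U (D * t + \<delta>)) + prob A"
      using m A(1) by (intro order_trans[OF finite_measure_mono measure_Un_le]) auto
    have "?U (D * t - \<delta>) \<subseteq> ?E \<union> A"
    proof
      fix \<omega> assume "\<omega> \<in> ?U (D * t - \<delta>)"
      then show "\<omega> \<in> ?E \<union> A"
        using A(3) by (cases "\<bar>G t n \<omega> - (W n \<omega> + D * t)\<bar> < \<delta>") auto
    qed
    then have lo: "prob (?U (D * t - \<delta>)) \<le> prob ?E + prob A"
      using m A(1) by (intro order_trans[OF finite_measure_mono measure_Un_le]) auto
    have L: "\<bar>Phi ((D * t + z) / \<sigma>) - Phi (D / \<sigma> * t)\<bar> \<le> \<bar>z\<bar> / \<sigma>" for z
    proof -
      have "\<bar>Phi ((D * t + z) / \<sigma>) - Phi (D / \<sigma> * t)\<bar> \<le> \<bar>(D * t + z) / \<sigma> - D / \<sigma> * t\<bar>" by (rule Phi_lipschitz)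
      also have "(D * t + z) / \<sigma> - D / \<sigma> * t = z / \<sigma>" by (simp add: add_divide_distrib)
      finally show ?thesis using \<sigma>(1) by (simp add: abs_divide)
    qed
    have d: "\<bar>\<delta>\<bar> / \<sigma> = \<epsilon> / 4" "\<bar>- \<delta>\<bar> / \<sigma> = \<epsilon> / 4" using \<delta> \<sigma>(1) by (simp_all add: \<delta>_def)
    have E: "{\<omega>\<in>space M. sqrt (real n) * (Q n \<omega> - tp) \<le> t} = ?E" using Q_G[OF elim(3)] by auto
    have "dist (prob ?E) (Phi (D / \<sigma> * t)) < \<epsilon>"
      using up lo A(2) L[of \<delta>] L[of "- \<delta>"] elim(1,2) \<epsilon> unfolding d dist_real_def by simp argo
    then show ?case unfolding E .
  qed
qed

text \<open>The point of evaluation is random, so it is trapped between neighbours of a deterministic grid of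
  mesh \<open>z\<close>, on which finitely many exceptional sets have to be avoided.\<close>

lemma bootstrap_quantile_pointwise:
  assumes h: "0 < h" and \<epsilon>: "0 < \<epsilon>"
  shows "whp h (\<lambda>n \<omega>. \<bar>HB n \<omega> (Q n \<omega> + t / sqrt (real n)) - Phi (D / \<sigma> * t)\<bar> \<le> \<epsilon>)"
proof -
  \<comment> \<open>The mesh for which an argument error of \<open>2 * (D * z)\<close>, two grid
    steps, changes \<open>Phi\<close> by at most \<epsilon>/2.\<close>
  define z where "z = \<epsilon> * \<sigma> / (4 * D)"
  have z: "0 < z" using \<epsilon> \<sigma> D by (simp add: z_def)
  have Dz: "2 * (D * z) / \<sigma> = \<epsilon> / 2" using D \<sigma> by (simp add: z_def)
  have h3: "0 < h/3" using h by simp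
  obtain C where C: "0 < C" "whp (h/3) (\<lambda>n \<omega>. \<bar>W n \<omega>\<bar> < C)" using W_tight[OF h3] by blast
  \<comment> \<open>Large enough that, when \<open>W\<close> is below \<open>C\<close> in absolute
    value, the sign of \<open>G\<close> is forced at both points \<open>(N - 1) * z\<close> and
    \<open>- (N - 1) * z\<close>. This confines the rescaled quantile to the grid.\<close>
  define N where "N = \<lceil>(C / D + z) / z\<rceil> + 1"
  define I where "I = {- N .. N}"
  have Nz: "C / D + z \<le> of_int (N - 1) * z"
  proof -
    have "(C / D + z) / z \<le> of_int (N - 1)" unfolding N_def by simp
    then show ?thesis using z by (simp add: pos_divide_le_eq)
  qed
  have Nz': "C + D * z \<le> D * (of_int (N - 1) * z)"
    using mult_left_mono[OF Nz, of D] D by (simp add: distrib_left)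
  define y where "y i = of_int i * z" for i :: int
  have y1: "y i = y (i - 1) + z" for i by (simp add: y_def algebra_simps)
  have w2: "whp (h/3) (\<lambda>n \<omega>. \<forall>i\<in>I. \<bar>G (y i) n \<omega> - (W n \<omega> + D * y i)\<bar> < D * z)"
  proof (rule whp_finite_Ball[OF _ _ h3])
    show "whp \<eta> (\<lambda>n \<omega>. \<bar>G (y i) n \<omega> - (W n \<omega> + D * y i)\<bar> < D * z)" if "0 < \<eta>" for i \<eta>
      by (rule G_approx[OF that]) (use z D in simp)
  qed (simp add: I_def)
  have w3: "whp (h/3) (\<lambda>n \<omega>. \<forall>i\<in>I. \<bar>HB n \<omega> (s (y i + t) n) - Phi ((W n \<omega> + D * (y i + t)) / \<sigma>)\<bar> \<le> \<epsilon>/2)"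
  proof (rule whp_finite_Ball[OF _ _ h3])
    show "whp \<eta> (\<lambda>n \<omega>. \<bar>HB n \<omega> (s (y i + t) n) - Phi ((W n \<omega> + D * (y i + t)) / \<sigma>)\<bar> \<le> \<epsilon>/2)" if "0 < \<eta>" for i \<eta>
      by (rule bootstrap_conditional_clt[OF that]) (use \<epsilon> in simp)
  qed (simp add: I_def)
  have "h/3 + (h/3 + h/3) = h" by simp
  from whp_conj[OF C(2) whp_conj[OF w2 w3], unfolded this]
  show ?thesis
  proof (rule whp_mono)
    show "\<forall>\<^sub>F n in sequentially. \<forall>\<omega>\<in>space M. \<bar>W n \<omega>\<bar> < C \<and>
        (\<forall>i\<in>I. \<bar>G (y i) n \<omega> - (W n \<omega> + D * y i)\<bar> < D * z) \<and>
        (\<forall>i\<in>I. \<bar>HB n \<omega> (s (y i + t) n) - Phi ((W n \<omega> + D * (y i + t)) / \<sigma>)\<bar> \<le> \<epsilon>/2) \<longrightarrow>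
        \<bar>HB n \<omega> (Q n \<omega> + t / sqrt (real n)) - Phi (D / \<sigma> * t)\<bar> \<le> \<epsilon>"
      using eventually_ge_at_top[of 1]
    proof eventually_elim
      case (elim n)
      show ?case
      proof (intro ballI impI, elim conjE)
        fix \<omega>
        assume W: "\<bar>W n \<omega>\<bar> < C" and G: "\<forall>i\<in>I. \<bar>G (y i) n \<omega> - (W n \<omega> + D * y i)\<bar> < D * z"
          and H: "\<forall>i\<in>I. \<bar>HB n \<omega> (s (y i + t) n) - Phi ((W n \<omega> + D * (y i + t)) / \<sigma>)\<bar> \<le> \<epsilon>/2"
        define q where "q = sqrt (real n) * (Q n \<omega> - tp)"
        have Qq: "Q n \<omega> = tp + q / sqrt (real n)" using elim by (simp add: q_def)
        have qG: "q \<le> v \<longleftrightarrow> 0 \<le> G v n \<omega>" for v unfolding q_def by (rule Q_G[OF elim])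
        have "0 < (C / D + z) / z" using C D z by (simp add: add_pos_pos)
        then have N0: "1 \<le> N - 1" unfolding N_def by simp
        then have NI: "N - 1 \<in> I" "- (N - 1) \<in> I" by (auto simp: I_def)
        have "0 \<le> G (y (N - 1)) n \<omega>"
          using bspec[OF G NI(1)] W Nz' unfolding y_def by argo
        then have up: "q \<le> of_int (N - 1) * z" using qG[of "y (N - 1)"] by (simp add: y_def)
        have "G (y (- (N - 1))) n \<omega> < 0"
        proof -
          have "D * y (- (N - 1)) = - (D * (of_int (N - 1) * z))" by (simp add: y_def algebra_simps)
          then show ?thesis using bspec[OF G NI(2)] W Nz' by argo
        qed
        then have lo: "- (of_int (N - 1) * z) < q" using qG[of "y (- (N - 1))"] by (simp add: y_def algebra_simps)
        define i where "i = \<lceil>q / z\<rceil>"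
        have "q / z \<le> of_int i" "of_int i < q / z + 1" unfolding i_def by linarith+
        then have i: "q \<le> y i" "y (i - 1) < q" using z by (simp_all add: y_def field_simps)
        have "q / z \<le> of_int (N - 1)" using up z by (simp add: pos_divide_le_eq)
        then have "i \<le> N - 1" unfolding i_def ceiling_le_iff .
        moreover have "of_int (- (N - 1)) < q / z" unfolding pos_less_divide_eq[OF z] using lo by (simp add: algebra_simps)
        then have "- (N - 1) < i" unfolding i_def less_ceiling_iff .
        ultimately have iI: "i \<in> I" "i - 1 \<in> I" by (auto simp: I_def)
        \<comment> \<open>The random index \<open>i\<close> is chosen by the quantile itself, so the
          signs of \<open>G\<close> at both neighbours are known. They force
          \<open>W + D * y\<close> at both neighbours to within \<open>2 * (D * z)\<close> of 0,
          whatever \<open>W\<close> is.\<close>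
        have "0 \<le> G (y i) n \<omega>" using i(1) qG by blast
        then have a1: "- (D * z) < W n \<omega> + D * y i" using bspec[OF G iI(1)] by argo
        have "\<not> 0 \<le> G (y (i - 1)) n \<omega>" using i(2) qG[of "y (i - 1)"] by simp
        then have a2: "W n \<omega> + D * y (i - 1) < D * z" using bspec[OF G iI(2)] by argo
        have yD: "D * y i = D * y (i - 1) + D * z" using y1[of i] by (simp add: distrib_left)
        interpret N: real_distribution std_normal_distribution by (rule real_dist_normal_dist)
        have L: "\<bar>Phi ((v + D * t) / \<sigma>) - Phi (D / \<sigma> * t)\<bar> \<le> \<bar>v\<bar> / \<sigma>" for v
        proof -
          have "\<bar>Phi ((v + D * t) / \<sigma>) - Phi (D / \<sigma> * t)\<bar> \<le> \<bar>(v + D * t) / \<sigma> - D / \<sigma> * t\<bar>" by (rule Phi_lipschitz)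
          also have "(v + D * t) / \<sigma> - D / \<sigma> * t = v / \<sigma>" by (simp add: add_divide_distrib)
          finally show ?thesis using \<sigma>(1) by (simp add: abs_divide)
        qed
        have Dz0: "0 < D * z" using D z by simp
        have le: "v \<le> w \<Longrightarrow> (v + D * t) / \<sigma> \<le> (w + D * t) / \<sigma>" for v w
          using \<sigma>(1) by (intro divide_right_mono) auto
        have sq: "q \<le> v \<Longrightarrow> Q n \<omega> + t / sqrt (real n) \<le> s (v + t) n" "v \<le> q \<Longrightarrow> s (v + t) n \<le> Q n \<omega> + t / sqrt (real n)" for v
          unfolding Qq add_divide_distrib by (auto intro: divide_right_mono)
        have "HB n \<omega> (Q n \<omega> + t / sqrt (real n)) \<le> HB n \<omega> (s (y i + t) n)" by (rule HB_mono[OF sq(1)[OF i(1)]])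
        moreover have "Phi ((W n \<omega> + D * (y i + t)) / \<sigma>) \<le> Phi ((2 * (D * z) + D * t) / \<sigma>)"
        proof (rule N.cdf_nondecreasing)
          have "W n \<omega> + D * y i \<le> 2 * (D * z)" using a2 yD by argo
          from le[OF this] show "(W n \<omega> + D * (y i + t)) / \<sigma> \<le> (2 * (D * z) + D * t) / \<sigma>" by (simp add: distrib_left add.assoc)
        qed
        moreover have "\<bar>Phi ((2 * (D * z) + D * t) / \<sigma>) - Phi (D / \<sigma> * t)\<bar> \<le> \<epsilon> / 2"
          using L[of "2 * (D * z)"] Dz Dz0 by simp
        moreover have "HB n \<omega> (s (y (i - 1) + t) n) \<le> HB n \<omega> (Q n \<omega> + t / sqrt (real n))" by (rule HB_mono[OF sq(2)[OF less_imp_le[OF i(2)]]])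
        moreover have "Phi ((- (2 * (D * z)) + D * t) / \<sigma>) \<le> Phi ((W n \<omega> + D * (y (i - 1) + t)) / \<sigma>)"
        proof (rule N.cdf_nondecreasing)
          have "- (2 * (D * z)) \<le> W n \<omega> + D * y (i - 1)" using a1 yD by argo
          from le[OF this] show "(- (2 * (D * z)) + D * t) / \<sigma> \<le> (W n \<omega> + D * (y (i - 1) + t)) / \<sigma>" by (simp add: distrib_left add.assoc)
        qed
        moreover have "\<bar>Phi ((- (2 * (D * z)) + D * t) / \<sigma>) - Phi (D / \<sigma> * t)\<bar> \<le> \<epsilon> / 2"
          using L[of "- (2 * (D * z))"] Dz Dz0 by simp
        moreover note bspec[OF H iI(1)] bspec[OF H iI(2)]
        ultimately show "\<bar>HB n \<omega> (Q n \<omega> + t / sqrt (real n)) - Phi (D / \<sigma> * t)\<bar> \<le> \<epsilon>" by argo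
      qed
    qed
  qed
qed

text \<open>Both distribution functions are compared with the same continuous limit on the same
  finite grid. The error \<epsilon>/4 there becomes \<epsilon>/2 everywhere for each of
  them.\<close>

lemma bootstrap_quantile_uniform:
  assumes h: "0 < h" and \<epsilon>: "0 < \<epsilon>"
  shows "whp h (\<lambda>n \<omega>. \<forall>t. \<bar>measure_pmf.prob (cbb_pmf n (l n) (\<lambda>i. X (int i) \<omega>))
           {y. quantile (ecdf (n div l n * l n) y) p - Q n \<omega> \<le> t}
        - prob {\<omega>' \<in> space M. Q n \<omega>' - tp \<le> t}\<bar> \<le> \<epsilon>)"
proof -
  have e: "0 < \<epsilon> / 4" "0 < D / \<sigma>" using \<epsilon> D \<sigma> by auto
  obtain T where T: "finite T" and grid: "\<forall>F. mono F \<and> (\<forall>t. 0 \<le> F t \<and> F t \<le> 1) \<and> (\<forall>t\<in>T. \<bar>F t - Phi (D / \<sigma> * t)\<bar> \<le> \<epsilon>/4) \<longrightarrow>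
           (\<forall>t. \<bar>F t - Phi (D / \<sigma> * t)\<bar> \<le> 2 * (\<epsilon>/4))"
    using polya_grid_Phi[OF e(2,1)] by (elim exE conjE) (rule that)
  have "whp h (\<lambda>n \<omega>. \<forall>t\<in>T. \<bar>HB n \<omega> (Q n \<omega> + t / sqrt (real n)) - Phi (D / \<sigma> * t)\<bar> \<le> \<epsilon>/4)"
    by (rule whp_finite_Ball[OF T bootstrap_quantile_pointwise[OF _ e(1)] h])
  then show ?thesis
  proof (rule whp_mono)
    have "\<forall>\<^sub>F n in sequentially. \<forall>t\<in>T. dist (prob {\<omega>\<in>space M. sqrt (real n) * (Q n \<omega> - tp) \<le> t}) (Phi (D / \<sigma> * t)) < \<epsilon>/4"
      by (intro eventually_ball_finite[OF T] ballI tendstoD[OF quantile_clt e(1)])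
    then show "\<forall>\<^sub>F n in sequentially. \<forall>\<omega>\<in>space M. (\<forall>t\<in>T. \<bar>HB n \<omega> (Q n \<omega> + t / sqrt (real n)) - Phi (D / \<sigma> * t)\<bar> \<le> \<epsilon>/4) \<longrightarrow>
        (\<forall>t. \<bar>measure_pmf.prob (cbb_pmf n (l n) (\<lambda>i. X (int i) \<omega>)) {y. quantile (ecdf (n div l n * l n) y) p - Q n \<omega> \<le> t}
        - prob {\<omega>' \<in> space M. Q n \<omega>' - tp \<le> t}\<bar> \<le> \<epsilon>)"
      using eventually_ge_at_top[of 1]
    proof eventually_elim
      case (elim n)
      have L: "1 \<le> l n" "l n \<le> n" using l[OF elim(2)] by auto
      then have "1 \<le> n div l n" by (simp add: Suc_le_eq div_greater_zero_iff)
      then have bl: "1 \<le> n div l n * l n" using L by (simp add: Suc_le_eq)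
      have sn: "0 < sqrt (real n)" using elim(2) by simp
      let ?P = "\<lambda>t. prob {\<omega>\<in>space M. sqrt (real n) * (Q n \<omega> - tp) \<le> t}"
      have Qm[measurable]: "Q n \<in> borel_measurable M"
        unfolding Q_def[abs_def] by (rule quantile_ecdf_measurable[OF X_measurable p])
      have P: "\<forall>t. \<bar>?P t - Phi (D / \<sigma> * t)\<bar> \<le> 2 * (\<epsilon>/4)"
      proof (rule spec[OF grid, THEN mp], intro conjI allI ballI)
        show "mono ?P"
        proof (rule monoI, rule finite_measure_mono)
          fix u v :: real assume "u \<le> v"
          then show "{\<omega>\<in>space M. sqrt (real n) * (Q n \<omega> - tp) \<le> u} \<subseteq> {\<omega>\<in>space M. sqrt (real n) * (Q n \<omega> - tp) \<le> v}" by auto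
        qed measurable
        show "0 \<le> ?P t" "?P t \<le> 1" for t by simp_all
        show "\<bar>?P t - Phi (D / \<sigma> * t)\<bar> \<le> \<epsilon>/4" if "t \<in> T" for t
          using bspec[OF elim(1) that] unfolding dist_real_def by (rule less_imp_le)
      qed
      show ?case
      proof (intro ballI impI allI)
        fix \<omega> t assume H: "\<forall>t\<in>T. \<bar>HB n \<omega> (Q n \<omega> + t / sqrt (real n)) - Phi (D / \<sigma> * t)\<bar> \<le> \<epsilon>/4"
        have B: "\<forall>t. \<bar>HB n \<omega> (Q n \<omega> + t / sqrt (real n)) - Phi (D / \<sigma> * t)\<bar> \<le> 2 * (\<epsilon>/4)"
        proof (rule spec[OF grid, THEN mp], intro conjI allI ballI)
          show "mono (\<lambda>t. HB n \<omega> (Q n \<omega> + t / sqrt (real n)))"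
            by (intro monoI HB_mono add_left_mono divide_right_mono) auto
          show "0 \<le> HB n \<omega> (Q n \<omega> + t / sqrt (real n))" "HB n \<omega> (Q n \<omega> + t / sqrt (real n)) \<le> 1" for t
            by (simp_all add: HB_def)
          show "\<bar>HB n \<omega> (Q n \<omega> + t / sqrt (real n)) - Phi (D / \<sigma> * t)\<bar> \<le> \<epsilon>/4" if "t \<in> T" for t
            using H that by blast
        qed
        \<comment> \<open>The grid bounds hold for every real argument, so the unscaled
          \<open>t\<close> is reached by evaluating them at \<open>sqrt n * t\<close>.\<close>
        let ?t = "sqrt (real n) * t"
        have 1: "measure_pmf.prob (cbb_pmf n (l n) (\<lambda>i. X (int i) \<omega>)) {y. quantile (ecdf (n div l n * l n) y) p - Q n \<omega> \<le> t}
           = HB n \<omega> (Q n \<omega> + ?t / sqrt (real n))"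
        proof -
          have "quantile (ecdf (n div l n * l n) y) p - Q n \<omega> \<le> t \<longleftrightarrow> p \<le> ecdf (n div l n * l n) y (Q n \<omega> + t)" for y
            unfolding diff_le_eq add.commute[of t] by (rule quantile_ecdf_le_iff[OF bl p])
          moreover have "?t / sqrt (real n) = t" using sn by simp
          ultimately show ?thesis unfolding cbb_pmf_def HB_def measure_map_pmf vimage_Collect_eq by (simp only:)
        qed
        have 2: "prob {\<omega>' \<in> space M. Q n \<omega>' - tp \<le> t} = ?P ?t"
          unfolding mult_le_cancel_left_pos[OF sn] ..
        show "\<bar>measure_pmf.prob (cbb_pmf n (l n) (\<lambda>i. X (int i) \<omega>)) {y. quantile (ecdf (n div l n * l n) y) p - Q n \<omega> \<le> t}
          - prob {\<omega>' \<in> space M. Q n \<omega>' - tp \<le> t}\<bar> \<le> \<epsilon>"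
          unfolding 1 2 using spec[OF B, of ?t] spec[OF P, of ?t] by linarith
      qed
    qed
  qed
qed

end

section \<open>Passage from the stated hypotheses to the conclusion\<close>

theorem corollary1:
  fixes M :: "'a measure" and X :: "int \<Rightarrow> 'a \<Rightarrow> real"
    and F :: "real \<Rightarrow> real" and p tp D :: real and l :: "nat \<Rightarrow> nat"
  assumes "prob_space M"
    and "\<And>i. X i \<in> borel_measurable M"
    and "stationary M X"
    and "strongly_mixing M X"
    and "0 < p" and "p < 1"
    and F_def: "F = cdf (distr M borel (X 1))"
    and tp_def: "tp = quantile F p"
    and "D \<noteq> 0"
    and "(\<lambda>h. F (tp + h) - F tp - D * h) \<in> o[at 0](\<lambda>h. h)"
    and "summable (\<lambda>n. mixing_coeff M X (n + 1))"
    and "convergent (\<lambda>n. prob_space.variance M (\<lambda>\<omega>. sqrt (real n) * ecdf n (\<lambda>i. X (int i) \<omega>) tp))"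
    and "lim (\<lambda>n. prob_space.variance M (\<lambda>\<omega>. sqrt (real n) * ecdf n (\<lambda>i. X (int i) \<omega>) tp)) > 0"
    and "\<And>n. n \<ge> 1 \<Longrightarrow> 1 \<le> l n \<and> l n \<le> n"
    and "(\<lambda>n. 1 / real (l n) + real (l n) / real n) \<longlonglongrightarrow> 0"
  shows "tendsto_in_prob M
    (\<lambda>n \<omega>. SUP t.
       \<bar>measure_pmf.prob (cbb_pmf n (l n) (\<lambda>i. X (int i) \<omega>))
           {y. quantile (ecdf (n div l n * l n) y) p
                 - quantile (ecdf n (\<lambda>i. X (int i) \<omega>)) p \<le> t}
        - measure M {\<omega>' \<in> space M. quantile (ecdf n (\<lambda>i. X (int i) \<omega>')) p - tp \<le> t}\<bar>)
    (\<lambda>_. 0)"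
proof -
  interpret prob_space M by fact
  interpret mixing_process M X
    by unfold_locales (use assms in auto)
  interpret F: real_distribution "distr M borel (X 1)" by (rule real_distribution_distr) measurable
  have F_mono: "mono F" unfolding F_def by (rule monoI) (rule F.cdf_nondecreasing)
  have F_\<pi>: "F t = \<pi> {..t}" for t
    unfolding F_def cdf_def \<pi>_def by (subst measure_distr) (auto intro!: arg_cong[of _ _ prob])
  have F_iff: "tp \<le> t \<longleftrightarrow> p \<le> F t" for t
    unfolding tp_def
  proof (rule quantile_le_iff[OF F_mono])
    show "continuous (at_right t) F" for t unfolding F_def by (rule F.cdf_is_right_cont)
    have "\<forall>\<^sub>F t in at_top. p < F t"
      unfolding F_def by (rule order_tendstoD(1)[OF F.cdf_lim_at_top_prob \<open>p < 1\<close>])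
    then obtain t where "p < F t" by (auto simp: eventually_at_top_linorder)
    then show "\<exists>t. p \<le> F t" by (auto intro: less_imp_le)
    have "\<forall>\<^sub>F t in at_bot. F t < p"
      unfolding F_def by (rule order_tendstoD(2)[OF F.cdf_lim_at_bot \<open>0 < p\<close>])
    then show "\<exists>t. F t < p" by (auto simp: eventually_at_bot_linorder)
  qed
  let ?r = "\<lambda>h. F (tp + h) - F tp - D * h"
  have small: "((\<lambda>h. ?r h / h) \<longlongrightarrow> 0) (at 0)"
    by (rule smalloD_tendsto) fact
  have F_cont: "((\<lambda>h. F (tp + h)) \<longlongrightarrow> F tp) (at 0)"
  proof -
    have "((\<lambda>h. ?r h / h * h + D * h + F tp) \<longlongrightarrow> 0 * 0 + D * 0 + F tp) (at 0)"
      by (intro tendsto_intros small)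
    then have "((\<lambda>h. ?r h / h * h + D * h + F tp) \<longlongrightarrow> F tp) (at 0)" by simp
    then show ?thesis
      by (rule Lim_transform_eventually) (auto simp: eventually_at_filter)
  qed
  \<comment> \<open>In general a quantile only gives \<open>p \<le> F tp\<close>. Differentiability
    makes \<open>F\<close> continuous at \<open>tp\<close>, and left of \<open>tp\<close> the values
    stay below \<open>p\<close>.\<close>
  have F_tp: "F tp = p"
  proof (rule antisym)
    have "((\<lambda>h. F (tp + h)) \<longlongrightarrow> F tp) (at_left 0)"
      by (rule tendsto_mono[OF at_le F_cont]) simp
    then show "F tp \<le> p"
    proof (rule tendsto_upperbound)
      show "\<forall>\<^sub>F h in at_left 0. F (tp + h) \<le> p"
        unfolding eventually_at_left_field
      proof (intro exI[of _ "-1"] conjI allI impI)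
        fix h :: real assume "h < 0"
        then have "\<not> p \<le> F (tp + h)" unfolding F_iff[symmetric] by simp
        then show "F (tp + h) \<le> p" by simp
      qed simp
    qed simp
    show "p \<le> F tp" using F_iff[of tp] by simp
  qed
  \<comment> \<open>\<open>F\<close> is monotone, so its difference quotients, and hence the slope,
    are nonnegative.\<close>
  have D_pos: "0 < D"
  proof -
    have "((\<lambda>h. ?r h / h + D) \<longlongrightarrow> 0 + D) (at_right 0)"
      by (intro tendsto_intros tendsto_mono[OF at_le small]) simp
    then have "0 \<le> 0 + D"
    proof (rule tendsto_lowerbound)
      show "\<forall>\<^sub>F h in at_right 0. 0 \<le> ?r h / h + D"
        unfolding eventually_at_right_field
      proof (intro exI[of _ 1] conjI allI impI)
        fix h :: real assume h: "0 < h"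
        have "0 \<le> (F (tp + h) - F tp) / h" using h monoD[OF F_mono, of tp "tp + h"] by simp
        also have "\<dots> = ?r h / h + D" using h by (simp add: field_simps)
        finally show "0 \<le> ?r h / h + D" .
      qed simp
    qed simp
    with \<open>D \<noteq> 0\<close> show ?thesis by simp
  qed
  have deriv: "(\<lambda>n. sqrt (real n) * (\<pi> {..tp + y / sqrt (real n)} - p)) \<longlonglongrightarrow> D * y" for y
  \<comment> \<open>The filter \<open>at 0\<close> excludes increment 0, so this case is
    separate.\<close>
  proof (cases "y = 0")
    case True
    then show ?thesis using F_tp by (simp add: F_\<pi>)
  next
    case False
    have sq: "(\<lambda>n. y / sqrt (real n)) \<longlonglongrightarrow> 0"
      by (intro tendsto_divide_0[OF tendsto_const] filterlim_at_top_imp_at_infinity filterlim_compose[OF sqrt_at_top filterlim_real_sequentially])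
    have "filterlim (\<lambda>n. y / sqrt (real n)) (at 0) sequentially"
      unfolding filterlim_at using sq eventually_gt_at_top[of 0] False by (auto elim!: eventually_mono)
    from filterlim_compose[OF small this]
    have "(\<lambda>n. y * (?r (y / sqrt (real n)) / (y / sqrt (real n))) + D * y) \<longlonglongrightarrow> y * 0 + D * y"
      by (intro tendsto_intros)
    then have "(\<lambda>n. y * (?r (y / sqrt (real n)) / (y / sqrt (real n))) + D * y) \<longlonglongrightarrow> D * y" by simp
    then show ?thesis
    proof (rule Lim_transform_eventually)
      show "\<forall>\<^sub>F n in sequentially. y * (?r (y / sqrt (real n)) / (y / sqrt (real n))) + D * y
          = sqrt (real n) * (\<pi> {..tp + y / sqrt (real n)} - p)"
        using eventually_gt_at_top[of 0]
      proof eventually_elim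
        case (elim n)
        have "y * (v / (y / c)) = c * v" if "c \<noteq> 0" for v c using False that by simp
        moreover have "sqrt (real n) \<noteq> 0" using elim by simp
        ultimately have "y * (?r (y / sqrt (real n)) / (y / sqrt (real n))) = sqrt (real n) * ?r (y / sqrt (real n))" by blast
        also have "\<dots> = sqrt (real n) * (F (tp + y / sqrt (real n)) - p) - D * y"
          using elim by (simp add: F_tp right_diff_distrib)
        finally show ?case unfolding F_\<pi> by simp
      qed
    qed
  qed
  \<comment> \<open>Centring removes the shift \<open>sqrt n * p\<close>, so the variance in the
    hypothesis is the normalised second moment whose limit is
    \<open>\<sigma>2 {..tp}\<close>.\<close>
  have var: "variance (\<lambda>\<omega>. sqrt (real n) * ecdf n (\<lambda>i. X (int i) \<omega>) tp) = expectation (\<lambda>\<omega>. (S {..tp} n \<omega>)\<^sup>2) / n" if n: "1 \<le> n" for n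
  proof -
    have s: "sqrt (real n) * sqrt (real n) = real n" "sqrt (real n) \<noteq> 0" using n by auto
    have Sint: "integrable M (S {..tp} n)" and S0: "expectation (S {..tp} n) = 0"
      unfolding S_def[abs_def] by (simp_all add: Bochner_Integration.integral_sum expectation_Y)
    have gen: "c \<noteq> 0 \<Longrightarrow> c * (v / (c * c)) = v / c" for c v :: real by simp
    have eq: "sqrt (real n) * ecdf n (\<lambda>i. X (int i) \<omega>) tp = S {..tp} n \<omega> / sqrt (real n) + sqrt (real n) * p" for \<omega>
      unfolding ecdf_eq[OF n] F_\<pi>[symmetric] F_tp distrib_left using gen[OF s(2), of "S {..tp} n \<omega>"] unfolding s(1) by simp
    have "expectation (\<lambda>\<omega>. sqrt (real n) * ecdf n (\<lambda>i. X (int i) \<omega>) tp) = sqrt (real n) * p"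
      unfolding eq using Sint S0 by (simp add: prob_space)
    then show ?thesis unfolding eq by (simp add: power_divide)
  qed
  have "(\<lambda>n. variance (\<lambda>\<omega>. sqrt (real n) * ecdf n (\<lambda>i. X (int i) \<omega>) tp)) \<longlonglongrightarrow> \<sigma>2 {..tp}"
  proof (rule Lim_transform_eventually[OF second_moment_S_tendsto])
    show "\<forall>\<^sub>F n in sequentially. expectation (\<lambda>\<omega>. (S {..tp} n \<omega>)\<^sup>2) / n = variance (\<lambda>\<omega>. sqrt (real n) * ecdf n (\<lambda>i. X (int i) \<omega>) tp)"
      using eventually_ge_at_top[of 1] by eventually_elim (simp only: var)
  qed simp
  then have "lim (\<lambda>n. variance (\<lambda>\<omega>. sqrt (real n) * ecdf n (\<lambda>i. X (int i) \<omega>) tp)) = \<sigma>2 {..tp}" by (rule limI)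
  with \<open>lim _ > 0\<close> have \<sigma>_pos: "0 < \<sigma>2 {..tp}" by simp
  have lb: "1 \<le> n \<Longrightarrow> 1 \<le> l n \<and> l n \<le> n" for n by fact
  note llim = \<open>(\<lambda>n. 1 / real (l n) + real (l n) / real n) \<longlonglongrightarrow> 0\<close>
  \<comment> \<open>Both summands are nonnegative, so each is squeezed between 0 and the
    sum.\<close>
  have inv_l: "(\<lambda>n. 1 / real (l n)) \<longlonglongrightarrow> 0"
    by (rule tendsto_sandwich[OF _ _ tendsto_const llim]) auto
  have l_small: "(\<lambda>n. real (l n) / real n) \<longlonglongrightarrow> 0"
    by (rule tendsto_sandwich[OF _ _ tendsto_const llim]) auto
  have l_inf: "filterlim l at_top sequentially"
    unfolding filterlim_at_top
  proof
    fix N :: nat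
    have "\<forall>\<^sub>F n in sequentially. 1 / real (l n) < 1 / real (N + 1)"
      by (rule order_tendstoD(2)[OF inv_l]) simp
    then show "\<forall>\<^sub>F n in sequentially. N \<le> l n"
      using eventually_ge_at_top[of 1]
    proof eventually_elim
      case (elim n)
      have "0 < real (l n)" using lb[OF elim(2)] by simp
      then have "real (N + 1) < real (l n)" using elim(1) by (simp add: field_simps)
      then show ?case by simp
    qed
  qed
  interpret quantile_bootstrap M X l p tp D "sqrt (\<sigma>2 {..tp})"
    by unfold_locales (use assms(5,6) F_tp D_pos \<sigma>_pos deriv lb l_inf l_small in \<open>auto simp: F_\<pi>\<close>)
  let ?d = "\<lambda>n \<omega> t. \<bar>measure_pmf.prob (cbb_pmf n (l n) (\<lambda>i. X (int i) \<omega>))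
           {y. quantile (ecdf (n div l n * l n) y) p - Q n \<omega> \<le> t}
        - prob {\<omega>' \<in> space M. Q n \<omega>' - tp \<le> t}\<bar>"
  show ?thesis
    unfolding tendsto_in_prob_def Q_def[symmetric]
  proof (intro conjI allI impI)
    show "(\<lambda>\<omega>. SUP t. ?d n \<omega> t) \<in> borel_measurable M" for n
      unfolding Q_def by (rule bootstrap_distance_measurable[OF prob_space_axioms X_measurable p])
    fix \<epsilon> :: real assume \<epsilon>: "0 < \<epsilon>"
    show "(\<lambda>n. prob {\<omega>\<in>space M. \<epsilon> < \<bar>(SUP t. ?d n \<omega> t) - 0\<bar>}) \<longlonglongrightarrow> 0"
    proof (rule LIMSEQ_I)
      fix r :: real assume r: "0 < r"
      then have "0 < r / 2" by simp
      \<comment> \<open>\<open>r / 2\<close> because \<open>whp\<close> bounds by a weak inequality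
        and the limit asks for a strict one. Outside the covering event the bound holds for all
        \<open>t\<close> at once, hence for the supremum.\<close>
      from bootstrap_quantile_uniform[OF this \<epsilon>]
      have "\<forall>\<^sub>F n in sequentially. norm (prob {\<omega>\<in>space M. \<epsilon> < \<bar>(SUP t. ?d n \<omega> t) - 0\<bar>} - 0) < r"
        unfolding whp_def
      proof eventually_elim
        case (elim n)
        then obtain A where A: "A \<in> events" "prob A \<le> r / 2" "{\<omega>\<in>space M. \<not> (\<forall>t. ?d n \<omega> t \<le> \<epsilon>)} \<subseteq> A" by blast
        have "{\<omega>\<in>space M. \<epsilon> < \<bar>(SUP t. ?d n \<omega> t) - 0\<bar>} \<subseteq> A"
        proof (rule order_trans[OF _ A(3)], rule Collect_mono, intro impI conjI notI, elim conjE, assumption, elim conjE)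
          fix \<omega> assume "\<epsilon> < \<bar>(SUP t. ?d n \<omega> t) - 0\<bar>" and le: "\<forall>t. ?d n \<omega> t \<le> \<epsilon>"
          have "(SUP t. ?d n \<omega> t) \<le> \<epsilon>" by (rule cSUP_least) (use le in auto)
          moreover have "?d n \<omega> 0 \<le> (SUP t. ?d n \<omega> t)"
            by (rule cSUP_upper) (use le in \<open>auto intro!: bdd_aboveI[of _ \<epsilon>]\<close>)
          then have "0 \<le> (SUP t. ?d n \<omega> t)" by (rule order_trans[OF abs_ge_zero])
          ultimately show False using \<open>\<epsilon> < _\<close> by linarith
        qed
        then have "prob {\<omega>\<in>space M. \<epsilon> < \<bar>(SUP t. ?d n \<omega> t) - 0\<bar>} \<le> prob A"
          by (rule finite_measure_mono) (rule A(1))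
        then show ?case using A(2) r by simp
      qed
      then show "\<exists>no. \<forall>n\<ge>no. norm (prob {\<omega>\<in>space M. \<epsilon> < \<bar>(SUP t. ?d n \<omega> t) - 0\<bar>} - 0) < r"
        by (simp only: eventually_sequentially)
    qed
  qed simp
qed

end
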